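(* Let $m\ge 2$, $1<p_0<\infty$, $\frac1{p_0}+\frac1{p_0'}=1$, $0<\alpha p_0'<mn$, and let $T_\alpha$ be an $m$-linear fractional integral operator with generalized kernel on $\mathbb{R}^n$ (with constants $C_k$, $k\ge1$, in its smoothness condition) such that $\sum_{k=1}^\infty C_k<\infty$. Let $\vec P=(p_1,\ldots,p_m)$, $\frac1p=\frac1{p_1}+\cdots+\frac1{p_m}$ with $p_0'\le p_j<\infty$ ($j=1,\ldots,m$), $\frac1q=\frac1p-\frac{\alpha}{n}>0$, and $\vec\omega=(\omega_1,\ldots,\omega_m)\in A_{\frac{\vec P}{p_0'},\frac{q}{p_0'}}$, and write $v_{\vec\omega}=\prod_{j=1}^m\omega_j$. (i) If $p_0'<p_j<\infty$ for all $j=1,\ldots,m$, then there is a constant $C>0$ such that for all $f_j\in L^{p_j}(\omega_j^{p_j/p_0'})$, $j=1,\ldots,m$, $$\left\|T_\alpha(f_1,\ldots,f_m)\right\|_{L^q\left(v_{\vec\omega}^{q/p_0'}\right)}\le C\prod_{j=1}^m\|f_j\|_{L^{p_j}\left(\omega_j^{p_j/p_0'}\right)}.$$ (ii) If $p_0'\le p_j<\infty$ for all $j=1,\ldots,m$ and at least one $p_j$ equals $p_0'$, then there is a constant $C>0$ such that for all $f_j\in L^{p_j}(\omega_j^{p_j/p_0'})$, $j=1,\ldots,m$, $$\left\|T_\alpha(f_1,\ldots,f_m)\right\|_{L^{q,\infty}\left(v_{\vec\omega}^{q/p_0'}\right)}\le C\prod_{j=1}^m\|f_j\|_{L^{p_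j}\left(\omega_j^{p_j/p_0'}\right)}.$$
   Context: Cubes in $\mathbb{R}^n$ have sides parallel to the axes; $Q(x,r)$ is the cube centered at $x$ with side length $r$; $|E|$ is Lebesgue measure; for a set $E$, $(E)^m=E\times\cdots\times E$ ($m$ factors); $\vec y=(y_1,\ldots,y_m)\in(\mathbb{R}^n)^m$, $d\vec y=dy_1\cdots dy_m$. Operator. Fix $1<p_0<\infty$, $\frac1{p_0}+\frac1{p_0'}=1$, and $\alpha$ with $0<\alpha p_0'<mn$. Let $K_\alpha(x,y_1,\ldots,y_m)$ be a locally integrable function defined away from the diagonal $x=y_1=\cdots=y_m$ in $(\mathbb{R}^n)^{m+1}$. Let $T_\alpha:\mathscr S(\mathbb{R}^n)\times\cdots\times\mathscr S(\mathbb{R}^n)\to\mathscr S'(\mathbb{R}^n)$ be $m$-linear with $$T_\alpha(\vec f)(x)=\int_{(\mathbb{R}^n)^m}K_\alpha(x,\vec y)\prod_{j=1}^m f_j(y_j)\,d\vec y\quad\text{for } x\notin\bigcap_{j=1}^m\operatorname{supp}f_j .$$ $T_\alpha$ is called an $m$-linear fractional integral operator with generalized kernel if: (1a) (size) for some $A>0$, $|K_\alpha(x,\vec y)|\le A\big(\sum_{j=1}^m|x-y_j|\big)^{-(mn-\alpha)}$; (1b) (smoothness) there are a constant $C>0$ and positive constants $C_k$, $k\in\{1,2,\ldots\}$, such that for all $k\geq 1$ and all $x\ne x'$ in $\mathbb{R}^n$, $$\left(\int_{Q(x,2^{k+2}\sqrt{mn}|x-x'|)^m\setminus Q(x,2^{k+1}\sqrt{mn}|x-x'|)^m}|K_\alpha(x,\vec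 y)-K_\alpha(x',\vec y)|^{p_0}d\vec y\right)^{1/p_0}\le C\,C_k\,2^{k(\alpha-\frac{mn}{p_0'})}|x-x'|^{\alpha-\frac{mn}{p_0'}};$$ (2) for some fixed $1\le s_1,\ldots,s_m\le p_0'$ with $\frac1s=\frac1{s_1}+\cdots+\frac1{s_m}$, $T_\alpha$ maps $L^{s_1}\times\cdots\times L^{s_m}$ boundedly into $L^{\frac{sn}{n-s\alpha},\infty}$. By (2), $T_\alpha$ is defined on $L^{s_1}\times\cdots\times L^{s_m}$, in particular on tuples of bounded measurable functions with compact support, and is still given there by the kernel formula. Norm estimates are understood in the usual sense: they hold for all bounded compactly supported measurable $f_j$ in the spaces on the right-hand side, the operator on general tuples being the continuous extension from this dense class. Weighted spaces. For a nonnegative function $w$, $\|f\|_{L^p(w)}=\left(\int|f|^p w\,dx\right)^{1/p}$ and $\|f\|_{L^{p,\infty}(w)}=\sup_{\lambda>0}\lambda\, \left(w(\{x:|f(x)|>\lambda\})\right)^{1/p}$, where $w(E)=\int_E w\,dx$. Weight class. For $\vec R=(r_1,\ldots,r_m)$ with $1\le r_j<\infty$, $\frac1r=\sum_j\frac1{r_j}$, $r\le u<\infty$, and nonnegative functions $\omega_1,\ldots,\omega_m$ on $\mathbb{R}^n$, $\vec\omega\in A_{\vec R,u}$ means $$\sup_Q\left(\frac1{|Q|}\int_Q v_{\vec\omega}(x)^{u}dx\right)^{1/u}\prod_{j=1}^m\left(\frac1{|Q|}\int_Q\omega_j(x)^{-r_j'}dx\right)^{1/r_j'}<\infty,\qquad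 v_{\vec\omega}=\prod_{j=1}^m\omega_j,$$ the supremum over all cubes $Q$, with $r_j'$ the conjugate exponent of $r_j$, and the $j$-th factor understood as $(\inf_Q\omega_j)^{-1}$ when $r_j=1$. Here $\vec P/p_0'=(p_1/p_0',\ldots,p_m/p_0')$. *)

theory Defs
  imports "HOL-Analysis.Analysis"
begin

subsection \<open>Schwartz functions and tempered distributions\<close>

primrec iter_deriv :: "'a::euclidean_space list \<Rightarrow> ('a \<Rightarrow> complex) \<Rightarrow> 'a \<Rightarrow> complex" where
  "iter_deriv [] f = f"
| "iter_deriv (b # bs) f = (\<lambda>x. frechet_derivative (iter_deriv bs f) (at x) b)"

definition schwartz :: "('a::euclidean_space \<Rightarrow> complex) set" where
  "schwartz = {f. \<forall>bs. set bs \<subseteq> Basis \<longrightarrow>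
      (\<forall>x. iter_deriv bs f differentiable (at x)) \<and>
      (\<forall>N. bounded (range (\<lambda>x. (1 + norm x) ^ N * norm (iter_deriv bs f x))))}"

definition schwartz_seminorm :: "'a::euclidean_space list \<Rightarrow> nat \<Rightarrow> ('a \<Rightarrow> complex) \<Rightarrow> real" where
  "schwartz_seminorm bs N f = (SUP x. (1 + norm x) ^ N * norm (iter_deriv bs f x))"

text \<open>Functionals are total functions on \<^typ>\<open>'a \<Rightarrow> complex\<close>; only their values on
  \<^const>\<open>schwartz\<close> matter. As the Schwartz space is metrizable, continuity is sequential continuity.\<close>

definition tempered_distribution :: "(('a::euclidean_space \<Rightarrow> complex) \<Rightarrow> complex) \<Rightarrow> bool" where
  "tempered_distribution u \<longleftrightarrow>
     (\<forall>\<phi>\<in>schwartz. \<forall>\<psi>\<in>schwartz. \<forall>a b.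
        u (\<lambda>x. a * \<phi> x + b * \<psi> x) = a * u \<phi> + b * u \<psi>) \<and>
     (\<forall>\<Phi> \<phi>. (\<forall>k::nat. \<Phi> k \<in> schwartz) \<and> \<phi> \<in> schwartz \<and>
        (\<forall>bs N. set bs \<subseteq> Basis \<longrightarrow>
           (\<lambda>k. schwartz_seminorm bs N (\<lambda>x. \<Phi> k x - \<phi> x)) \<longlonglongrightarrow> 0)
        \<longrightarrow> (\<lambda>k. u (\<Phi> k)) \<longlonglongrightarrow> u \<phi>)"

definition supp :: "('a::topological_space \<Rightarrow> complex) \<Rightarrow> 'a set" where
  "supp f = closure {x. f x \<noteq> 0}"

text \<open>The distribution \<open>u\<close> is given by the function \<open>g\<close> on the open set \<open>U\<close>.\<close>

definition given_by_on ::
  "'a::euclidean_space set \<Rightarrow> (('a \<Rightarrow> complex) \<Rightarrow> complex) \<Rightarrow> ('a \<Rightarrow> complex) \<Rightarrow> bool" where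
  "given_by_on U u g \<longleftrightarrow>
     (\<forall>\<phi>\<in>schwartz. compact (supp \<phi>) \<and> supp \<phi> \<subseteq> U \<longrightarrow>
        integrable lebesgue (\<lambda>x. g x * \<phi> x) \<and> u \<phi> = (LINT x|lebesgue. g x * \<phi> x))"

subsection \<open>Weighted Lebesgue spaces\<close>

text \<open>\<open>epow x a\<close> is \<open>x\<^sup>a\<close> for \<open>x \<in> [0,\<infinity>]\<close> and \<open>a > 0\<close>.\<close>

definition epow :: "ennreal \<Rightarrow> real \<Rightarrow> ennreal" where
  "epow x a = (if x = top then top else ennreal (enn2real x powr a))"

definition Lp_norm :: "real \<Rightarrow> (real^'n \<Rightarrow> real) \<Rightarrow> (real^'n \<Rightarrow> complex) \<Rightarrow> ennreal" where
  "Lp_norm p w f = epow (\<integral>\<^sup>+ x. ennreal (norm (f x) powr p * w x) \<partial>lebesgue) (1 / p)"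

definition weak_Lp_norm :: "real \<Rightarrow> (real^'n \<Rightarrow> real) \<Rightarrow> (real^'n \<Rightarrow> complex) \<Rightarrow> ennreal" where
  "weak_Lp_norm p w f = (SUP l\<in>{0<..}.
     ennreal l * epow (\<integral>\<^sup>+ x\<in>{x. l < norm (f x)}. ennreal (w x) \<partial>lebesgue) (1 / p))"

definition Lp_space :: "real \<Rightarrow> (real^'n \<Rightarrow> real) \<Rightarrow> (real^'n \<Rightarrow> complex) set" where
  "Lp_space p w = {f. f \<in> borel_measurable lebesgue \<and> Lp_norm p w f < top}"

definition bounded_compact_supp :: "(real^'n \<Rightarrow> complex) set" where
  "bounded_compact_supp =
     {f. f \<in> borel_measurable lebesgue \<and> bounded (range f) \<and> compact (supp f)}"

subsection \<open>Cubes and the weight class\<close>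

definition cube :: "real^'n \<Rightarrow> real \<Rightarrow> (real^'n) set" where
  "cube x r = cbox (\<chi> i. x $ i - r / 2) (\<chi> i. x $ i + r / 2)"

definition avg :: "(real^'n) set \<Rightarrow> (real^'n \<Rightarrow> ennreal) \<Rightarrow> ennreal" where
  "avg Q g = (\<integral>\<^sup>+ x\<in>Q. g x \<partial>lebesgue) / emeasure lebesgue Q"

definition ess_inf_on :: "(real^'n) set \<Rightarrow> (real^'n \<Rightarrow> real) \<Rightarrow> ennreal" where
  "ess_inf_on Q w = Sup {c. AE x in lebesgue. x \<in> Q \<longrightarrow> c \<le> ennreal (w x)}"

text \<open>The factor \<open>(1/|Q| \<integral>\<^sub>Q w\<^sup>-\<^sup>r\<^sup>')\<^sup>1\<^sup>/\<^sup>r\<^sup>'\<close> with \<open>r' = r / (r - 1)\<close>. The inverse is taken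
  in \<^typ>\<open>ennreal\<close>, so a vanishing weight contributes \<open>\<infinity>\<close> (whereas \<open>0 powr a = 0\<close>).\<close>

definition dual_factor :: "(real^'n) set \<Rightarrow> real \<Rightarrow> (real^'n \<Rightarrow> real) \<Rightarrow> ennreal" where
  "dual_factor Q r w =
     (if r = 1 then inverse (ess_inf_on Q w)
      else epow (avg Q (\<lambda>x. inverse (ennreal (w x powr (r / (r - 1)))))) ((r - 1) / r))"

definition v_weight :: "('m::finite \<Rightarrow> real^'n \<Rightarrow> real) \<Rightarrow> real^'n \<Rightarrow> real" where
  "v_weight \<omega> x = (\<Prod>j\<in>UNIV. \<omega> j x)"

definition weight_class ::
  "('m::finite \<Rightarrow> real) \<Rightarrow> real \<Rightarrow> ('m \<Rightarrow> real^'n \<Rightarrow> real) set" where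
  "weight_class R u = {\<omega>.
     (\<forall>j. \<omega> j \<in> borel_measurable lebesgue \<and> (\<forall>x. 0 \<le> \<omega> j x)) \<and>
     (SUP (x, \<rho>) \<in> UNIV \<times> {0<..}.
        epow (avg (cube x \<rho>) (\<lambda>y. ennreal (v_weight \<omega> y powr u))) (1 / u) *
        (\<Prod>j\<in>UNIV. dual_factor (cube x \<rho>) (R j) (\<omega> j))) < top}"

subsection \<open>Multilinear fractional integral operators with generalized kernel\<close>

text \<open>The number \<open>m\<close> of factors is \<open>CARD('m)\<close>, the dimension \<open>n\<close> is \<open>CARD('n)\<close>, and
  \<open>(\<real>\<^sup>n)\<^sup>m\<close> is \<^typ>\<open>real^'n^'m\<close>.\<close>

definition kernel_integral ::
  "(real^'n \<Rightarrow> real^'n^'m \<Rightarrow> complex) \<Rightarrow> ('m::finite \<Rightarrow> real^'n \<Rightarrow> complex) \<Rightarrow> real^'n \<Rightarrow> complex" where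
  "kernel_integral K f x = (LINT y|lebesgue. K x y * (\<Prod>j\<in>UNIV. f j (y $ j)))"

definition diagonal :: "((real^'n) \<times> (real^'n^'m)) set" where
  "diagonal = {(x, y). \<forall>j. y $ j = x}"

text \<open>Values of \<open>K\<close> on the diagonal are irrelevant. Measurability of each \<open>K x\<close> is what gives meaning
  to the integrals over \<open>y\<close> at a fixed \<open>x\<close>; joint measurability only yields it for almost every \<open>x\<close>.\<close>

definition kernel_locally_integrable :: "(real^'n \<Rightarrow> real^'n^'m \<Rightarrow> complex) \<Rightarrow> bool" where
  "kernel_locally_integrable K \<longleftrightarrow>
     (\<forall>S. compact S \<and> S \<inter> diagonal = {} \<longrightarrow> set_integrable lebesgue S (\<lambda>z. K (fst z) (snd z))) \<and>
     (\<forall>x. K x \<in> borel_measurable lebesgue)"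

definition kernel_size :: "real \<Rightarrow> (real^'n \<Rightarrow> real^'n^'m \<Rightarrow> complex) \<Rightarrow> bool" where
  "kernel_size \<alpha> K \<longleftrightarrow> (\<exists>A>0. \<forall>x y. (x, y) \<notin> diagonal \<longrightarrow>
     norm (K x y) \<le>
       A * (\<Sum>j\<in>UNIV. norm (x - y $ j)) powr (- (real CARD('m) * real CARD('n) - \<alpha>)))"

definition kernel_smooth ::
  "real \<Rightarrow> real \<Rightarrow> real \<Rightarrow> (nat \<Rightarrow> real) \<Rightarrow> (real^'n \<Rightarrow> real^'n^'m \<Rightarrow> complex) \<Rightarrow> bool" where
  "kernel_smooth p0 p0' \<alpha> Ck K \<longleftrightarrow>
     (\<forall>k\<ge>1. Ck k > 0) \<and>
     (\<exists>C>0. \<forall>k\<ge>1. \<forall>x x'. x \<noteq> x' \<longrightarrow>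
        (let d = norm (x - x'); mn = real CARD('m) * real CARD('n);
             B = (\<lambda>i. {y. \<forall>j. y $ j \<in> cube x (2 ^ i * sqrt mn * d)})
         in epow (\<integral>\<^sup>+ y\<in>B (k + 2) - B (k + 1). ennreal (norm (K x y - K x' y) powr p0) \<partial>lebesgue)
                 (1 / p0)
            \<le> ennreal (C * Ck k * 2 powr (real k * (\<alpha> - mn / p0')) * d powr (\<alpha> - mn / p0'))))"

text \<open>\<open>T0\<close> is the operator on Schwartz tuples, with values in the tempered distributions.\<close>

definition multilinear_on_schwartz ::
  "(('m::finite \<Rightarrow> real^'n \<Rightarrow> complex) \<Rightarrow> (real^'n \<Rightarrow> complex) \<Rightarrow> complex) \<Rightarrow> bool" where
  "multilinear_on_schwartz T0 \<longleftrightarrow>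
     (\<forall>f. (\<forall>j. f j \<in> schwartz) \<longrightarrow>
        tempered_distribution (T0 f) \<and>
        (\<forall>i. \<forall>g\<in>schwartz. \<forall>a b. \<forall>\<phi>\<in>schwartz.
           T0 (f(i := \<lambda>x. a * f i x + b * g x)) \<phi> = a * T0 f \<phi> + b * T0 (f(i := g)) \<phi>))"

text \<open>\<open>T\<close> is the bounded \<open>m\<close>-linear operator from \<open>L\<^bsup>s\<^sub>1\<^esup> \<times> \<dots> \<times> L\<^bsup>s\<^sub>m\<^esup>\<close> into \<open>L\<^bsup>t,\<infinity>\<^esup>\<close> that \<open>T0\<close> induces: its
  values are functions modulo null sets which, on Schwartz tuples, represent the distributions given
  by \<open>T0\<close>; on bounded functions of compact support the kernel formula persists.\<close>

definition bounded_weak_extension ::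
  "('m::finite \<Rightarrow> real) \<Rightarrow> real \<Rightarrow> (real^'n \<Rightarrow> real^'n^'m \<Rightarrow> complex) \<Rightarrow>
   (('m \<Rightarrow> real^'n \<Rightarrow> complex) \<Rightarrow> (real^'n \<Rightarrow> complex) \<Rightarrow> complex) \<Rightarrow>
   (('m \<Rightarrow> real^'n \<Rightarrow> complex) \<Rightarrow> real^'n \<Rightarrow> complex) \<Rightarrow> bool" where
  "bounded_weak_extension s t K T0 T \<longleftrightarrow>
     (\<forall>f. (\<forall>j. f j \<in> Lp_space (s j) (\<lambda>_. 1)) \<longrightarrow>
        T f \<in> borel_measurable lebesgue \<and>
        (\<forall>i. \<forall>g \<in> Lp_space (s i) (\<lambda>_. 1). \<forall>a b. AE x in lebesgue.
           T (f(i := \<lambda>x. a * f i x + b * g x)) x = a * T f x + b * T (f(i := g)) x)) \<and>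
     (\<exists>B>0. \<forall>f. (\<forall>j. f j \<in> Lp_space (s j) (\<lambda>_. 1)) \<longrightarrow>
        weak_Lp_norm t (\<lambda>_. 1) (T f) \<le> ennreal B * (\<Prod>j\<in>UNIV. Lp_norm (s j) (\<lambda>_. 1) (f j))) \<and>
     (\<forall>f. (\<forall>j. f j \<in> schwartz) \<longrightarrow> given_by_on UNIV (T0 f) (T f)) \<and>
     (\<forall>f. (\<forall>j. f j \<in> bounded_compact_supp) \<longrightarrow>
        (AE x in lebesgue. x \<notin> (\<Inter>j. supp (f j)) \<longrightarrow> T f x = kernel_integral K f x))"

definition frac_integral_operator ::
  "real \<Rightarrow> real \<Rightarrow> real \<Rightarrow> (nat \<Rightarrow> real) \<Rightarrow> (real^'n \<Rightarrow> real^'n^'m \<Rightarrow> complex) \<Rightarrow>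
   (('m::finite \<Rightarrow> real^'n \<Rightarrow> complex) \<Rightarrow> (real^'n \<Rightarrow> complex) \<Rightarrow> complex) \<Rightarrow>
   (('m \<Rightarrow> real^'n \<Rightarrow> complex) \<Rightarrow> real^'n \<Rightarrow> complex) \<Rightarrow> bool" where
  "frac_integral_operator p0 p0' \<alpha> Ck K T0 T \<longleftrightarrow>
     kernel_locally_integrable K \<and>
     multilinear_on_schwartz T0 \<and>
     (\<forall>f. (\<forall>j. f j \<in> schwartz) \<longrightarrow>
        given_by_on (- (\<Inter>j. supp (f j))) (T0 f) (kernel_integral K f)) \<and>
     kernel_size \<alpha> K \<and>
     kernel_smooth p0 p0' \<alpha> Ck K \<and>
     (\<exists>s \<sigma>. (\<forall>j. 1 \<le> s j \<and> s j \<le> p0') \<and> 1 / \<sigma> = (\<Sum>j\<in>UNIV. 1 / s j) \<and>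
        bounded_weak_extension s (\<sigma> * real CARD('n) / (real CARD('n) - \<sigma> * \<alpha>)) K T0 T)"

subsection \<open>Extension to weighted spaces\<close>

text \<open>\<open>S\<close> is the continuous extension of \<open>T\<close> from the tuples of bounded functions of compact support
  to all tuples in \<open>L\<^bsup>p\<^sub>1\<^esup>(w\<^sub>1) \<times> \<dots> \<times> L\<^bsup>p\<^sub>m\<^esup>(w\<^sub>m)\<close>, the target carrying the quasi-norm \<open>N\<close>. Constant
  sequences \<open>g\<close> show that \<open>S f\<close> and \<open>T f\<close> are at distance \<open>0\<close> in the target for \<open>f\<close> in the dense
  class, so an estimate for \<open>S\<close> contains the one for \<open>T\<close> on that class.\<close>

definition continuous_extension ::
  "('m::finite \<Rightarrow> real) \<Rightarrow> ('m \<Rightarrow> real^'n \<Rightarrow> real) \<Rightarrow> ((real^'n \<Rightarrow> complex) \<Rightarrow> ennreal) \<Rightarrow>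
   (('m \<Rightarrow> real^'n \<Rightarrow> complex) \<Rightarrow> real^'n \<Rightarrow> complex) \<Rightarrow>
   (('m \<Rightarrow> real^'n \<Rightarrow> complex) \<Rightarrow> real^'n \<Rightarrow> complex) \<Rightarrow> bool" where
  "continuous_extension p w N T S \<longleftrightarrow>
     (\<forall>f. (\<forall>j. f j \<in> Lp_space (p j) (w j)) \<longrightarrow>
        S f \<in> borel_measurable lebesgue \<and>
        (\<forall>g. (\<forall>k::nat. \<forall>j. g k j \<in> bounded_compact_supp \<inter> Lp_space (p j) (w j)) \<and>
             (\<forall>j. (\<lambda>k. Lp_norm (p j) (w j) (\<lambda>x. g k j x - f j x)) \<longlonglongrightarrow> 0)
             \<longrightarrow> (\<lambda>k. N (\<lambda>x. T (g k) x - S f x)) \<longlonglongrightarrow> 0))"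

end

theory Submission
  imports Defs
begin

text \<open>
  The operator is dominated by a dyadic potential, and the weight condition is strong enough to bound
  this potential by sums over cubes that hardly overlap.

  \<^bold>\<open>Reduction to a positive operator.\<close> By the size condition the kernel integral is at most a
  constant times \<open>J \<phi> x = \<Sum>\<^sub>j 2\<^sup>j\<^sup>\<alpha> \<Prod>\<^sub>i avg \<phi>\<^sub>i\<close>, the averages being over the cube of side \<open>3 2\<^sup>j\<close> around
  the dyadic cell of \<open>x\<close> (\<open>kernel_potential_bound\<close>). The kernel formula is given only off the common
  support of the \<open>f\<^sub>j\<close>. On the common support, the difference \<open>D\<close> of the operator and the kernel
  integral is local: on a cell \<open>Q\<close> it depends only on the restrictions \<open>f\<^sub>j 1\<^sub>Q\<close>. The weak type bound
  from \<open>L\<^bsup>s\<^sub>1\<^esup> \<times> \<dots> \<times> L\<^bsup>s\<^sub>m\<^esup>\<close> into \<open>L\<^bsup>t,\<infinity>\<^esup>\<close> with \<open>1/t = \<Sum>\<^sub>j 1/s\<^sub>j - \<alpha>/n\<close> shows that \<open>D\<close> can be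
  large on a part of \<open>Q\<close> of measure at most \<open>C |Q|\<^bsup>1 + \<delta>\<^esup>\<close> only. Summing over ever smaller cells gives
  \<open>D = 0\<close> (\<open>operator_eq_kernel_integral\<close>).

  \<^bold>\<open>The weights.\<close> Put \<open>w\<^sub>j = \<omega>\<^sub>j\<^bsup>1/p\<^sub>0'\<^esup>\<close>. The weight condition implies that
  \<open>(avg (\<Prod>\<^sub>j w\<^sub>j)\<^sup>q)\<^bsup>1/q\<^esup> \<Prod>\<^sub>j (avg w\<^sub>j\<^bsup>-\<rho>\<^sub>j\<^esup>)\<^bsup>1/\<rho>\<^sub>j\<^esup>\<close> is bounded over all cubes, and here \<open>\<rho>\<^sub>j\<close> exceeds the
  conjugate exponent of \<open>P\<^sub>j\<close>, because \<open>p\<^sub>0' > 1\<close>. So Hoelder's inequality with \<open>\<rho>\<^sub>j\<close> and its conjugate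
  \<open>a\<^sub>j\<close> bounds the averages of \<open>\<phi>\<^sub>j\<close> by those of \<open>h\<^sub>j = (\<phi>\<^sub>j w\<^sub>j)\<^bsup>a\<^sub>j\<^esup>\<close>, and there is room for the maximal theorem
  on \<open>L\<^bsup>P\<^sub>j/a\<^sub>j\<^esup>\<close>, since \<open>a\<^sub>j < P\<^sub>j\<close>. The same condition gives the measure \<open>V = (\<Prod>\<^sub>j w\<^sub>j)\<^sup>q dx\<close> the
  property \<open>V(Q) \<le> C V(E)\<close> for \<open>E \<subseteq> Q\<close> with \<open>|E| \<ge> |Q|/2\<close>.

  \<^bold>\<open>The weighted estimate\<close> (\<open>dyadic_potential_bound\<close>). Fix a large base \<open>A\<close> and let \<open>\<Omega>\<^sub>k\<close> be the set where
  some product of averages exceeds \<open>A\<^sup>k\<close>, cut into the maximal cells with this property. Within each of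
  these cells the sum over the scales is geometric, so \<open>J \<phi> \<le> C \<Sum>\<^sub>k \<lambda>\<^sub>k 1\<^bsub>\<Omega>\<^sub>k\<^esub>\<close> with \<open>\<lambda>\<^sub>k\<close> constant on
  the cells of level \<open>k\<close>. The weak type of the maximal function shows that \<open>\<Omega>\<^bsub>k+1\<^esub>\<close> fills at most half of each such cell.
  Hence its \<open>V\<close>-measure decays geometrically in \<open>k\<close>, and this decay permits to replace the \<open>q\<close>-th power
  of the sum by the sum of the \<open>q\<close>-th powers, for every \<open>q > 0\<close>. Each \<open>\<integral> \<lambda>\<^sub>k\<^sup>q dV\<close> is then compared,
  cell by cell, with an integral over the disjoint sets \<open>\<Omega>\<^sub>k - \<Omega>\<^bsub>k+1\<^esub>\<close> of products of maximal functions
  of the \<open>h\<^sub>j\<close>; the gain \<open>q > p\<close> absorbs the factor \<open>2\<^sup>j\<^sup>\<alpha>\<close>.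

  \<^bold>\<open>Extension.\<close> The kernel integral converges absolutely almost everywhere for all tuples in the
  weighted spaces and is the continuous extension sought. This is a strong type estimate also when some
  \<open>P\<^sub>j = p\<^sub>0'\<close>, and Chebyshev's inequality yields the weak one. If \<open>\<Prod>\<^sub>j \<omega>\<^sub>j = 0\<close> almost everywhere, the target
  norm vanishes identically; in all other cases the condition on large cubes forces every \<open>\<omega>\<^sub>j\<close> to be
  positive almost everywhere (\<open>degenerate_or_positive\<close>).
\<close>

section \<open>Powers of extended nonnegative reals and Hoelder's inequality\<close>

lemma epow_zero [simp]: "epow 0 a = 0"
  by (simp add: epow_def)

lemma epow_top [simp]: "epow top a = top"
  by (simp add: epow_def)

lemma epow_ennreal: "0 \<le> x \<Longrightarrow> epow (ennreal x) a = ennreal (x powr a)"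
  by (simp add: epow_def)

lemma epow_one_exponent [simp]: "epow x 1 = x"
  by (cases x) (simp_all add: epow_ennreal)

lemma epow_mono: "0 \<le> a \<Longrightarrow> x \<le> y \<Longrightarrow> epow x a \<le> epow y a"
  by (cases x; cases y) (auto simp: epow_ennreal powr_mono2 top_unique)

lemma epow_mult: "0 < a \<Longrightarrow> epow (x * y) a = epow x a * epow y a"
proof (cases x; cases y)
  fix r s assume "x = ennreal r" "0 \<le> r" "y = ennreal s" "0 \<le> s"
  then show ?thesis by (simp add: epow_ennreal powr_mult flip: ennreal_mult)
next
  fix r assume a: "0 < a" and *: "x = ennreal r" "0 \<le> r" "y = top"
  then show ?thesis by (cases "r = 0") (simp_all add: epow_ennreal ennreal_mult_top ennreal_mult_eq_top_iff)
next
  fix r assume a: "0 < a" and *: "x = top" "y = ennreal r" "0 \<le> r"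
  then show ?thesis by (cases "r = 0") (simp_all add: epow_ennreal ennreal_top_mult ennreal_mult_eq_top_iff)
qed (simp add: ennreal_mult_eq_top_iff)

lemma epow_prod: "finite I \<Longrightarrow> 0 < a \<Longrightarrow> epow (\<Prod>i\<in>I. x i) a = (\<Prod>i\<in>I. epow (x i) a)"
proof (induction I rule: finite_induct)
  case empty
  have "epow (ennreal 1) a = 1" by (subst epow_ennreal) auto
  then show ?case by simp
qed (simp add: epow_mult)

lemma epow_epow: "epow (epow x a) b = epow x (a * b)"
  by (cases x) (simp_all add: epow_ennreal powr_powr)

lemma epow_add: "0 < a \<Longrightarrow> 0 < b \<Longrightarrow> epow x (a + b) = epow x a * epow x b"
  by (cases x) (simp_all add: epow_ennreal powr_add ennreal_mult)

lemma epow_eq_top_iff [simp]: "epow x a = top \<longleftrightarrow> x = top"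
  by (cases x) (simp_all add: epow_ennreal)

lemma epow_less_top_iff [simp]: "epow x a < top \<longleftrightarrow> x < top"
  by (simp add: less_top[symmetric])

lemma epow_eq_0_iff [simp]: "epow x a = 0 \<longleftrightarrow> x = 0"
  by (cases x) (simp_all add: epow_ennreal)

lemma epow_le_iff: assumes a: "0 < a" shows "epow x a \<le> epow y a \<longleftrightarrow> x \<le> y"
proof
  assume le: "epow x a \<le> epow y a"
  have "epow (epow x a) (1/a) \<le> epow (epow y a) (1/a)" by (rule epow_mono) (use a le in auto)
  moreover have "a * (1/a) = 1" using a by simp
  ultimately show "x \<le> y" by (simp only: epow_epow epow_one_exponent)
qed (use a in \<open>simp add: epow_mono\<close>)

lemma epow_one [simp]: "epow 1 a = 1"
  using epow_ennreal[of 1 a] by simp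

lemma epow_measurable [measurable (raw)]:
  assumes "f \<in> borel_measurable M" shows "(\<lambda>x. epow (f x) a) \<in> borel_measurable M"
proof -
  have "(\<lambda>x. if f x = top then top else ennreal (enn2real (f x) powr a)) \<in> borel_measurable M"
    using assms by measurable
  then show ?thesis by (simp add: epow_def cong: measurable_cong)
qed

text \<open>Comparison with the largest summand serves all \<open>q > 0\<close> at once, also \<open>q <
  1\<close>, where the target space is only quasi-normed.\<close>

lemma epow_sum_le:
  assumes "finite I" "0 < q"
  shows "epow (\<Sum>i\<in>I. x i) q \<le> ennreal (real (card I) powr q) * (\<Sum>i\<in>I. epow (x i) q)"
proof (cases "I = {}")
  case False
  obtain l where l: "l \<in> I" "\<And>i. i \<in> I \<Longrightarrow> x i \<le> x l"
  proof -
    have "Max (x ` I) \<in> x ` I" using assms False by (intro Max_in) auto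
    then obtain l where "l \<in> I" "x l = Max (x ` I)" by auto
    then show ?thesis using assms that[of l] by simp
  qed
  have "(\<Sum>i\<in>I. x i) \<le> of_nat (card I) * x l" using l by (intro sum_bounded_above)
  also have "\<dots> = ennreal (real (card I)) * x l" by (simp add: ennreal_of_nat_eq_real_of_nat)
  finally have "epow (\<Sum>i\<in>I. x i) q \<le> epow (ennreal (real (card I)) * x l) q"
    using assms by (intro epow_mono) auto
  also have "\<dots> = ennreal (real (card I) powr q) * epow (x l) q"
    using assms by (simp add: epow_mult epow_ennreal)
  also have "epow (x l) q \<le> (\<Sum>i\<in>I. epow (x i) q)"
    using l assms by (intro member_le_sum) auto
  finally show ?thesis by (simp add: mult_left_mono)
qed simp

lemma weighted_AM_GM:
  fixes x t :: "'i \<Rightarrow> real"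
  assumes I: "finite I" and x: "\<And>i. i \<in> I \<Longrightarrow> 0 \<le> x i"
    and t: "\<And>i. i \<in> I \<Longrightarrow> 0 < t i" "(\<Sum>i\<in>I. t i) = 1"
  shows "(\<Prod>i\<in>I. x i powr t i) \<le> (\<Sum>i\<in>I. t i * x i)"
proof (cases "\<exists>i\<in>I. x i = 0")
  case True
  then have "(\<Prod>i\<in>I. x i powr t i) = 0" using I by (force intro!: prod_zero)
  moreover have "0 \<le> (\<Sum>i\<in>I. t i * x i)" using x t by (intro sum_nonneg mult_nonneg_nonneg) (auto intro: less_imp_le)
  ultimately show ?thesis by simp
next
  case False
  then have pos: "0 < x i" if "i \<in> I" for i using x that by force
  have "exp (\<Sum>i\<in>I. t i *\<^sub>R ln (x i)) \<le> (\<Sum>i\<in>I. t i * exp (ln (x i)))"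
  proof (rule convex_on_sum[of I UNIV exp])
    show "I \<noteq> {}" using t(2) by auto
    show "0 \<le> t i" if "i \<in> I" for i using t(1)[OF that] by simp
  qed (use I t(2) exp_convex in simp_all)
  also have "\<dots> = (\<Sum>i\<in>I. t i * x i)" using pos by simp
  also have "exp (\<Sum>i\<in>I. t i *\<^sub>R ln (x i)) = (\<Prod>i\<in>I. x i powr t i)"
    unfolding exp_sum[OF I] by (intro prod.cong) (auto simp: powr_def dest!: pos)
  finally show ?thesis .
qed

lemma weighted_AM_GM_ennreal:
  assumes I: "finite I" and t: "\<And>i. i \<in> I \<Longrightarrow> 0 < t i" "(\<Sum>i\<in>I. t i) = 1"
  shows "(\<Prod>i\<in>I. epow (x i) (t i)) \<le> (\<Sum>i\<in>I. ennreal (t i) * x i)"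
proof (cases "\<exists>i\<in>I. x i = top")
  case True
  then obtain i where i: "i \<in> I" "x i = top" by blast
  with t(1)[of i] have "ennreal (t i) * x i = top" by (simp add: ennreal_mult_eq_top_iff)
  then have "(\<Sum>i\<in>I. ennreal (t i) * x i) = top"
    unfolding ennreal_sum_eq_top[OF I] using i(1) by (rule bexI)
  then show ?thesis by simp
next
  case False
  define y where "y i = enn2real (x i)" for i
  have x: "x i = ennreal (y i)" "0 \<le> y i" if "i \<in> I" for i
    using that False by (auto simp: y_def less_top)
  have "(\<Prod>i\<in>I. epow (x i) (t i)) = (\<Prod>i\<in>I. ennreal (y i powr t i))"
    using x by (intro prod.cong) (auto simp: epow_ennreal)
  also have "\<dots> = ennreal (\<Prod>i\<in>I. y i powr t i)" by (rule prod_ennreal) simp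
  also have "\<dots> \<le> ennreal (\<Sum>i\<in>I. t i * y i)"
    using I t x by (intro ennreal_leI weighted_AM_GM) auto
  also have "\<dots> = (\<Sum>i\<in>I. ennreal (t i * y i))"
    using t x by (intro sum_ennreal[symmetric] mult_nonneg_nonneg) (auto intro: less_imp_le)
  also have "\<dots> = (\<Sum>i\<in>I. ennreal (t i) * x i)"
    using t x by (intro sum.cong) (auto simp: ennreal_mult less_imp_le)
  finally show ?thesis .
qed

text \<open>After division of each \<open>\<phi> i\<close> by its integral this is the weighted inequality
  between the geometric and the arithmetic mean, integrated. A factor of integral \<open>0\<close> or
  \<open>\<infinity>\<close> cannot be normalised; then the left-hand side vanishes or the right-hand side
  is infinite.\<close>

lemma generalized_Holder:
  assumes I: "finite I" and t: "\<And>i. i \<in> I \<Longrightarrow> 0 < t i" "(\<Sum>i\<in>I. t i) = 1"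
    and [measurable]: "\<And>i. i \<in> I \<Longrightarrow> \<phi> i \<in> borel_measurable M"
  shows "(\<integral>\<^sup>+x. (\<Prod>i\<in>I. epow (\<phi> i x) (t i)) \<partial>M) \<le> (\<Prod>i\<in>I. epow (\<integral>\<^sup>+x. \<phi> i x \<partial>M) (t i))"
proof -
  define c where "c i = (\<integral>\<^sup>+x. \<phi> i x \<partial>M)" for i
  consider "\<exists>i\<in>I. c i = 0" | "\<forall>i\<in>I. c i \<noteq> 0" "\<exists>i\<in>I. c i = top" | "\<forall>i\<in>I. c i \<noteq> 0 \<and> c i \<noteq> top"
    by blast
  then show ?thesis
  proof cases
    case 1
    then obtain i where i: "i \<in> I" "c i = 0" by blast
    then have "AE x in M. \<phi> i x = 0" by (simp add: c_def nn_integral_0_iff_AE)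
    then have "AE x in M. (\<Prod>i\<in>I. epow (\<phi> i x) (t i)) = 0"
      by eventually_elim (use i I in \<open>auto intro!: prod_zero\<close>)
    then have "(\<integral>\<^sup>+x. (\<Prod>i\<in>I. epow (\<phi> i x) (t i)) \<partial>M) = (\<integral>\<^sup>+x. 0 \<partial>M)" by (rule nn_integral_cong_AE)
    then show ?thesis by simp
  next
    case 2
    then have "(\<Prod>i\<in>I. epow (c i) (t i)) = top" using I by (auto simp: ennreal_prod_eq_top)
    then show ?thesis by (simp add: c_def)
  next
    case 3
    define e where "e i = ennreal (1 / enn2real (c i))" for i
    have ec: "c i * e i = 1" if "i \<in> I" for i
    proof -
      have "c i = ennreal (enn2real (c i))" "enn2real (c i) > 0"
        using 3 that by (auto simp: less_top enn2real_positive_iff zero_less_iff_neq_zero)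
      then show ?thesis unfolding e_def
        by (metis ennreal_1 ennreal_mult' less_eq_real_def mult.commute nonzero_eq_divide_eq order_less_irrefl zero_less_divide_1_iff)
    qed
    have "(\<integral>\<^sup>+x. (\<Prod>i\<in>I. epow (\<phi> i x) (t i)) \<partial>M)
       = (\<integral>\<^sup>+x. (\<Prod>i\<in>I. epow (c i) (t i)) * (\<Prod>i\<in>I. epow (e i * \<phi> i x) (t i)) \<partial>M)"
    proof (intro nn_integral_cong)
      fix x
      have "(\<Prod>i\<in>I. epow (\<phi> i x) (t i)) = (\<Prod>i\<in>I. epow (c i * (e i * \<phi> i x)) (t i))"
        by (intro prod.cong) (simp_all add: ec flip: mult.assoc)
      also have "\<dots> = (\<Prod>i\<in>I. epow (c i) (t i)) * (\<Prod>i\<in>I. epow (e i * \<phi> i x) (t i))"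
        using t by (simp add: epow_mult flip: prod.distrib)
      finally show "(\<Prod>i\<in>I. epow (\<phi> i x) (t i)) = (\<Prod>i\<in>I. epow (c i) (t i)) * (\<Prod>i\<in>I. epow (e i * \<phi> i x) (t i))" .
    qed
    also have "\<dots> = (\<Prod>i\<in>I. epow (c i) (t i)) * (\<integral>\<^sup>+x. (\<Prod>i\<in>I. epow (e i * \<phi> i x) (t i)) \<partial>M)"
      by (intro nn_integral_cmult borel_measurable_prod_ennreal) measurable
    also have "(\<integral>\<^sup>+x. (\<Prod>i\<in>I. epow (e i * \<phi> i x) (t i)) \<partial>M) \<le> (\<integral>\<^sup>+x. (\<Sum>i\<in>I. ennreal (t i) * (e i * \<phi> i x)) \<partial>M)"
      by (intro nn_integral_mono weighted_AM_GM_ennreal I t)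
    also have "\<dots> = (\<Sum>i\<in>I. ennreal (t i) * (e i * c i))"
      unfolding c_def by (subst nn_integral_sum) (auto simp: nn_integral_cmult)
    also have "\<dots> = (\<Sum>i\<in>I. ennreal (t i))"
      using ec by (intro sum.cong) (simp_all add: mult.commute)
    also have "\<dots> = 1"
      using t by (subst sum_ennreal) (auto intro: less_imp_le)
    finally show ?thesis by (simp add: c_def mult_left_mono)
  qed
qed

corollary Holder2:
  assumes "0 < s" "0 < t" "s + t = 1" "f \<in> borel_measurable M" "g \<in> borel_measurable M"
  shows "(\<integral>\<^sup>+x. epow (f x) s * epow (g x) t \<partial>M) \<le> epow (\<integral>\<^sup>+x. f x \<partial>M) s * epow (\<integral>\<^sup>+x. g x \<partial>M) t"
proof -
  let ?t = "\<lambda>b. if b then s else t" and ?f = "\<lambda>b. if b then f else g"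
  have "(\<integral>\<^sup>+x. (\<Prod>b\<in>{True, False}. epow (?f b x) (?t b)) \<partial>M)
      \<le> (\<Prod>b\<in>{True, False}. epow (\<integral>\<^sup>+x. ?f b x \<partial>M) (?t b))"
    by (rule generalized_Holder) (use assms in auto)
  then show ?thesis by simp
qed

section \<open>Dyadic cells and stopping partitions\<close>

text \<open>Sums over countable index sets, mostly over all scales, are integrals for the counting measure:
  they need no enumeration, and Tonelli's theorem exchanges them with other integrals.\<close>

abbreviation count_sum :: "('i \<Rightarrow> ennreal) \<Rightarrow> ennreal"  (binder \<open>\<Sum>\<^sup>+\<close> 10) where
  "count_sum f \<equiv> \<integral>\<^sup>+i. f i \<partial>count_space UNIV"

definition side :: "int \<Rightarrow> real" where "side j = 2 powr real_of_int j"

text \<open>The cells of scale \<open>j\<close> are half-open and have side \<open>side j\<close>, so that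
  large \<open>j\<close> means large cells. A cell is the class of all points with the same index, and it is
  named by any of its points.\<close>

definition idx :: "int \<Rightarrow> real^'n \<Rightarrow> 'n \<Rightarrow> int" where
  "idx j x = (\<lambda>i. \<lfloor>x $ i / side j\<rfloor>)"

definition dcell :: "int \<Rightarrow> real^'n \<Rightarrow> (real^'n) set" where
  "dcell j x = {y. idx j y = idx j x}"

text \<open>The closed cube with the same centre as the cell of \<open>x\<close> and three times its side.
  It contains every point at distance at most \<open>side j\<close> from \<open>x\<close>, and it is a cube
  to which the weight condition applies.\<close>

definition bcube :: "int \<Rightarrow> real^'n \<Rightarrow> (real^'n) set" where
  "bcube j x = cube (\<chi> i. (real_of_int (idx j x i) + 1 / 2) * side j) (3 * side j)"

lemma side_pos [simp]: "0 < side j"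
  by (simp add: side_def)

lemma side_nonneg [simp]: "0 \<le> side j" and side_nz [simp]: "side j \<noteq> 0"
  using side_pos[of j] by linarith+

lemma side_add: "side (i + j) = side i * side j"
  by (simp add: side_def powr_add)

lemma side_add1: "side (j + 1) = 2 * side j"
  by (simp add: side_def powr_add)

lemma side_mono: "i \<le> j \<Longrightarrow> side i \<le> side j"
  by (simp add: side_def)

lemma side_double: "i < j \<Longrightarrow> 2 * side i \<le> side j"
  using side_mono[of "i + 1" j] by (simp add: side_add1)

lemma side_nat: "side (int d) = of_int (2 ^ d)"
  by (simp add: side_def powr_realpow)

text \<open>The cells are nested: the coarse index is a quotient of the fine one.\<close>

lemma idx_coarser: assumes "i \<le> j" shows "idx j x = (\<lambda>k. idx i x k div 2 ^ nat (j - i))"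
proof
  fix k
  have "side j = side i * of_int (2 ^ nat (j - i))"
    using assms side_add[of i "j - i"] side_nat[of "nat (j - i)"] by simp
  then have "x $ k / side j = (x $ k / side i) / of_int (2 ^ nat (j - i))" by simp
  then show "idx j x k = idx i x k div 2 ^ nat (j - i)"
    unfolding idx_def by (metis floor_divide_real_eq_div zero_le_numeral zero_le_power)
qed

lemma idx_eq_coarser: "i \<le> j \<Longrightarrow> idx i x = idx i y \<Longrightarrow> idx j x = idx j y"
  by (simp add: idx_coarser)

lemma dcell_self [simp]: "x \<in> dcell j x"
  by (simp add: dcell_def)

lemma idx_bounds:
  "real_of_int (idx j x i) * side j \<le> x $ i" "x $ i < (real_of_int (idx j x i) + 1) * side j"
proof -
  have "of_int (idx j x i) \<le> x $ i / side j" "x $ i / side j < of_int (idx j x i) + 1"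
    unfolding idx_def by linarith+
  then show "real_of_int (idx j x i) * side j \<le> x $ i" "x $ i < (real_of_int (idx j x i) + 1) * side j"
    by (simp_all only: pos_le_divide_eq[OF side_pos] pos_divide_less_eq[OF side_pos])
qed

lemma mem_bcube: "y \<in> bcube j x \<longleftrightarrow>
    (\<forall>i. (real_of_int (idx j x i) - 1) * side j \<le> y $ i \<and> y $ i \<le> (real_of_int (idx j x i) + 2) * side j)"
  by (simp add: bcube_def cube_def mem_box_cart algebra_simps)

lemma bcube_cong: "idx j x = idx j y \<Longrightarrow> bcube j x = bcube j y"
  by (simp add: bcube_def)

lemma dcell_subset_bcube: "dcell j x \<subseteq> bcube j x"
proof
  fix y assume "y \<in> dcell j x"
  then have e: "idx j y = idx j x" by (simp add: dcell_def)
  show "y \<in> bcube j x" unfolding mem_bcube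
  proof (intro allI conjI)
    fix i
    show "(real_of_int (idx j x i) - 1) * side j \<le> y $ i" "y $ i \<le> (real_of_int (idx j x i) + 2) * side j"
      using idx_bounds[where j=j and x=y and i=i] side_pos[of j] by (simp_all add: e algebra_simps)
  qed
qed

lemma near_mem_bcube:
  assumes "\<And>i. \<bar>y $ i - x $ i\<bar> \<le> side j" shows "y \<in> bcube j x"
  unfolding mem_bcube
proof (intro allI conjI)
  fix i
  show "(real_of_int (idx j x i) - 1) * side j \<le> y $ i" "y $ i \<le> (real_of_int (idx j x i) + 2) * side j"
    using idx_bounds[where j=j and x=x and i=i] assms[of i] side_pos[of j] by (simp_all add: algebra_simps)
qed

lemma bcube_near: assumes "y \<in> bcube j x" shows "\<bar>y $ i - x $ i\<bar> \<le> 2 * side j"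
proof -
  have "(real_of_int (idx j x i) - 1) * side j \<le> y $ i \<and> y $ i \<le> (real_of_int (idx j x i) + 2) * side j"
    using assms by (simp add: mem_bcube)
  then show ?thesis using idx_bounds[where j=j and x=x and i=i] by (simp add: algebra_simps abs_le_iff)
qed

lemma bcube_mono: assumes "i \<le> j" shows "bcube i x \<subseteq> bcube j x"
proof (cases "i = j")
  case False
  then have d: "2 * side i \<le> side j" using assms by (intro side_double) simp
  show ?thesis
  proof
    fix y assume "y \<in> bcube i x"
    then show "y \<in> bcube j x"
      by (intro near_mem_bcube) (use bcube_near d in \<open>fastforce intro: order_trans\<close>)
  qed
qed simp

lemma bcube_subset_cball: "bcube j (x :: real^'n) \<subseteq> cball x (2 * real CARD('n) * side j)"
proof
  fix y assume y: "y \<in> bcube j x"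
  have "norm (y - x) \<le> (\<Sum>i\<in>UNIV. \<bar>(y - x) $ i\<bar>)" by (rule norm_le_l1_cart)
  also have "\<dots> \<le> (\<Sum>i\<in>(UNIV :: 'n set). 2 * side j)"
    by (intro sum_mono) (use bcube_near[OF y] in simp)
  finally show "y \<in> cball x (2 * real CARD('n) * side j)"
    by (simp add: dist_norm norm_minus_commute)
qed

lemma side_unbounded: "\<exists>j\<ge>j0. r \<le> side j"
proof -
  define j where "j = max j0 \<lceil>log 2 (max r 1)\<rceil>"
  have "log 2 (max r 1) \<le> of_int j" unfolding j_def by linarith
  then have "max r 1 \<le> side j" by (simp add: side_def log_le_iff)
  then show ?thesis unfolding j_def by (intro exI[of _ j]) (auto simp: j_def)
qed

lemma bounded_subset_bcube:
  assumes "bounded S" shows "\<exists>j\<ge>j0. S \<subseteq> bcube j (x :: real^'n)"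
proof -
  obtain r where r: "\<And>y. y \<in> S \<Longrightarrow> dist x y \<le> r"
    using assms by (meson bounded_any_center)
  obtain j where j: "j \<ge> j0" "r \<le> side j" using side_unbounded by blast
  have "S \<subseteq> bcube j x"
  proof
    fix y assume "y \<in> S"
    then have "norm (y - x) \<le> side j" using r j by (fastforce simp: dist_norm norm_minus_commute)
    moreover have "\<bar>y $ i - x $ i\<bar> \<le> norm (y - x)" for i
      using component_le_norm_cart[of "y - x" i] by simp
    ultimately show "y \<in> bcube j x" by (intro near_mem_bcube) (meson order_trans)
  qed
  with j show ?thesis by blast
qed

lemma emeasure_cube: "0 \<le> r \<Longrightarrow> emeasure lebesgue (cube (x :: real^'n) r) = ennreal (r ^ CARD('n))"
proof -
  assume r: "0 \<le> r"
  have "cube x r \<noteq> {}" using r by (simp add: cube_def interval_ne_empty_cart)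
  then have "measure lborel (cube x r) = r ^ CARD('n)" unfolding cube_def by (subst content_cbox_cart) simp_all
  then have "emeasure lborel (cube x r) = ennreal (r ^ CARD('n))"
    by (metis cube_def emeasure_eq_ennreal_measure emeasure_lborel_cbox_finite less_irrefl infinity_ennreal_def top.not_eq_extremum)
  then show ?thesis by (simp add: cube_def)
qed

lemma cube_sets [measurable, simp]: "cube x r \<in> sets lebesgue"
  by (simp add: cube_def)

lemma bcube_sets [measurable, simp]: "bcube j x \<in> sets lebesgue"
  by (simp add: bcube_def)

lemma emeasure_bcube:
  "emeasure lebesgue (bcube j (x :: real^'n)) = ennreal (3 ^ CARD('n) * side j ^ CARD('n))"
  unfolding bcube_def by (subst emeasure_cube) (simp_all add: power_mult_distrib)

lemma idx_measurable [measurable]: "idx j \<in> borel \<rightarrow>\<^sub>M count_space (UNIV :: ('n::finite \<Rightarrow> int) set)"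
  unfolding measurable_count_space_eq2_countable
proof (intro conjI ballI)
  fix z :: "'n \<Rightarrow> int"
  have "idx j -` {z} = (\<Inter>i. {x. \<lfloor>x $ i / side j\<rfloor> = z i})"
    by (auto simp: idx_def fun_eq_iff)
  also have "\<dots> \<in> sets borel"
  proof (intro sets.finite_INT)
    fix i
    have "(\<lambda>x :: real^'n. x $ i) \<in> borel_measurable borel"
      by (intro borel_measurable_continuous_onI continuous_intros)
    then show "{x :: real^'n. \<lfloor>x $ i / side j\<rfloor> = z i} \<in> sets borel" by measurable
  qed auto
  finally show "idx j -` {z} \<inter> space borel \<in> sets borel" by simp
qed auto

text \<open>Such a function factors through the index map, which has countably many values and measurable
  fibres.\<close>

lemma constant_on_cells_measurable:
  assumes "\<And>x y. idx j x = idx j y \<Longrightarrow> \<phi> x = \<phi> y"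
  shows "\<phi> \<in> borel_measurable (lebesgue :: (real^'n) measure)"
proof -
  define \<psi> where "\<psi> z = \<phi> (SOME x. idx j x = z)" for z
  have "\<phi> = (\<lambda>x. \<psi> (idx j x))"
    unfolding \<psi>_def by (rule ext) (metis (mono_tags, lifting) assms someI)
  moreover have "(\<lambda>x. \<psi> (idx j x)) \<in> borel_measurable borel" by measurable
  ultimately have "\<phi> \<in> borel_measurable borel" by simp
  then show ?thesis by (simp add: measurable_completion)
qed

lemma union_of_cells_measurable:
  assumes "\<And>x y. idx j x = idx j y \<Longrightarrow> x \<in> A \<Longrightarrow> y \<in> A"
  shows "A \<in> sets (lebesgue :: (real^'n) measure)"
proof -
  have "(indicator A :: _ \<Rightarrow> real) \<in> borel_measurable lebesgue"
  proof (rule constant_on_cells_measurable[of j])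
    fix x y :: "real^'n" assume "idx j x = idx j y"
    then have "x \<in> A \<longleftrightarrow> y \<in> A" using assms[of x y] assms[of y x] by metis
    then show "indicator A x = (indicator A y :: real)" by (simp add: indicator_def)
  qed
  then show ?thesis by (simp add: borel_measurable_indicator_iff)
qed

lemma dcell_sets [measurable, simp]: "dcell j x \<in> sets lebesgue"
  by (rule union_of_cells_measurable[of j]) (auto simp: dcell_def)

abbreviation cell_low :: "int \<Rightarrow> real^'n \<Rightarrow> real^'n" where
  "cell_low j x \<equiv> (\<chi> i. real_of_int (idx j x i) * side j)"

abbreviation cell_high :: "int \<Rightarrow> real^'n \<Rightarrow> real^'n" where
  "cell_high j x \<equiv> (\<chi> i. (real_of_int (idx j x i) + 1) * side j)"

lemma box_subset_dcell: "box (cell_low j x) (cell_high j x) \<subseteq> dcell j x"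
proof
  fix y assume "y \<in> box (cell_low j x) (cell_high j x)"
  then have "real_of_int (idx j x i) * side j < y $ i \<and> y $ i < (real_of_int (idx j x i) + 1) * side j" for i
    by (simp add: mem_box_cart)
  then have "idx j y i = idx j x i" for i
    unfolding idx_def[of j y] by (intro floor_unique) (simp_all add: field_simps less_imp_le)
  then show "y \<in> dcell j x" by (auto simp: dcell_def)
qed

lemma dcell_subset_cbox: "dcell j x \<subseteq> cbox (cell_low j x) (cell_high j x)"
proof
  fix y assume "y \<in> dcell j x"
  then have e: "idx j y = idx j x" by (simp add: dcell_def)
  show "y \<in> cbox (cell_low j x) (cell_high j x)"
    using idx_bounds[where j=j and x=y] by (simp add: mem_box_cart e less_imp_le)
qed

lemma emeasure_dcell: "emeasure lebesgue (dcell j (x :: real^'n)) = ennreal (side j ^ CARD('n))"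
proof (rule antisym)
  let ?c = "(\<chi> i. (real_of_int (idx j x i) + 1 / 2) * side j) :: real^'n"
  have cube_eq: "cube ?c (side j) = cbox (cell_low j x) (cell_high j x)"
    by (simp add: cube_def algebra_simps)
  have cbox: "emeasure lebesgue (cbox (cell_low j x) (cell_high j x)) = ennreal (side j ^ CARD('n))"
    unfolding cube_eq[symmetric] by (subst emeasure_cube) simp_all
  show "emeasure lebesgue (dcell j x) \<le> ennreal (side j ^ CARD('n))"
    unfolding cbox[symmetric] by (intro emeasure_mono dcell_subset_cbox) simp
  have "ennreal (side j ^ CARD('n)) = emeasure lebesgue (box (cell_low j x) (cell_high j x))"
    unfolding cbox[symmetric] by (simp add: emeasure_lborel_cbox_eq emeasure_lborel_box_eq)
  also have "\<dots> \<le> emeasure lebesgue (dcell j x)"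
    by (intro emeasure_mono box_subset_dcell) simp
  finally show "ennreal (side j ^ CARD('n)) \<le> emeasure lebesgue (dcell j x)" .
qed

lemma AE_interior_dcell:
  "AE y in lebesgue. y \<in> dcell j x \<longrightarrow> y \<in> interior (dcell j x)"
proof -
  have "cbox (cell_low j x) (cell_high j x) - box (cell_low j x) (cell_high j x) \<in> null_sets lebesgue"
    using negligible_frontier_interval by (simp only: negligible_iff_null_sets)
  moreover have "box (cell_low j x) (cell_high j x) \<subseteq> interior (dcell j x)"
    by (intro interior_maximal box_subset_dcell open_box)
  ultimately show ?thesis
    by (intro AE_I'[of "cbox (cell_low j x) (cell_high j x) - box (cell_low j x) (cell_high j x)"])
       (use dcell_subset_cbox in auto)
qed

text \<open>Stated without subtraction in the extended reals; the measure of the cell is finite, so the mass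
  of the parts can be compared.\<close>

lemma emeasure_dcell_large_complement:
  assumes [measurable]: "E \<in> sets lebesgue"
    and small: "2 * emeasure lebesgue (dcell j x \<inter> E) \<le> emeasure lebesgue (dcell j x)"
  shows "emeasure lebesgue (dcell j x) \<le> 2 * emeasure lebesgue (dcell j x - E)"
proof -
  define Q where "Q = dcell j x"
  have [measurable]: "Q \<in> sets lebesgue" by (simp add: Q_def)
  have fin: "emeasure lebesgue Q \<noteq> top" unfolding Q_def emeasure_dcell by simp
  have "Q = Q \<inter> E \<union> (Q - E)" by blast
  moreover have "emeasure lebesgue (Q \<inter> E) + emeasure lebesgue (Q - E) = emeasure lebesgue (Q \<inter> E \<union> (Q - E))"
    by (rule plus_emeasure) auto
  ultimately have split: "emeasure lebesgue Q = emeasure lebesgue (Q \<inter> E) + emeasure lebesgue (Q - E)" by metis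
  have "emeasure lebesgue (Q \<inter> E) \<noteq> top" "emeasure lebesgue (Q - E) \<noteq> top"
    using fin unfolding split by auto
  then show ?thesis using small unfolding Q_def[symmetric] split
    by (cases "emeasure lebesgue (Q \<inter> E)"; cases "emeasure lebesgue (Q - E)")
       (auto simp flip: ennreal_plus ennreal_numeral ennreal_mult)
qed

text \<open>The set \<open>\<Omega>\<close> is partitioned into dyadic cells of different scales, and
  \<open>\<tau> x\<close> is the scale of the part that contains \<open>x\<close>. With this description
  families of stopping cubes are replaced by functions of \<open>x\<close>.\<close>

definition stopping :: "(real^'n) set \<Rightarrow> (real^'n \<Rightarrow> int) \<Rightarrow> bool" where
  "stopping \<Omega> \<tau> \<longleftrightarrow> (\<forall>x\<in>\<Omega>. \<forall>y\<in>dcell (\<tau> x) x. y \<in> \<Omega> \<and> \<tau> y = \<tau> x)"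

lemma stopping_level:
  assumes "stopping \<Omega> \<tau>" "idx j x = idx j y" "x \<in> \<Omega>" "\<tau> x = j"
  shows "y \<in> \<Omega>" "\<tau> y = j"
proof -
  have "y \<in> dcell (\<tau> x) x" using assms by (simp add: dcell_def)
  with assms(1,3) have "y \<in> \<Omega> \<and> \<tau> y = \<tau> x" unfolding stopping_def by blast
  with assms(4) show "y \<in> \<Omega>" "\<tau> y = j" by simp_all
qed

lemma stopping_measurable:
  fixes \<Omega> :: "(real^'n) set"
  assumes "stopping \<Omega> \<tau>" shows "\<Omega> \<in> sets lebesgue"
proof -
  have "{x \<in> \<Omega>. \<tau> x = j} \<in> sets lebesgue" for j
    
  proof (rule union_of_cells_measurable[of j])
    fix x y :: "real^'n" assume "idx j x = idx j y" "x \<in> {x \<in> \<Omega>. \<tau> x = j}"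
    then show "y \<in> {x \<in> \<Omega>. \<tau> x = j}"
      using stopping_level[OF assms, where j=j and x=x and y=y] by simp
  qed
  then have "(\<Union>j. {x \<in> \<Omega>. \<tau> x = j}) \<in> sets lebesgue" by (intro sets.countable_UN) auto
  moreover have "(\<Union>j. {x \<in> \<Omega>. \<tau> x = j}) = \<Omega>" by auto
  ultimately show ?thesis by simp
qed

lemma stopping_function_measurable:
  fixes \<phi> :: "real^'n \<Rightarrow> ennreal"
  assumes "stopping \<Omega> \<tau>" and "\<And>x y. x \<in> \<Omega> \<Longrightarrow> y \<in> dcell (\<tau> x) x \<Longrightarrow> \<phi> y = \<phi> x"
  shows "(\<lambda>x. \<phi> x * indicator \<Omega> x) \<in> borel_measurable lebesgue"
proof (rule measurableI)
  fix A :: "ennreal set"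
  have "stopping {x \<in> \<Omega>. \<phi> x \<in> A} \<tau>"
    unfolding stopping_def
  proof (intro ballI)
    fix x y assume "x \<in> {x \<in> \<Omega>. \<phi> x \<in> A}" "y \<in> dcell (\<tau> x) x"
    then have x: "x \<in> \<Omega>" "\<phi> x \<in> A" and y: "y \<in> dcell (\<tau> x) x" by auto
    then have "y \<in> \<Omega> \<and> \<tau> y = \<tau> x" using assms(1) unfolding stopping_def by blast
    with x assms(2)[OF x(1) y] show "y \<in> {x \<in> \<Omega>. \<phi> x \<in> A} \<and> \<tau> y = \<tau> x" by simp
  qed
  from stopping_measurable[OF this] stopping_measurable[OF assms(1)]
  have m: "{x \<in> \<Omega>. \<phi> x \<in> A} \<union> (if 0 \<in> A then - \<Omega> else {}) \<in> sets lebesgue"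
    by (auto simp: Compl_in_sets_lebesgue)
  have "(\<lambda>x. \<phi> x * indicator \<Omega> x) -` A \<inter> space lebesgue
      = {x \<in> \<Omega>. \<phi> x \<in> A} \<union> (if 0 \<in> A then - \<Omega> else {})"
    by (auto simp: indicator_def of_bool_def split: if_splits)
  with m show "(\<lambda>x. \<phi> x * indicator \<Omega> x) -` A \<inter> space lebesgue \<in> sets lebesgue" by simp
qed simp

text \<open>The parts are indexed by their scale and their index, of which there are countably many.\<close>

lemma stopping_nn_integral:
  fixes F :: "real^'n \<Rightarrow> ennreal"
  assumes "stopping \<Omega> \<tau>" and [measurable]: "F \<in> borel_measurable lebesgue"
  shows "(\<integral>\<^sup>+x\<in>\<Omega>. F x \<partial>lebesgue) =
     (\<Sum>\<^sup>+p. (\<integral>\<^sup>+x\<in>{x\<in>\<Omega>. \<tau> x = fst p \<and> idx (fst p) x = snd p}. F x \<partial>lebesgue))"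
proof -
  define c where "c p = {x\<in>\<Omega>. \<tau> x = fst p \<and> idx (fst p) x = snd p}" for p :: "int \<times> ('n \<Rightarrow> int)"
  have [measurable]: "c p \<in> sets lebesgue" for p
    unfolding c_def
  proof (rule union_of_cells_measurable[of "fst p"])
    fix x y :: "real^'n" assume "idx (fst p) x = idx (fst p) y" "x \<in> {x \<in> \<Omega>. \<tau> x = fst p \<and> idx (fst p) x = snd p}"
    then show "y \<in> {x \<in> \<Omega>. \<tau> x = fst p \<and> idx (fst p) x = snd p}"
      using stopping_level[OF assms(1), where j="fst p" and x=x and y=y] by simp
  qed
  have "(\<integral>\<^sup>+x\<in>\<Omega>. F x \<partial>lebesgue) = (\<integral>\<^sup>+x. \<integral>\<^sup>+p. F x * indicator (c p) x \<partial>count_space UNIV \<partial>lebesgue)"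
  proof (intro nn_integral_cong)
    fix x
    have "(\<Sum>\<^sup>+p. F x * indicator (c p) x)
       = (\<Sum>p\<in>{(\<tau> x, idx (\<tau> x) x)}. F x * indicator (c p) x)"
      by (rule nn_integral_count_space') (auto simp: c_def indicator_def)
    then show "F x * indicator \<Omega> x = (\<Sum>\<^sup>+p. F x * indicator (c p) x)"
      by (simp add: c_def indicator_def)
  qed
  also have "\<dots> = (\<Sum>\<^sup>+p. \<integral>\<^sup>+x. F x * indicator (c p) x \<partial>lebesgue)"
    by (rule nn_integral_count_space_nn_integral) auto
  finally show ?thesis by (simp add: c_def)
qed

text \<open>All comparisons of sums over stopping cubes are instances of this lemma: it is enough to compare
  on each part.\<close>

lemma stopping_nn_integral_mono:
  fixes F G :: "real^'n \<Rightarrow> ennreal"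
  assumes st: "stopping \<Omega> \<tau>" and [measurable]: "F \<in> borel_measurable lebesgue" "G \<in> borel_measurable lebesgue"
    and le: "\<And>x. x \<in> \<Omega> \<Longrightarrow> (\<integral>\<^sup>+y\<in>dcell (\<tau> x) x. F y \<partial>lebesgue) \<le> (\<integral>\<^sup>+y\<in>dcell (\<tau> x) x. G y \<partial>lebesgue)"
  shows "(\<integral>\<^sup>+x\<in>\<Omega>. F x \<partial>lebesgue) \<le> (\<integral>\<^sup>+x\<in>\<Omega>. G x \<partial>lebesgue)"
  unfolding stopping_nn_integral[OF st assms(2)] stopping_nn_integral[OF st assms(3)]
proof (rule nn_integral_mono)
  fix p :: "int \<times> ('n \<Rightarrow> int)"
  show "(\<integral>\<^sup>+x\<in>{x\<in>\<Omega>. \<tau> x = fst p \<and> idx (fst p) x = snd p}. F x \<partial>lebesgue)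
     \<le> (\<integral>\<^sup>+x\<in>{x\<in>\<Omega>. \<tau> x = fst p \<and> idx (fst p) x = snd p}. G x \<partial>lebesgue)"
  proof (cases "{x\<in>\<Omega>. \<tau> x = fst p \<and> idx (fst p) x = snd p} = {}")
    case False
    then obtain x where x: "x \<in> \<Omega>" "\<tau> x = fst p" "idx (fst p) x = snd p" by auto
    then have "{x\<in>\<Omega>. \<tau> x = fst p \<and> idx (fst p) x = snd p} = dcell (\<tau> x) x"
      unfolding dcell_def using stopping_level[OF st, where j="fst p" and x=x] by auto
    then show ?thesis using le[OF x(1)] by simp
  qed simp
qed

section \<open>The maximal function\<close>

lemma lebesgue_less_set [measurable]:
  fixes f g :: "'a::euclidean_space \<Rightarrow> ennreal"
  assumes [measurable]: "f \<in> borel_measurable lebesgue" "g \<in> borel_measurable lebesgue"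
  shows "{x. f x < g x} \<in> sets lebesgue"
proof -
  have "{x \<in> space lebesgue. f x < g x} \<in> sets lebesgue" by measurable
  then show ?thesis by simp
qed

lemma geometric_int:
  assumes a: "1 < a"
  shows "(\<Sum>\<^sup>+k. ennreal (a powr real_of_int k) * indicator {..K} k)
       = ennreal (a powr real_of_int K * (a / (a - 1)))"
proof -
  have bij: "bij_betw (\<lambda>n. K - int n) UNIV {..K}"
    by (rule bij_betwI[of _ _ _ "\<lambda>k. nat (K - k)"]) auto
  have "(\<Sum>\<^sup>+k. ennreal (a powr real_of_int k) * indicator {..K} k)
      = (\<integral>\<^sup>+k. ennreal (a powr real_of_int k) \<partial>count_space {..K})"
    by (subst nn_integral_count_space_indicator[of "{..K}"]) auto
  also have "\<dots> = (\<Sum>\<^sup>+n. ennreal (a powr real_of_int (K - int n)))"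
    by (rule nn_integral_bij_count_space[OF bij, symmetric])
  also have "\<dots> = (\<Sum>n. ennreal (a powr real_of_int K * (1 / a) ^ n))"
    using a by (simp add: nn_integral_count_space_nat powr_diff powr_realpow power_one_over)
  also have "\<dots> = ennreal (a powr real_of_int K * (1 / (1 - 1 / a)))"
    using a by (intro suminf_ennreal_eq sums_mult geometric_sums) auto
  also have "1 / (1 - 1 / a) = a / (a - 1)" using a by (simp add: field_simps)
  finally show ?thesis .
qed

lemma level_exists:
  assumes a: "1 < a" and y: "0 < y" "y < top"
  obtains k :: int where "ennreal (a powr k) < y" "y \<le> ennreal (a powr (k + 1))"
proof -
  obtain r where r: "y = ennreal r" "0 < r" using y by (cases y) auto
  define k where "k = \<lceil>log a r\<rceil> - 1"
  have k: "of_int k < log a r" "log a r \<le> of_int k + 1" unfolding k_def by linarith+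
  have "a powr k < a powr (log a r)" using k a by (intro powr_less_mono) auto
  moreover have "a powr (log a r) \<le> a powr (of_int k + 1)" using k a by (intro powr_mono) auto
  moreover have "a powr (log a r) = r" using a r by simp
  ultimately show ?thesis using r that[of k] by (simp add: ennreal_less_iff ennreal_leI)
qed

text \<open>A geometric series is comparable with its largest term, and the largest level below
  \<open>y\<close> is less than \<open>y\<close>.\<close>

lemma geometric_below:
  assumes a: "1 < a" and b: "0 < b"
  shows "(\<Sum>\<^sup>+k. ennreal (a powr (b * real_of_int k)) * indicator {k. ennreal (a powr real_of_int k) < y} k)
     \<le> ennreal (a powr b / (a powr b - 1)) * epow y b"
proof -
  have ab: "1 < a powr b" using a b by simp
  consider "y = 0" | "y = top" | "0 < y" "y < top" 
    using top.not_eq_extremum zero_less_iff_neq_zero by blast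
  then show ?thesis
  proof cases
    case 2
    then show ?thesis using ab by (simp add: ennreal_mult_top)
  next
    case 3
    obtain K :: int where K: "ennreal (a powr K) < y" "y \<le> ennreal (a powr (K + 1))"
      using level_exists[OF a 3] .
    have sub: "k \<le> K" if "ennreal (a powr real_of_int k) < y" for k
    proof -
      have "ennreal (a powr real_of_int k) < ennreal (a powr (K + 1))" using that K by simp
      then have "real_of_int k < K + 1" using a by (simp add: ennreal_less_iff)
      then show ?thesis by simp
    qed
    have "(\<Sum>\<^sup>+k. ennreal (a powr (b * real_of_int k)) * indicator {k. ennreal (a powr real_of_int k) < y} k)
       \<le> (\<Sum>\<^sup>+k. ennreal ((a powr b) powr real_of_int k) * indicator {..K} k)"
      by (intro nn_integral_mono) (auto simp: powr_powr indicator_def dest: sub)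
    also have "\<dots> = ennreal ((a powr b) powr real_of_int K * (a powr b / (a powr b - 1)))"
      by (rule geometric_int[OF ab])
    also have "\<dots> = ennreal (a powr b / (a powr b - 1)) * epow (ennreal (a powr K)) b"
      using ab by (simp add: epow_ennreal powr_powr mult.commute flip: ennreal_mult)
    also have "\<dots> \<le> ennreal (a powr b / (a powr b - 1)) * epow y b"
      using K b by (intro mult_left_mono epow_mono) auto
    finally show ?thesis .
  qed simp
qed

text \<open>The only needed term is that of the last level below \<open>y\<close>. For \<open>y =
  \<infinity>\<close> all levels count, and the sum diverges.\<close>

lemma level_sum:
  assumes a: "1 < a" and s: "0 < s"
  shows "epow y s \<le> (\<Sum>\<^sup>+k. ennreal (a powr (s * (real_of_int k + 1))) * indicator {k. ennreal (a powr real_of_int k) < y} k)"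
    (is "_ \<le> integral\<^sup>N _ ?f")
proof -
  have pt: "?f k \<le> integral\<^sup>N (count_space UNIV) ?f" for k
    by (rule nn_integral_ge_point) simp
  consider "y = 0" | "y = top" | "0 < y" "y < top" 
    using top.not_eq_extremum zero_less_iff_neq_zero by blast
  then show ?thesis
  proof cases
    case 2
    have "of_nat n \<le> integral\<^sup>N (count_space UNIV) ?f" for n
    proof -
      obtain m where m: "real n < (a powr s) ^ m"
        using real_arch_pow[of "a powr s"] a s by auto
      have "(a powr s) ^ m = a powr (s * real m)"
        using a by (simp add: powr_powr flip: powr_realpow)
      also have "\<dots> \<le> a powr (s * (real_of_int (int m) + 1))" using a s by simp
      finally have "ennreal (real n) \<le> ?f (int m)" using m 2 by (auto intro!: ennreal_leI)
      then show ?thesis using pt[of "int m"] by (simp add: ennreal_of_nat_eq_real_of_nat)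
    qed
    then have "\<not> integral\<^sup>N (count_space UNIV) ?f < top"
      using ennreal_Ex_less_of_nat leD by blast
    then have "integral\<^sup>N (count_space UNIV) ?f = top" by (simp only: not_less top_unique)
    then show ?thesis by simp
  next
    case 3
    obtain k :: int where k: "ennreal (a powr k) < y" "y \<le> ennreal (a powr (k + 1))"
      using level_exists[OF a 3] .
    have "epow y s \<le> epow (ennreal (a powr (k + 1))) s" using k s by (intro epow_mono) auto
    also have "\<dots> = ?f k" using k by (simp add: epow_ennreal powr_powr mult.commute)
    finally show ?thesis using pt[of k] by simp
  qed simp
qed

lemma avg_bcube: "avg (bcube j (x :: real^'n)) h =
    (\<integral>\<^sup>+y\<in>bcube j x. h y \<partial>lebesgue) / ennreal (3 ^ CARD('n) * side j ^ CARD('n))"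
  by (simp only: avg_def emeasure_bcube)

lemma avg_bcube_times: "avg (bcube j (x :: real^'n)) h * emeasure lebesgue (bcube j x) =
    (\<integral>\<^sup>+y\<in>bcube j x. h y \<partial>lebesgue)"
  unfolding avg_def emeasure_bcube by (subst ennreal_divide_times) simp

lemma less_divide_ennreal_real:
  assumes "0 < c" shows "x < y / ennreal c \<longleftrightarrow> x * ennreal c < y"
  using assms
  by (cases x; cases y) (auto simp: divide_ennreal ennreal_less_iff field_simps ennreal_top_divide
      ennreal_top_mult ennreal_mult_less_top simp flip: ennreal_mult)

lemma less_avg_bcube: "c < avg (bcube j (x :: real^'n)) h \<longleftrightarrow>
    c * ennreal (3 ^ CARD('n) * side j ^ CARD('n)) < (\<integral>\<^sup>+y\<in>bcube j x. h y \<partial>lebesgue)"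
  unfolding avg_bcube by (rule less_divide_ennreal_real) simp

text \<open>A maximal function over the dilated cells. Its values at \<open>x\<close> are averages over
  cubes around the cells of \<open>x\<close>, so it is comparable with the uncentred maximal function of
  Hardy and Littlewood.\<close>

definition maxf :: "(real^'n \<Rightarrow> ennreal) \<Rightarrow> real^'n \<Rightarrow> ennreal" where
  "maxf h x = (SUP j. avg (bcube j x) h)"

lemma avg_le_maxf: "avg (bcube j x) h \<le> maxf h x"
  unfolding maxf_def by (rule SUP_upper) simp

lemma avg_bcube_measurable [measurable]: "(\<lambda>x. avg (bcube j x) h) \<in> borel_measurable lebesgue"
  by (rule constant_on_cells_measurable[of j]) (metis bcube_cong)

lemma maxf_measurable [measurable]: "maxf h \<in> borel_measurable lebesgue"
  unfolding maxf_def[abs_def] by measurable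

text \<open>Each cube whose average exceeds \<open>l\<close> lies in a ball of comparable volume around its
  point, and by Vitali's covering lemma disjoint balls among these cover the whole set after dilation by
  five. The radii are bounded because the volume of such a cube is at most \<open>\<integral> h /
  l\<close>.\<close>

lemma maxf_weak_type:
  fixes h :: "real^'n \<Rightarrow> ennreal"
  assumes [measurable]: "h \<in> borel_measurable lebesgue" and l: "0 < l"
  shows "ennreal l * emeasure lebesgue {x. ennreal l < maxf h x}
      \<le> ennreal ((20 * real CARD('n)) ^ CARD('n)) * (\<integral>\<^sup>+x. h x \<partial>lebesgue)"
proof (cases "(\<integral>\<^sup>+x. h x \<partial>lebesgue) = top")
  case True
  then show ?thesis by (simp add: ennreal_mult_top)
next
  case False
  define n where "n = CARD('n)"
  have n: "0 < n" by (simp add: n_def)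
  obtain I where I: "(\<integral>\<^sup>+x. h x \<partial>lebesgue) = ennreal I" "0 \<le> I"
    using False by (cases "\<integral>\<^sup>+x. h x \<partial>lebesgue") auto
  define S where "S = {x. ennreal l < maxf h x}"
  define r where "r p = 2 * real n * side (snd p)" for p :: "(real^'n) \<times> int"
  define B where "B p = cball (fst p) (r p)" for p
  define K where "K = {p. ennreal l < avg (bcube (snd p) (fst p)) h}"
  have big: "ennreal (l * side (snd p) ^ n) \<le> (\<integral>\<^sup>+y\<in>B p. h y \<partial>lebesgue)" if "p \<in> K" for p
  proof -
    have "ennreal (l * side (snd p) ^ n) \<le> ennreal (l * (3 ^ n * side (snd p) ^ n))"
      using l by (intro ennreal_leI mult_left_mono) auto
    also have "\<dots> = ennreal l * ennreal (3 ^ n * side (snd p) ^ n)"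
      using l by (simp add: ennreal_mult)
    also have "\<dots> \<le> (\<integral>\<^sup>+y\<in>bcube (snd p) (fst p). h y \<partial>lebesgue)"
      using that by (simp add: K_def less_avg_bcube n_def)
    also have "\<dots> \<le> (\<integral>\<^sup>+y\<in>B p. h y \<partial>lebesgue)"
      using bcube_subset_cball[of "snd p" "fst p"]
      by (intro nn_integral_mono) (auto simp: indicator_def B_def r_def n_def)
    finally show ?thesis .
  qed
  have bnd: "0 < r p \<and> r p \<le> 2 * real n * max 1 (I / l)" if "p \<in> K" for p
  proof -
    have "(\<integral>\<^sup>+y\<in>B p. h y \<partial>lebesgue) \<le> (\<integral>\<^sup>+x. h x \<partial>lebesgue)"
      by (intro nn_integral_mono) (auto simp: indicator_def)
    with big[OF that] have "ennreal (l * side (snd p) ^ n) \<le> ennreal I"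
      unfolding I(1) by (rule order_trans)
    then have "l * side (snd p) ^ n \<le> I" using I(2) by (simp only: ennreal_le_iff)
    then have le: "side (snd p) ^ n \<le> I / l" using I l by (simp add: field_simps)
    have "side (snd p) \<le> max 1 (I / l)"
    proof (cases "side (snd p) \<le> 1")
      case False
      then have "side (snd p) \<le> side (snd p) ^ n" using n by (intro self_le_power) auto
      with le show ?thesis by simp
    qed simp
    then show ?thesis using n by (simp add: r_def mult_left_mono)
  qed
  have "S \<subseteq> (\<Union>p\<in>K. cball (fst p) (r p))"
  proof
    fix x assume "x \<in> S"
    then obtain j where "ennreal l < avg (bcube j x) h" by (auto simp: S_def maxf_def less_SUP_iff)
    then show "x \<in> (\<Union>p\<in>K. cball (fst p) (r p))"
      by (intro UN_I[of "(x, j)"]) (simp_all add: K_def r_def)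
  qed
  then obtain C where C: "countable C" "C \<subseteq> K"
     "pairwise (\<lambda>i j. disjnt (cball (fst i) (r i)) (cball (fst j) (r j))) C"
     "S \<subseteq> (\<Union>i\<in>C. cball (fst i) (5 * r i))"
    by (rule Vitali_covering_lemma_cballs[OF _ bnd])
  \<comment> \<open>The ball of radius \<open>5 r\<close> is enclosed in the cube of side \<open>10 r = 20 n
    side\<close>; this is where the constant comes from.\<close>
  have ball5: "emeasure lebesgue (cball (fst p) (5 * r p)) \<le> ennreal ((20 * real n) ^ n * side (snd p) ^ n)" for p
  proof -
    have r0: "0 \<le> r p" by (simp add: r_def)
    have "cball (fst p) (5 * r p) \<subseteq> cube (fst p) (10 * r p)"
    proof
      fix y assume "y \<in> cball (fst p) (5 * r p)"
      then have y: "norm (y - fst p) \<le> 5 * r p" by (simp add: dist_norm norm_minus_commute)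
      have "\<bar>y $ i - fst p $ i\<bar> \<le> 5 * r p" for i
        using component_le_norm_cart[of "y - fst p" i] y by simp
      then show "y \<in> cube (fst p) (10 * r p)"
        by (simp add: cube_def mem_box_cart abs_le_iff algebra_simps)
    qed
    then have "emeasure lebesgue (cball (fst p) (5 * r p)) \<le> emeasure lebesgue (cube (fst p) (10 * r p))"
      by (intro emeasure_mono) auto
    also have "\<dots> = ennreal ((10 * r p) ^ n)" using r0 by (subst emeasure_cube) (auto simp: n_def)
    also have "10 * r p = (20 * real n) * side (snd p)" by (simp add: r_def)
    finally show ?thesis by (simp only: power_mult_distrib)
  qed
  have "S \<in> sets lebesgue" unfolding S_def by (rule lebesgue_less_set) measurable
  then have "ennreal l * emeasure lebesgue S = ennreal l * (\<integral>\<^sup>+x. indicator S x \<partial>lebesgue)"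
    by simp
  also have "(\<integral>\<^sup>+x. indicator S x \<partial>lebesgue)
      \<le> (\<integral>\<^sup>+x. (\<integral>\<^sup>+p. indicator (cball (fst p) (5 * r p)) x \<partial>count_space C) \<partial>lebesgue)"
  proof (rule nn_integral_mono)
    fix x
    show "indicator S x \<le> (\<integral>\<^sup>+p. indicator (cball (fst p) (5 * r p)) x \<partial>count_space C)"
    proof (cases "x \<in> S")
      case True
      then obtain p where p: "p \<in> C" "x \<in> cball (fst p) (5 * r p)" using C(4) by blast
      have "indicator (cball (fst p) (5 * r p)) x \<le> (\<integral>\<^sup>+p. indicator (cball (fst p) (5 * r p)) x \<partial>count_space C)"
        by (rule nn_integral_ge_point) (rule p)
      with p True show ?thesis by (simp del: mem_cball)
    qed simp
  qed
  also have "\<dots> = (\<integral>\<^sup>+p. (\<integral>\<^sup>+x. indicator (cball (fst p) (5 * r p)) x \<partial>lebesgue) \<partial>count_space C)"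
    by (rule nn_integral_count_space_nn_integral[OF C(1)]) (rule borel_measurable_indicator, simp)
  also have "\<dots> = (\<integral>\<^sup>+p. emeasure lebesgue (cball (fst p) (5 * r p)) \<partial>count_space C)"
    by simp
  also have "\<dots> \<le> (\<integral>\<^sup>+p. ennreal ((20 * real n) ^ n * side (snd p) ^ n) \<partial>count_space C)"
    by (intro nn_integral_mono ball5)
  also have "ennreal l * \<dots> = (\<integral>\<^sup>+p. ennreal l * ennreal ((20 * real n) ^ n * side (snd p) ^ n) \<partial>count_space C)"
    by (simp add: nn_integral_cmult)
  also have "\<dots> = (\<integral>\<^sup>+p. ennreal ((20 * real n) ^ n) * ennreal (l * side (snd p) ^ n) \<partial>count_space C)"
    using l by (intro nn_integral_cong) (simp add: mult_ac flip: ennreal_mult)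
  also have "\<dots> \<le> (\<integral>\<^sup>+p. ennreal ((20 * real n) ^ n) * (\<integral>\<^sup>+y\<in>B p. h y \<partial>lebesgue) \<partial>count_space C)"
    using C(2) by (intro nn_integral_mono mult_left_mono big) auto
  also have "\<dots> = ennreal ((20 * real n) ^ n) * (\<integral>\<^sup>+p. (\<integral>\<^sup>+y\<in>B p. h y \<partial>lebesgue) \<partial>count_space C)"
    by (rule nn_integral_cmult) simp
  also have "(\<integral>\<^sup>+p. (\<integral>\<^sup>+y\<in>B p. h y \<partial>lebesgue) \<partial>count_space C)
      = (\<integral>\<^sup>+y. (\<integral>\<^sup>+p. h y * indicator (B p) y \<partial>count_space C) \<partial>lebesgue)"
    by (rule nn_integral_count_space_nn_integral[OF C(1), symmetric])
       (auto simp: B_def intro!: borel_measurable_times_ennreal borel_measurable_indicator)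
  also have "\<dots> \<le> (\<integral>\<^sup>+y. h y \<partial>lebesgue)"
  proof (rule nn_integral_mono)
    fix y
    show "(\<integral>\<^sup>+p. h y * indicator (B p) y \<partial>count_space C) \<le> h y"
    proof (cases "\<exists>p\<in>C. y \<in> B p")
      case True
      then obtain p where p: "p \<in> C" "y \<in> B p" by blast
      have uniq: "y \<notin> B p'" if "p' \<in> C" "p' \<noteq> p" for p'
        using C(3) p that unfolding pairwise_def disjnt_def B_def by blast
      have "(\<integral>\<^sup>+p. h y * indicator (B p) y \<partial>count_space C) = (\<Sum>p\<in>{p}. h y * indicator (B p) y)"
        using p uniq by (intro nn_integral_count_space') auto
      then show ?thesis using p by simp
    next
      case False
      then have "(\<integral>\<^sup>+p. h y * indicator (B p) y \<partial>count_space C) = (\<integral>\<^sup>+p. 0 \<partial>count_space C)"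
        by (intro nn_integral_cong) auto
      then show ?thesis by simp
    qed
  qed
  finally show ?thesis by (simp add: S_def n_def mult_left_mono)
qed

lemma maxf_le_truncation:
  fixes h :: "real^'n \<Rightarrow> ennreal"
  assumes [measurable]: "h \<in> borel_measurable lebesgue"
  shows "maxf h x \<le> c + maxf (\<lambda>y. h y * indicator {y. c < h y} y) x"
  unfolding maxf_def
proof (rule SUP_least)
  fix j
  have m: "{y. c < h y} \<in> sets lebesgue" by (rule lebesgue_less_set) measurable
  have "(\<integral>\<^sup>+y\<in>bcube j x. h y \<partial>lebesgue)
     \<le> (\<integral>\<^sup>+y. c * indicator (bcube j x) y + (h y * indicator {y. c < h y} y) * indicator (bcube j x) y \<partial>lebesgue)"
    by (intro nn_integral_mono) (auto simp: indicator_def of_bool_def)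
  also have "\<dots> = c * emeasure lebesgue (bcube j x) + (\<integral>\<^sup>+y\<in>bcube j x. h y * indicator {y. c < h y} y \<partial>lebesgue)"
    using m by (subst nn_integral_add) (auto simp: nn_integral_cmult)
  finally have "avg (bcube j x) h \<le> (c * emeasure lebesgue (bcube j x) + (\<integral>\<^sup>+y\<in>bcube j x. h y * indicator {y. c < h y} y \<partial>lebesgue)) / emeasure lebesgue (bcube j x)"
    unfolding avg_def by (rule divide_right_mono_ennreal)
  also have "\<dots> = c + avg (bcube j x) (\<lambda>y. h y * indicator {y. c < h y} y)"
    unfolding avg_def emeasure_bcube by (subst add_divide_distrib_ennreal, subst mult_divide_eq_ennreal) auto
  also have "avg (bcube j x) (\<lambda>y. h y * indicator {y. c < h y} y) \<le> (SUP j. avg (bcube j x) (\<lambda>y. h y * indicator {y. c < h y} y))"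
    by (rule SUP_upper) simp
  finally show "avg (bcube j x) h \<le> c + (SUP j. avg (bcube j x) (\<lambda>y. h y * indicator {y. c < h y} y))"
    by (simp add: add_left_mono)
qed

text \<open>Marcinkiewicz interpolation between the weak bound and the trivial bound in
  \<open>L\<^sup>\<infinity>\<close>: at the level \<open>2\<^bsup>k+1\<^esup>\<close> only the part of
  \<open>h\<close> above \<open>2\<^sup>k\<close> matters, and the levels are summed with the geometric
  series.\<close>

lemma maxf_strong_type:
  assumes s: "1 < s"
  obtains C where "0 < C" "\<And>h :: real^'n \<Rightarrow> ennreal. h \<in> borel_measurable lebesgue \<Longrightarrow>
      (\<integral>\<^sup>+x. epow (maxf h x) s \<partial>lebesgue) \<le> ennreal C * (\<integral>\<^sup>+x. epow (h x) s \<partial>lebesgue)"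
proof
  define A where "A = (20 * real CARD('n)) ^ CARD('n)"
  define D where "D = 2 powr (s - 1) / (2 powr (s - 1) - 1)"
  have gt1: "1 < (2::real) powr (s - 1)" using s by simp
  show "0 < 2 powr (2 * s) * A * D" using gt1 by (simp add: A_def D_def)
  fix h :: "real^'n \<Rightarrow> ennreal" assume [measurable]: "h \<in> borel_measurable lebesgue"
  define w where "w k = (2::real) powr real_of_int k" for k :: int
  have D0: "0 \<le> D" using gt1 by (simp add: D_def)
  have A0: "0 \<le> A" by (simp add: A_def)
  have w_pos: "0 < w k" for k by (simp add: w_def)
  let ?p = "\<lambda>k. ennreal (2 powr (s * (real_of_int k + 1)))" and ?E = "\<lambda>k. {x. ennreal (w k) < maxf h x}"
  let ?t = "\<lambda>k x. h x * indicator {y. ennreal (w k) < h y} x"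
  let ?z = "\<lambda>k x. ennreal (2 powr ((s - 1) * real_of_int k)) * indicator {y. ennreal (w k) < h y} x"
  have level: "emeasure lebesgue (?E (k + 1))
      \<le> ennreal (A / w k) * (\<integral>\<^sup>+x. ?t k x \<partial>lebesgue)" for k
  proof -
    define g where "g = (\<lambda>y. h y * indicator {y. ennreal (w k) < h y} y)"
    have [measurable]: "g \<in> borel_measurable lebesgue" unfolding g_def by measurable
    have dbl: "ennreal (w (k + 1)) = ennreal (w k) + ennreal (w k)"
      by (simp add: w_def powr_add flip: ennreal_plus)
    have "emeasure lebesgue (?E (k + 1)) \<le> emeasure lebesgue {x. ennreal (w k) < maxf g x}"
    proof (rule emeasure_mono)
      show "(?E (k + 1)) \<subseteq> {x. ennreal (w k) < maxf g x}"
      proof safe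
        fix x assume "ennreal (w (k + 1)) < maxf h x"
        also have "\<dots> \<le> ennreal (w k) + maxf g x" unfolding g_def by (rule maxf_le_truncation) measurable
        finally show "ennreal (w k) < maxf g x" unfolding dbl by (rule contrapos_pp) (simp add: not_less add_left_mono)
      qed
    qed (rule lebesgue_less_set; measurable)
    also have "\<dots> = ennreal (1 / w k) * (ennreal (w k) * emeasure lebesgue {x. ennreal (w k) < maxf g x})"
      using w_pos[of k] by (simp flip: mult.assoc ennreal_mult)
    also have "\<dots> \<le> ennreal (1 / w k) * (ennreal A * (\<integral>\<^sup>+x. g x \<partial>lebesgue))"
      unfolding A_def by (intro mult_left_mono maxf_weak_type w_pos) auto
    also have "\<dots> = ennreal (A / w k) * (\<integral>\<^sup>+x. g x \<partial>lebesgue)"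
      using w_pos[of k] by (simp add: A_def flip: mult.assoc ennreal_mult)
    finally show ?thesis by (simp add: g_def)
  qed
  have "(\<integral>\<^sup>+x. epow (maxf h x) s \<partial>lebesgue)
      \<le> (\<integral>\<^sup>+x. (\<Sum>\<^sup>+k. ?p k * indicator {k. ennreal (w k) < maxf h x} k) \<partial>lebesgue)"
    unfolding w_def using s by (intro nn_integral_mono level_sum) auto
  also have "\<dots> = (\<integral>\<^sup>+x. (\<Sum>\<^sup>+k. ?p k * indicator (?E k) x) \<partial>lebesgue)"
    by (simp add: indicator_def)
  also have "\<dots> = (\<Sum>\<^sup>+k. (\<integral>\<^sup>+x. ?p k * indicator (?E k) x \<partial>lebesgue))"
    by (rule nn_integral_count_space_nn_integral) auto
  also have "\<dots> = (\<Sum>\<^sup>+k. ?p k * emeasure lebesgue (?E k))"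
    by (intro nn_integral_cong nn_integral_cmult_indicator) measurable
  also have "\<dots> \<le> (\<Sum>\<^sup>+k. (\<integral>\<^sup>+x. ennreal (2 powr (2 * s) * A) * (h x * ?z (k - 1) x) \<partial>lebesgue))"
  proof (rule nn_integral_mono)
    fix k
    have "?p k * emeasure lebesgue (?E k)
       \<le> ?p k * (ennreal (A / w (k - 1)) * (\<integral>\<^sup>+x. ?t (k - 1) x \<partial>lebesgue))"
      using level[of "k - 1"] by (intro mult_left_mono) auto
    also have "\<dots> = ennreal (2 powr (s * (real_of_int k + 1)) * (A / w (k - 1))) * (\<integral>\<^sup>+x. ?t (k - 1) x \<partial>lebesgue)"
      using w_pos[of "k - 1"] A0 by (subst ennreal_mult) (simp_all add: mult.assoc)
    also have "2 powr (s * (real_of_int k + 1)) * (A / w (k - 1)) = 2 powr (2 * s) * A * 2 powr ((s - 1) * real_of_int (k - 1))"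
    proof -
      have "2 powr (s * (real_of_int k + 1)) / w (k - 1) = 2 powr (s * (real_of_int k + 1) - real_of_int (k - 1))"
        by (simp add: w_def powr_diff)
      also have "s * (real_of_int k + 1) - real_of_int (k - 1) = 2 * s + (s - 1) * real_of_int (k - 1)"
        by (simp add: algebra_simps)
      also have "2 powr (2 * s + (s - 1) * real_of_int (k - 1)) = 2 powr (2 * s) * 2 powr ((s - 1) * real_of_int (k - 1))"
        by (rule powr_add)
      finally show ?thesis by (metis mult.assoc mult.commute times_divide_eq_left times_divide_eq_right)
    qed
    also have "ennreal (2 powr (2 * s) * A * 2 powr ((s - 1) * real_of_int (k - 1))) * (\<integral>\<^sup>+x. ?t (k - 1) x \<partial>lebesgue)
        = (\<integral>\<^sup>+x. ennreal (2 powr (2 * s) * A * 2 powr ((s - 1) * real_of_int (k - 1))) * (?t (k - 1) x) \<partial>lebesgue)"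
      by (rule nn_integral_cmult[symmetric]) measurable
    also have "\<dots> = (\<integral>\<^sup>+x. ennreal (2 powr (2 * s) * A) * (h x * ?z (k - 1) x) \<partial>lebesgue)"
      by (intro nn_integral_cong) (simp add: A_def ennreal_mult mult_ac)
    finally show "?p k * emeasure lebesgue (?E k)
       \<le> (\<integral>\<^sup>+x. ennreal (2 powr (2 * s) * A) * (h x * ?z (k - 1) x) \<partial>lebesgue)" .
  qed
  also have "\<dots> = (\<Sum>\<^sup>+k. (\<integral>\<^sup>+x. ennreal (2 powr (2 * s) * A) * (h x * ?z k x) \<partial>lebesgue))"
    by (rule nn_integral_bij_count_space[where g="\<lambda>k::int. k - 1"]) (rule bij_betwI[of _ _ _ "\<lambda>k. k + 1"], auto)
  also have "\<dots> = (\<integral>\<^sup>+x. (\<Sum>\<^sup>+k. ennreal (2 powr (2 * s) * A) * (h x * ?z k x)) \<partial>lebesgue)"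
    by (rule nn_integral_count_space_nn_integral[symmetric]) auto
  also have "\<dots> = (\<integral>\<^sup>+x. ennreal (2 powr (2 * s) * A) * (h x * (\<Sum>\<^sup>+k. ennreal (2 powr ((s - 1) * real_of_int k)) * indicator {k. ennreal (2 powr real_of_int k) < h x} k)) \<partial>lebesgue)"
    by (simp add: nn_integral_cmult w_def indicator_def)
  also have "\<dots> \<le> (\<integral>\<^sup>+x. ennreal (2 powr (2 * s) * A) * (h x * (ennreal D * epow (h x) (s - 1))) \<partial>lebesgue)"
    unfolding D_def using s by (intro nn_integral_mono mult_left_mono geometric_below) auto
  also have "\<dots> = (\<integral>\<^sup>+x. ennreal (2 powr (2 * s) * A * D) * epow (h x) s \<partial>lebesgue)"
  proof (intro nn_integral_cong)
    fix x
    have "epow (h x) s = h x * epow (h x) (s - 1)" using s epow_add[of 1 "s - 1" "h x"] by simp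
    then show "ennreal (2 powr (2 * s) * A) * (h x * (ennreal D * epow (h x) (s - 1))) = ennreal (2 powr (2 * s) * A * D) * epow (h x) s"
      using A0 D0 by (simp add: ennreal_mult mult_ac)
  qed
  also have "\<dots> = ennreal (2 powr (2 * s) * A * D) * (\<integral>\<^sup>+x. epow (h x) s \<partial>lebesgue)"
    by (rule nn_integral_cmult) measurable
  finally show "(\<integral>\<^sup>+x. epow (maxf h x) s \<partial>lebesgue) \<le> ennreal (2 powr (2 * s) * A * D) * (\<integral>\<^sup>+x. epow (h x) s \<partial>lebesgue)" .
qed

section \<open>Averages and the weight condition\<close>

text \<open>An average is an integral for a density, which turns inequalities for integrals into
  inequalities for averages without a change of measure.\<close>

lemma avg_density:
  assumes "Q \<in> sets lebesgue" "g \<in> borel_measurable lebesgue"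
  shows "avg Q g = (\<integral>\<^sup>+x. (inverse (emeasure lebesgue Q) * indicator Q x) * g x \<partial>lebesgue)"
proof -
  have "avg Q g = inverse (emeasure lebesgue Q) * (\<integral>\<^sup>+x\<in>Q. g x \<partial>lebesgue)"
    by (simp add: avg_def divide_ennreal_def mult.commute)
  also have "\<dots> = (\<integral>\<^sup>+x. inverse (emeasure lebesgue Q) * (g x * indicator Q x) \<partial>lebesgue)"
    using assms by (intro nn_integral_cmult[symmetric] borel_measurable_times_ennreal borel_measurable_indicator)
  finally show ?thesis by (simp add: mult_ac)
qed

lemma avg_mono_AE:
  assumes "AE x in lebesgue. x \<in> Q \<longrightarrow> f x \<le> g x" shows "avg Q f \<le> avg Q g"
  unfolding avg_def using assms
  by (intro divide_right_mono_ennreal nn_integral_mono_AE) (auto simp: indicator_def)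

lemma avg_Holder2:
  assumes [measurable]: "Q \<in> sets lebesgue" "f \<in> borel_measurable lebesgue" "g \<in> borel_measurable lebesgue"
    and st: "0 < s" "0 < t" "s + t = 1"
  shows "avg Q (\<lambda>x. epow (f x) s * epow (g x) t) \<le> epow (avg Q f) s * epow (avg Q g) t"
proof -
  define c where "c x = inverse (emeasure lebesgue Q) * indicator Q x" for x :: "real^'a"
  have [measurable]: "c \<in> borel_measurable lebesgue" unfolding c_def by measurable
  have "avg Q (\<lambda>x. epow (f x) s * epow (g x) t) = (\<integral>\<^sup>+x. c x * (epow (f x) s * epow (g x) t) \<partial>lebesgue)"
    unfolding c_def by (rule avg_density) measurable
  also have "\<dots> = (\<integral>\<^sup>+x. epow (c x * f x) s * epow (c x * g x) t \<partial>lebesgue)"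
  proof (intro nn_integral_cong)
    fix x
    have "c x = epow (c x) s * epow (c x) t" using st epow_add[of s t "c x"] by simp
    then have "c x * (epow (f x) s * epow (g x) t) = (epow (c x) s * epow (c x) t) * (epow (f x) s * epow (g x) t)"
      by (rule arg_cong)
    also have "\<dots> = epow (c x * f x) s * epow (c x * g x) t"
      using st by (simp add: epow_mult mult_ac)
    finally show "c x * (epow (f x) s * epow (g x) t) = epow (c x * f x) s * epow (c x * g x) t" .
  qed
  also have "\<dots> \<le> epow (\<integral>\<^sup>+x. c x * f x \<partial>lebesgue) s * epow (\<integral>\<^sup>+x. c x * g x \<partial>lebesgue) t"
    using st by (intro Holder2) measurable
  finally show ?thesis unfolding c_def by (simp add: avg_density)
qed

lemma avg_Jensen:
  assumes [measurable]: "h \<in> borel_measurable lebesgue" and s: "1 < s"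
  shows "epow (avg (bcube j x) h) s \<le> avg (bcube j x) (\<lambda>y. epow (h y) s)"
proof -
  have one: "avg (bcube j x) (\<lambda>_. 1) = 1"
    unfolding avg_def using emeasure_bcube[of j x] by (simp add: ennreal_divide_self)
  have "avg (bcube j x) h = avg (bcube j x) (\<lambda>y. epow (epow (h y) s) (1 / s) * epow 1 (1 - 1 / s))"
    using s by (simp add: epow_epow)
  also have "\<dots> \<le> epow (avg (bcube j x) (\<lambda>y. epow (h y) s)) (1 / s) * epow (avg (bcube j x) (\<lambda>_. 1)) (1 - 1 / s)"
    using s by (intro avg_Holder2) (auto simp: field_simps)
  finally have "epow (avg (bcube j x) h) s \<le> epow (epow (avg (bcube j x) (\<lambda>y. epow (h y) s)) (1 / s)) s"
    using s by (intro epow_mono) (auto simp: one)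
  then show ?thesis using s by (simp add: epow_epow)
qed

lemma prod_epow_sum:
  assumes "finite I" "I \<noteq> {}" "\<And>i. i \<in> I \<Longrightarrow> 0 < t i"
  shows "(\<Prod>i\<in>I. epow x (t i)) = epow x (\<Sum>i\<in>I. t i)"
  using assms
proof (induction I rule: finite_ne_induct)
  case (insert i I)
  then show ?case by (simp add: epow_add sum_pos)
qed simp

lemma sum_option: "(\<Sum>i\<in>(UNIV :: 'm::finite option set). f i) = f None + (\<Sum>i\<in>UNIV. f (Some i))"
  by (simp add: UNIV_option_conv sum.reindex)

text \<open>The factor for the weight and the \<open>m\<close> factors for the dual weights are combined
  into one product over \<open>'m option\<close>.\<close>

lemma prod_option: "(\<Prod>i\<in>(UNIV :: 'm::finite option set). f i) = f None * (\<Prod>i\<in>UNIV. f (Some i))"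
  by (simp add: UNIV_option_conv prod.reindex)

text \<open>The one-weight setting in the form in which it is used. For weights \<open>w\<^sub>i\<close> one
  takes \<open>V = (\<Prod>\<^sub>i w\<^sub>i)\<^sup>q\<close> and \<open>\<sigma> i =
  w\<^sub>i\<^bsup>-\<rho>\<^sub>i\<^esup>\<close>; then \<open>lower\<close> is an equality where all
  weights are positive. That \<open>a i < P i\<close> means that \<open>\<rho> i\<close> exceeds the
  conjugate exponent of \<open>P i\<close>. This strict inequality leaves room for the maximal
  theorem.\<close>

locale frac_weights =
  fixes V :: "real^'n \<Rightarrow> ennreal" and \<sigma> :: "'m::finite \<Rightarrow> real^'n \<Rightarrow> ennreal"
    and P a \<rho> :: "'m \<Rightarrow> real" and \<alpha> p q K :: real
  assumes V_meas [measurable]: "V \<in> borel_measurable lebesgue"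
    and \<sigma>_meas [measurable]: "\<And>i. \<sigma> i \<in> borel_measurable lebesgue"
    and a_pos: "\<And>i. 0 < a i" and \<rho>_pos: "\<And>i. 0 < \<rho> i" and conj: "\<And>i. 1 / a i + 1 / \<rho> i = 1"
    and a_less: "\<And>i. a i < P i"
    and \<alpha>_pos: "0 < \<alpha>" and p_pos: "0 < p" and q_pos: "0 < q" and K_pos: "0 < K"
    and p_sum: "1 / p = (\<Sum>i\<in>UNIV. 1 / P i)" and q_def: "1 / q = 1 / p - \<alpha> / real CARD('n)"
    and cond: "\<And>x r. 0 < r \<Longrightarrow>
        epow (avg (cube x r) V) (1 / q) * (\<Prod>i\<in>UNIV. epow (avg (cube x r) (\<sigma> i)) (1 / \<rho> i)) \<le> ennreal K"
    and lower: "AE x in lebesgue. 1 \<le> epow (V x) (1 / q) * (\<Prod>i\<in>UNIV. epow (\<sigma> i x) (1 / \<rho> i))"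
    and V_cube: "\<And>x r. 0 < r \<Longrightarrow> 0 < (\<integral>\<^sup>+y\<in>cube x r. V y \<partial>lebesgue)"
      "\<And>x r. 0 < r \<Longrightarrow> (\<integral>\<^sup>+y\<in>cube x r. V y \<partial>lebesgue) < top"
begin

definition VV :: "(real^'n) set \<Rightarrow> ennreal" where "VV A = (\<integral>\<^sup>+y\<in>A. V y \<partial>lebesgue)"

lemma VV_mono: "A \<subseteq> B \<Longrightarrow> VV A \<le> VV B"
  unfolding VV_def by (intro nn_integral_mono) (auto simp: indicator_def)

lemma VV_Un: "A \<in> sets lebesgue \<Longrightarrow> B \<in> sets lebesgue \<Longrightarrow> A \<inter> B = {} \<Longrightarrow> VV (A \<union> B) = VV A + VV B"
  unfolding VV_def by (subst nn_integral_add[symmetric]) (auto intro!: nn_integral_cong simp: indicator_def)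

lemma VV_bcube: "0 < VV (bcube j x)" "VV (bcube j x) < top"
  unfolding VV_def bcube_def by (rule V_cube, simp)+

lemma VV_dcell: "VV (dcell j x) < top"
  using VV_mono[OF dcell_subset_bcube] VV_bcube(2) by (rule le_less_trans)

lemma P_pos: "0 < P i"
  using a_pos[of i] a_less[of i] by simp

lemma p_less_q: "p < q"
proof -
  have "0 < \<alpha> / real CARD('n)" using \<alpha>_pos by simp
  then have "1 / q < 1 / p" using q_def by linarith
  then show ?thesis using p_pos q_pos by (simp add: field_simps)
qed

lemma alpha_q: "\<alpha> * q = real CARD('n) * ((q - p) / p)"
proof -
  have "\<alpha> = real CARD('n) * (1 / p - 1 / q)" using q_def by (simp add: field_simps)
  then show ?thesis using p_pos q_pos by (simp add: field_simps)
qed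

text \<open>Integrating \<open>lower\<close> over \<open>E\<close> with Hoelder's inequality bounds
  \<open>|E|\<close> by a power of \<open>V(E)\<close> times powers of the integrals of the \<open>\<sigma>
  i\<close>, and \<open>cond\<close> bounds the latter by a negative power of \<open>V\<close> of the whole
  cube. It is a form of the Muckenhoupt condition \<open>A\<^sub>\<infinity>\<close>.\<close>

lemma V_doubling_on_large_subsets:
  "\<exists>c>0. \<forall>j x E. E \<in> sets lebesgue \<longrightarrow> E \<subseteq> dcell j x \<longrightarrow>
     emeasure lebesgue (dcell j x) \<le> 2 * emeasure lebesgue E \<longrightarrow> VV (bcube j x) \<le> ennreal c * VV E"
proof -
  define Z where "Z = 1 / q + (\<Sum>i\<in>UNIV. 1 / \<rho> i)"
  have Z: "0 < Z" unfolding Z_def using q_pos \<rho>_pos by (intro add_pos_nonneg sum_nonneg) (auto intro: less_imp_le)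
  \<comment> \<open>The exponents \<open>1/q\<close> and \<open>1/\<rho> i\<close>, normalised to sum
    \<open>1\<close>.\<close>
  define t where "t x = (case x of None \<Rightarrow> 1 / q / Z | Some i \<Rightarrow> 1 / \<rho> i / Z)" for x
  have t_pos: "0 < t x" for x using q_pos \<rho>_pos Z by (simp add: t_def split: option.split)
  have t_sum: "(\<Sum>x\<in>UNIV. t x) = 1"
  proof -
    have "(\<Sum>x\<in>UNIV. t x) = 1 / q / Z + (\<Sum>i\<in>UNIV. 1 / \<rho> i) / Z"
      by (simp only: sum_option t_def option.case sum_divide_distrib)
    also have "\<dots> = Z / Z" by (simp only: Z_def add_divide_distrib)
    finally show ?thesis using Z by simp
  qed
  define L where "L = 2 * 3 ^ CARD('n) * K powr (1 / Z)"
  have L: "0 < L" using K_pos by (simp add: L_def)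
  define c where "c = L powr (q * Z)"
  have c: "0 < c" using L by (simp add: c_def)
  have main: "VV (bcube j x) \<le> ennreal c * VV E"
    if [measurable]: "E \<in> sets lebesgue" and E: "E \<subseteq> dcell j x"
      "emeasure lebesgue (dcell j x) \<le> 2 * emeasure lebesgue E" for j x E
  proof -
    define B where "B = bcube j x"
    have [measurable]: "B \<in> sets lebesgue" by (simp add: B_def)
    have EB: "E \<subseteq> B" using E(1) dcell_subset_bcube unfolding B_def by blast
    define b where "b = emeasure lebesgue B"
    have b: "b = ennreal (3 ^ CARD('n) * side j ^ CARD('n))" by (simp only: b_def B_def emeasure_bcube)
    have b0: "b \<noteq> 0" "b \<noteq> top" unfolding b by simp_all
    define S where "S i = (\<integral>\<^sup>+y\<in>B. \<sigma> i y \<partial>lebesgue)" for i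
    define f where "f w y = (case w of None \<Rightarrow> V y * indicator E y | Some i \<Rightarrow> \<sigma> i y * indicator B y)" for w y
    have [measurable]: "f w \<in> borel_measurable lebesgue" for w
      unfolding f_def by (cases w) auto
    have "emeasure lebesgue E = (\<integral>\<^sup>+y. indicator E y \<partial>lebesgue)" by simp
    also have "\<dots> \<le> (\<integral>\<^sup>+y. (\<Prod>w\<in>UNIV. epow (f w y) (t w)) \<partial>lebesgue)"
    proof (rule nn_integral_mono_AE)
      show "AE y in lebesgue. indicator E y \<le> (\<Prod>w\<in>UNIV. epow (f w y) (t w))"
        using lower
      proof eventually_elim
        fix y assume y: "1 \<le> epow (V y) (1 / q) * (\<Prod>i\<in>UNIV. epow (\<sigma> i y) (1 / \<rho> i))"
        show "indicator E y \<le> (\<Prod>w\<in>UNIV. epow (f w y) (t w))"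
        proof (cases "y \<in> E")
          case True
          have "epow 1 (1 / Z) \<le> epow (epow (V y) (1 / q) * (\<Prod>i\<in>UNIV. epow (\<sigma> i y) (1 / \<rho> i))) (1 / Z)"
            using y Z by (intro epow_mono) auto
          also have "\<dots> = (\<Prod>w\<in>UNIV. epow (f w y) (t w))"
            using True EB Z by (auto simp: prod_option f_def t_def epow_mult epow_prod epow_epow)
          finally show ?thesis using True by simp
        qed simp
      qed
    qed
    also have "\<dots> \<le> (\<Prod>w\<in>UNIV. epow (\<integral>\<^sup>+y. f w y \<partial>lebesgue) (t w))"
      by (rule generalized_Holder) (auto simp: t_pos t_sum)
    also have "\<dots> = epow (VV E) (1 / q / Z) * (\<Prod>i\<in>UNIV. epow (S i) (1 / \<rho> i / Z))"
      by (simp add: prod_option f_def t_def VV_def S_def)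
    finally have 1: "emeasure lebesgue E \<le> epow (VV E) (1 / q / Z) * (\<Prod>i\<in>UNIV. epow (S i) (1 / \<rho> i / Z))" .
    have avgs: "VV B = avg B V * b" "S i = avg B (\<sigma> i) * b" for i
      unfolding VV_def S_def b_def B_def by (simp_all only: avg_bcube_times)
    have "epow (VV B) (1 / q / Z) * (\<Prod>i\<in>UNIV. epow (S i) (1 / \<rho> i / Z))
        = (epow (avg B V) (1 / q / Z) * (\<Prod>i\<in>UNIV. epow (avg B (\<sigma> i)) (1 / \<rho> i / Z))) * (\<Prod>w\<in>UNIV. epow b (t w))"
      using q_pos \<rho>_pos Z by (simp add: avgs epow_mult prod_option t_def prod.distrib mult_ac)
    also have "(\<Prod>w\<in>UNIV. epow b (t w)) = b"
      using t_pos t_sum by (subst prod_epow_sum) auto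
    also have "epow (avg B V) (1 / q / Z) * (\<Prod>i\<in>UNIV. epow (avg B (\<sigma> i)) (1 / \<rho> i / Z))
        = epow (epow (avg B V) (1 / q) * (\<Prod>i\<in>UNIV. epow (avg B (\<sigma> i)) (1 / \<rho> i))) (1 / Z)"
      using Z by (simp add: epow_mult epow_prod epow_epow)
    also have "\<dots> \<le> epow (ennreal K) (1 / Z)"
      unfolding B_def bcube_def using Z by (intro epow_mono cond) auto
    also have "epow (ennreal K) (1 / Z) = ennreal (K powr (1 / Z))" using K_pos by (simp add: epow_ennreal)
    finally have 2: "epow (VV B) (1 / q / Z) * (\<Prod>i\<in>UNIV. epow (S i) (1 / \<rho> i / Z)) \<le> ennreal (K powr (1 / Z)) * b"
      by (simp add: mult_right_mono)
    have "b = ennreal (3 ^ CARD('n)) * emeasure lebesgue (dcell j x)"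
      unfolding b emeasure_dcell by (rule ennreal_mult) auto
    also have "\<dots> \<le> ennreal (3 ^ CARD('n)) * (2 * emeasure lebesgue E)" using E(2) by (intro mult_left_mono) auto
    also have "\<dots> = ennreal (2 * 3 ^ CARD('n)) * emeasure lebesgue E"
      by (simp add: ennreal_mult mult_ac)
    finally have "epow (VV B) (1 / q / Z) * b \<le> epow (VV B) (1 / q / Z) * (ennreal (2 * 3 ^ CARD('n)) * emeasure lebesgue E)"
      by (rule mult_left_mono) simp
    also have "\<dots> \<le> epow (VV B) (1 / q / Z) * (ennreal (2 * 3 ^ CARD('n)) * (epow (VV E) (1 / q / Z) * (\<Prod>i\<in>UNIV. epow (S i) (1 / \<rho> i / Z))))"
      using 1 by (intro mult_left_mono) auto
    also have "\<dots> = ennreal (2 * 3 ^ CARD('n)) * epow (VV E) (1 / q / Z) * (epow (VV B) (1 / q / Z) * (\<Prod>i\<in>UNIV. epow (S i) (1 / \<rho> i / Z)))"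
      by (simp only: mult_ac)
    also have "\<dots> \<le> ennreal (2 * 3 ^ CARD('n)) * epow (VV E) (1 / q / Z) * (ennreal (K powr (1 / Z)) * b)"
      by (intro mult_left_mono 2) auto
    also have "\<dots> = (ennreal L * epow (VV E) (1 / q / Z)) * b"
      unfolding L_def by (simp add: ennreal_mult mult_ac)
    finally have "epow (VV B) (1 / q / Z) \<le> ennreal L * epow (VV E) (1 / q / Z)"
      using b0 ennreal_mult_le_mult_iff[of b] by (simp add: mult.commute)
    then have "epow (epow (VV B) (1 / q / Z)) (q * Z) \<le> epow (ennreal L * epow (VV E) (1 / q / Z)) (q * Z)"
      using q_pos Z by (intro epow_mono) auto
    then show ?thesis
      using q_pos Z L by (simp add: epow_epow epow_mult epow_ennreal c_def B_def)
  qed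
  show ?thesis by (rule exI[of _ c]) (use c main in blast)
qed

text \<open>The complement of \<open>E\<close> in the cell carries a fixed fraction of
  \<open>V\<close>.\<close>

lemma V_decay_off_large_subsets:
  obtains \<theta> where "0 < \<theta>" "\<theta> < 1" "\<And>j x E. E \<in> sets lebesgue \<Longrightarrow>
     2 * emeasure lebesgue (dcell j x \<inter> E) \<le> emeasure lebesgue (dcell j x) \<Longrightarrow>
     VV (dcell j x \<inter> E) \<le> ennreal \<theta> * VV (dcell j x)"
proof -
  obtain c where c: "0 < c" and doub: "\<And>j x E. E \<in> sets lebesgue \<Longrightarrow> E \<subseteq> dcell j x \<Longrightarrow>
     emeasure lebesgue (dcell j x) \<le> 2 * emeasure lebesgue E \<Longrightarrow> VV (bcube j x) \<le> ennreal c * VV E"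
    using V_doubling_on_large_subsets by blast
  define \<theta> where "\<theta> = c / (c + 1)"
  show thesis
  proof (rule that)
    show "0 < \<theta>" "\<theta> < 1" using c by (simp_all add: \<theta>_def)
    fix j and x :: "real^'n" and E :: "(real^'n) set"
    assume E: "E \<in> sets lebesgue" and small: "2 * emeasure lebesgue (dcell j x \<inter> E) \<le> emeasure lebesgue (dcell j x)"
    define Q where "Q = dcell j x"
    have [measurable]: "Q \<in> sets lebesgue" "E \<in> sets lebesgue" using E by (simp_all add: Q_def)
    have "emeasure lebesgue Q \<le> 2 * emeasure lebesgue (Q - E)"
      unfolding Q_def by (rule emeasure_dcell_large_complement[OF E small])
    then have "VV (bcube j x) \<le> ennreal c * VV (Q - E)" unfolding Q_def by (intro doub) auto
    with VV_mono[OF dcell_subset_bcube, of j x] have le: "VV Q \<le> ennreal c * VV (Q - E)"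
      unfolding Q_def by (rule order_trans)
    have VQ: "VV Q = VV (Q \<inter> E) + VV (Q - E)"
      by (subst VV_Un[symmetric]) (auto intro!: arg_cong[where f=VV])
    have "VV Q \<noteq> top" using VV_dcell[of j x] by (simp add: Q_def)
    then have "VV (Q \<inter> E) \<noteq> top" "VV (Q - E) \<noteq> top" unfolding VQ by auto
    then obtain u v where uv: "VV (Q \<inter> E) = ennreal u" "VV (Q - E) = ennreal v" "0 \<le> u" "0 \<le> v"
      by (metis ennreal_cases)
    have "u + v \<le> c * v" using le uv c unfolding VQ by (simp flip: ennreal_plus ennreal_mult)
    then have "u \<le> \<theta> * (u + v)" using c uv(3,4) unfolding \<theta>_def by (simp add: field_simps)
    then have "VV (Q \<inter> E) \<le> ennreal \<theta> * VV Q"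
      using uv c unfolding VQ by (simp add: \<theta>_def flip: ennreal_plus ennreal_mult)
    then show "VV (dcell j x \<inter> E) \<le> ennreal \<theta> * VV (dcell j x)" by (simp add: Q_def)
  qed
qed

end

section \<open>Level sets of the averages\<close>

text \<open>The data for a fixed tuple \<open>\<phi>\<close>. In the application \<open>h i = (\<phi> i
  w\<^sub>i)\<^bsup>a\<^sub>i\<^esup>\<close>, so that \<open>\<phi>_le\<close> is an equality and the norms
  of \<open>norm_fin\<close> are the weighted norms of the \<open>\<phi> i\<close>. The constants
  \<open>\<theta>\<close>, \<open>\<beta>\<close> and \<open>lev\<close> are independent of
  \<open>\<phi>\<close>; the base \<open>lev\<close> of the levels is chosen in
  \<open>level_sets_sparse\<close>.\<close>

locale frac_data = frac_weights V \<sigma> P a \<rho> \<alpha> p q K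
  for V :: "real^'n \<Rightarrow> ennreal" and \<sigma> :: "'m::finite \<Rightarrow> real^'n \<Rightarrow> ennreal"
    and P a \<rho> :: "'m \<Rightarrow> real" and \<alpha> p q K :: real +
  fixes \<phi> h :: "'m \<Rightarrow> real^'n \<Rightarrow> ennreal" and \<theta> \<beta> lev :: real
  assumes \<phi>_meas [measurable]: "\<And>i. \<phi> i \<in> borel_measurable lebesgue"
    and h_meas [measurable]: "\<And>i. h i \<in> borel_measurable lebesgue"
    and \<phi>_le: "\<And>i. AE x in lebesgue. \<phi> i x \<le> epow (h i x) (1 / a i) * epow (\<sigma> i x) (1 / \<rho> i)"
    and norm_fin: "\<And>i. (\<integral>\<^sup>+x. epow (h i x) (P i / a i) \<partial>lebesgue) < top"
    and \<theta>: "0 < \<theta>" "\<theta> < 1"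
    and decay: "\<And>j x E. E \<in> sets lebesgue \<Longrightarrow>
     2 * emeasure lebesgue (dcell j x \<inter> E) \<le> emeasure lebesgue (dcell j x) \<Longrightarrow>
     VV (dcell j x \<inter> E) \<le> ennreal \<theta> * VV (dcell j x)"
    and \<beta>_def: "\<beta> = 2 * real CARD('m) * (20 * real CARD('n)) ^ CARD('n) * 3 ^ CARD('n)"
    and lev_def: "lev = (2 ^ CARD('n) * \<beta>) ^ CARD('m)"
begin

text \<open>\<open>F\<close> is the product of averages in the potential, \<open>u\<close> its substitute in
  terms of the \<open>h i\<close>, and \<open>G\<close> the product of norms on the right-hand side of the
  estimate. \<open>Om k\<close> is the set where some \<open>F j\<close> exceeds the level
  \<open>lev\<^sup>k\<close>, and \<open>tau k\<close> is the largest scale \<open>j\<close> where this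
  happens. On \<open>Om k\<close>, \<open>lam k\<close> is the largest term of the potential that this level
  can produce, up to a constant; \<open>psi k\<close> is its \<open>q\<close>-th power.\<close>

definition F :: "int \<Rightarrow> real^'n \<Rightarrow> ennreal" where "F j x = (\<Prod>i\<in>UNIV. avg (bcube j x) (\<phi> i))"
definition u :: "int \<Rightarrow> real^'n \<Rightarrow> ennreal" where "u j x = (\<Prod>i\<in>UNIV. epow (avg (bcube j x) (h i)) (1 / a i))"
definition G :: ennreal where "G = (\<Prod>i\<in>UNIV. epow (\<integral>\<^sup>+x. epow (h i x) (P i / a i) \<partial>lebesgue) (1 / P i))"
definition Om :: "int \<Rightarrow> (real^'n) set" where "Om k = {x. \<exists>j. ennreal (lev powr k) < F j x}"
definition tau :: "int \<Rightarrow> real^'n \<Rightarrow> int" where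
  "tau k x = (SOME j. ennreal (lev powr k) < F j x \<and> (\<forall>j'. ennreal (lev powr k) < F j' x \<longrightarrow> j' \<le> j))"
definition lam :: "int \<Rightarrow> real^'n \<Rightarrow> ennreal" where
  "lam k x = ennreal (lev powr k * side (tau k x) powr \<alpha>)"
definition psi :: "int \<Rightarrow> real^'n \<Rightarrow> ennreal" where
  "psi k x = epow (lam k x) q * indicator (Om k) x"

lemma \<beta>_pos: "1 < \<beta>"
proof -
  have c: "(1::real) \<le> real CARD('m)" "(1::real) \<le> real CARD('n)" by (simp_all add: Suc_leI)
  then have "(1::real) \<le> 20 * real CARD('n)" by linarith
  then have "(1::real) \<le> real CARD('m)" "(1::real) \<le> (20 * real CARD('n)) ^ CARD('n)" "(1::real) \<le> 3 ^ CARD('n)"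
    using c by (auto simp only: intro!: one_le_power)
  then have "1 * 1 * 1 \<le> real CARD('m) * (20 * real CARD('n)) ^ CARD('n) * 3 ^ CARD('n)"
    by (intro mult_mono) auto
  then show ?thesis unfolding \<beta>_def by simp
qed

lemma lev_gt1: "1 < lev"
proof -
  have "1 * 1 < 2 ^ CARD('n) * \<beta>" using \<beta>_pos by (intro mult_le_less_imp_less) auto
  then show ?thesis unfolding lev_def by (intro one_less_power) auto
qed

lemma G_fin: "G < top"
proof -
  have "G \<noteq> top"
    unfolding G_def using norm_fin by (auto simp: ennreal_prod_eq_top less_top)
  then show ?thesis by (simp add: less_top)
qed

lemma F_cong: "idx j x = idx j y \<Longrightarrow> F j x = F j y"
  and u_cong: "idx j x = idx j y \<Longrightarrow> u j x = u j y"
  using bcube_cong[of j x y] by (simp_all add: F_def u_def)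

text \<open>Hoelder's inequality on the cube with the exponents \<open>a i\<close> and \<open>\<rho>
  i\<close>, then the weight condition.\<close>

lemma V_average_F_le: "epow (avg (bcube j x) V) (1 / q) * F j x \<le> ennreal K * u j x"
proof -
  have "F j x \<le> (\<Prod>i\<in>UNIV. epow (avg (bcube j x) (h i)) (1 / a i) * epow (avg (bcube j x) (\<sigma> i)) (1 / \<rho> i))"
    unfolding F_def
  proof (rule prod_mono_ennreal)
    fix i :: 'm
    have "avg (bcube j x) (\<phi> i) \<le> avg (bcube j x) (\<lambda>y. epow (h i y) (1 / a i) * epow (\<sigma> i y) (1 / \<rho> i))"
      using \<phi>_le[of i] by (intro avg_mono_AE) auto
    also have "\<dots> \<le> epow (avg (bcube j x) (h i)) (1 / a i) * epow (avg (bcube j x) (\<sigma> i)) (1 / \<rho> i)"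
      using a_pos \<rho>_pos conj by (intro avg_Holder2) auto
    finally show "avg (bcube j x) (\<phi> i) \<le> epow (avg (bcube j x) (h i)) (1 / a i) * epow (avg (bcube j x) (\<sigma> i)) (1 / \<rho> i)" .
  qed
  also have "\<dots> = u j x * (\<Prod>i\<in>UNIV. epow (avg (bcube j x) (\<sigma> i)) (1 / \<rho> i))"
    by (simp add: u_def prod.distrib)
  finally have "epow (avg (bcube j x) V) (1 / q) * F j x
     \<le> epow (avg (bcube j x) V) (1 / q) * (u j x * (\<Prod>i\<in>UNIV. epow (avg (bcube j x) (\<sigma> i)) (1 / \<rho> i)))"
    by (rule mult_left_mono) simp
  also have "\<dots> = (epow (avg (bcube j x) V) (1 / q) * (\<Prod>i\<in>UNIV. epow (avg (bcube j x) (\<sigma> i)) (1 / \<rho> i))) * u j x"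
    by (simp add: mult_ac)
  also have "\<dots> \<le> ennreal K * u j x"
    unfolding bcube_def by (intro mult_right_mono cond) auto
  finally show ?thesis .
qed

text \<open>By Jensen's inequality with exponent \<open>P i / a i\<close>.\<close>

lemma u_le_G: "u j x * epow (emeasure lebesgue (bcube j x)) (1 / p) \<le> G"
proof -
  let ?b = "emeasure lebesgue (bcube j x)"
  have "epow ?b (1 / p) = (\<Prod>i\<in>UNIV. epow ?b (1 / P i))"
    unfolding p_sum using P_pos by (subst prod_epow_sum) auto
  then have "u j x * epow ?b (1 / p) = (\<Prod>i\<in>UNIV. epow (avg (bcube j x) (h i)) (1 / a i) * epow ?b (1 / P i))"
    by (simp add: u_def prod.distrib)
  also have "\<dots> \<le> G" unfolding G_def
  proof (rule prod_mono_ennreal)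
    fix i :: 'm
    have s: "1 < P i / a i" using a_pos a_less by simp
    have "epow (avg (bcube j x) (h i)) (P i / a i) * ?b \<le> avg (bcube j x) (\<lambda>y. epow (h i y) (P i / a i)) * ?b"
      using s by (intro mult_right_mono avg_Jensen) auto
    also have "\<dots> = (\<integral>\<^sup>+y\<in>bcube j x. epow (h i y) (P i / a i) \<partial>lebesgue)" by (rule avg_bcube_times)
    also have "\<dots> \<le> (\<integral>\<^sup>+y. epow (h i y) (P i / a i) \<partial>lebesgue)"
      by (intro nn_integral_mono) (auto simp: indicator_def)
    finally have "epow (epow (avg (bcube j x) (h i)) (P i / a i) * ?b) (1 / P i)
      \<le> epow (\<integral>\<^sup>+y. epow (h i y) (P i / a i) \<partial>lebesgue) (1 / P i)"
      using P_pos[of i] by (intro epow_mono) auto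
    moreover have "epow (epow (avg (bcube j x) (h i)) (P i / a i) * ?b) (1 / P i)
       = epow (avg (bcube j x) (h i)) (1 / a i) * epow ?b (1 / P i)"
      using P_pos[of i] by (simp add: epow_mult epow_epow)
    ultimately show "epow (avg (bcube j x) (h i)) (1 / a i) * epow ?b (1 / P i)
       \<le> epow (\<integral>\<^sup>+y. epow (h i y) (P i / a i) \<partial>lebesgue) (1 / P i)" by simp
  qed
  finally show ?thesis .
qed

text \<open>The identity \<open>\<alpha> q = n (q - p) / p\<close> turns \<open>side\<^bsup>\<alpha>
  q\<^esup>\<close> into the power \<open>(q - p) / p\<close> of the volume, and this volume together with
  \<open>q - p\<close> of the \<open>q\<close> factors \<open>u\<close> is at most \<open>G\<^bsup>q -
  p\<^esup>\<close>. The remaining \<open>p\<close> factors are kept for the maximal theorem.\<close>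

lemma weighted_cell_bound:
  "epow (ennreal (side j powr \<alpha>) * F j x) q * VV (bcube j x)
     \<le> ennreal (K powr q) * epow G (q - p) * (emeasure lebesgue (bcube j x) * epow (u j x) p)"
proof -
  let ?b = "emeasure lebesgue (bcube j x)" and ?v = "avg (bcube j x) V"
  have qp: "0 < q - p" using p_less_q by simp
  have "epow (epow ?v (1 / q) * F j x) q \<le> epow (ennreal K * u j x) q"
    using q_pos by (intro epow_mono V_average_F_le) auto
  then have 1: "?v * epow (F j x) q \<le> ennreal (K powr q) * epow (u j x) q"
    using q_pos K_pos by (simp add: epow_mult epow_epow epow_ennreal)
  have "epow (ennreal (side j powr \<alpha>)) q = ennreal (side j powr (real CARD('n) * ((q - p) / p)))"
    by (simp add: epow_ennreal powr_powr alpha_q)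
  also have "\<dots> = epow (ennreal (side j ^ CARD('n))) ((q - p) / p)"
    by (simp add: epow_ennreal powr_powr flip: powr_realpow)
  also have "\<dots> \<le> epow ?b ((q - p) / p)"
    unfolding emeasure_bcube using qp p_pos by (intro epow_mono ennreal_leI) auto
  also have "\<dots> = epow (epow ?b (1 / p)) (q - p)" by (simp add: epow_epow)
  finally have 2: "epow (ennreal (side j powr \<alpha>)) q \<le> epow (epow ?b (1 / p)) (q - p)" .
  have 3: "epow (u j x) q = epow (u j x) (q - p) * epow (u j x) p"
    using epow_add[OF qp p_pos, of "u j x"] by simp
  have "epow (ennreal (side j powr \<alpha>) * F j x) q * VV (bcube j x)
     = epow (ennreal (side j powr \<alpha>)) q * (?v * epow (F j x) q) * ?b"
    unfolding VV_def avg_bcube_times[symmetric] using q_pos by (simp add: epow_mult mult_ac)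
  also have "\<dots> \<le> epow (epow ?b (1 / p)) (q - p) * (ennreal (K powr q) * epow (u j x) q) * ?b"
    by (intro mult_right_mono mult_mono 1 2) auto
  also have "\<dots> = ennreal (K powr q) * epow (u j x * epow ?b (1 / p)) (q - p) * (?b * epow (u j x) p)"
    using qp by (simp add: 3 epow_mult mult_ac)
  also have "\<dots> \<le> ennreal (K powr q) * epow G (q - p) * (?b * epow (u j x) p)"
    using qp by (intro mult_right_mono mult_left_mono epow_mono u_le_G) auto
  finally show ?thesis .
qed

lemma weighted_cell_bound_uniform:
  "epow (ennreal (side j powr \<alpha>) * F j x) q * VV (bcube j x) \<le> ennreal (K powr q) * epow G q"
proof -
  let ?b = "emeasure lebesgue (bcube j x)"
  have qp: "0 < q - p" using p_less_q by simp
  have "?b * epow (u j x) p = epow (u j x * epow ?b (1 / p)) p"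
    using p_pos by (simp add: epow_mult epow_epow mult.commute)
  also have "\<dots> \<le> epow G p" using p_pos by (intro epow_mono u_le_G) auto
  finally have "ennreal (K powr q) * epow G (q - p) * (?b * epow (u j x) p) \<le> ennreal (K powr q) * epow G (q - p) * epow G p"
    by (rule mult_left_mono) simp
  also have "\<dots> = ennreal (K powr q) * epow G q"
    using epow_add[OF qp p_pos, of G] by (simp add: mult.assoc)
  finally show ?thesis using weighted_cell_bound[of j x] by (rule order_trans[rotated])
qed

lemma F_finite: "F j x < top"
proof (rule ccontr)
  assume "\<not> F j x < top"
  then have "epow (ennreal (side j powr \<alpha>) * F j x) q = top"
    by (simp add: less_top[symmetric] ennreal_mult_eq_top_iff)
  then have "epow (ennreal (side j powr \<alpha>) * F j x) q * VV (bcube j x) = top"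
    using VV_bcube(1)[of j x] by (simp add: ennreal_mult_eq_top_iff)
  with weighted_cell_bound_uniform[of j x] have "ennreal (K powr q) * epow G q = top" by (simp add: top_unique)
  then show False using G_fin by (simp add: ennreal_mult_eq_top_iff)
qed

text \<open>Along growing cubes \<open>V\<close> does not decrease while \<open>side\<^sup>\<alpha>\<close>
  grows, so by the uniform bound \<open>F\<close> tends to zero. Hence there is a largest scale at which it
  exceeds the level.\<close>

lemma large_F_bounded_scale: "\<exists>J. \<forall>j. ennreal (lev powr real_of_int k) < F j x \<longrightarrow> j \<le> J"
proof -
  obtain v where v: "VV (bcube 0 x) = ennreal v" "0 < v"
    using VV_bcube[of 0 x] by (cases "VV (bcube 0 x)") auto
  obtain c where c: "ennreal (K powr q) * epow G q = ennreal c" "0 \<le> c"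
    using G_fin by (cases "ennreal (K powr q) * epow G q") (auto simp: ennreal_mult_eq_top_iff)
  define l where "l = lev powr real_of_int k"
  have l: "0 < l" using lev_gt1 by (simp add: l_def)
  define d where "d = (c / v / l powr q) powr (1 / (\<alpha> * q))"
  obtain J where J: "0 \<le> J" "d + 1 \<le> side J" using side_unbounded by blast
  have "j \<le> J" if "ennreal l < F j x" for j
  proof (rule ccontr)
    assume "\<not> j \<le> J"
    then have j: "0 \<le> j" "d < side j" using J side_mono[of J j] by auto
    have "ennreal ((side j powr \<alpha> * l) powr q * v) = epow (ennreal (side j powr \<alpha>) * ennreal l) q * VV (bcube 0 x)"
      using l v by (simp add: epow_ennreal flip: ennreal_mult)
    also have "\<dots> \<le> epow (ennreal (side j powr \<alpha>) * F j x) q * VV (bcube j x)"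
      using q_pos that j(1) by (intro mult_mono epow_mono mult_left_mono VV_mono bcube_mono) auto
    also have "\<dots> \<le> ennreal c" using weighted_cell_bound_uniform[of j x] c by simp
    finally have "(side j powr \<alpha> * l) powr q * v \<le> c" using c(2) by (simp only: ennreal_le_iff)
    then have "side j powr (\<alpha> * q) \<le> c / v / l powr q"
      using v l by (simp add: powr_mult powr_powr field_simps)
    then have "(side j powr (\<alpha> * q)) powr (1 / (\<alpha> * q)) \<le> d"
      unfolding d_def using \<alpha>_pos q_pos by (intro powr_mono2) auto
    then have "side j \<le> d" using \<alpha>_pos q_pos by (simp add: powr_powr)
    with j(2) show False by simp
  qed
  then show ?thesis unfolding l_def by blast
qed

lemma tau_exists:
  assumes "x \<in> Om k"
  shows "\<exists>j. ennreal (lev powr k) < F j x \<and> (\<forall>j'. ennreal (lev powr k) < F j' x \<longrightarrow> j' \<le> j)"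
proof -
  obtain j0 where j0: "ennreal (lev powr k) < F j0 x" using assms by (auto simp: Om_def)
  obtain J where J: "\<And>j. ennreal (lev powr k) < F j x \<Longrightarrow> j \<le> J" using large_F_bounded_scale by blast
  obtain j where j: "ennreal (lev powr k) < F j x"
     "\<And>j'. ennreal (lev powr k) < F j' x \<Longrightarrow> nat (J - j) \<le> nat (J - j')"
    using ex_has_least_nat[of "\<lambda>j. ennreal (lev powr k) < F j x" j0 "\<lambda>j. nat (J - j)"] j0 by blast
  have "j' \<le> j" if "ennreal (lev powr k) < F j' x" for j'
    using j(2)[OF that] J[OF that] J[OF j(1)] by linarith
  with j(1) show ?thesis by blast
qed

lemma tau: assumes "x \<in> Om k"
  shows "ennreal (lev powr k) < F (tau k x) x" "\<And>j. ennreal (lev powr k) < F j x \<Longrightarrow> j \<le> tau k x"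
  using someI_ex[OF tau_exists[OF assms]] unfolding tau_def by blast+

lemma tau_eqI:
  assumes "ennreal (lev powr k) < F j x" "\<And>j'. ennreal (lev powr k) < F j' x \<Longrightarrow> j' \<le> j"
  shows "tau k x = j"
proof -
  have "x \<in> Om k" using assms by (auto simp: Om_def)
  then show ?thesis using tau[of x k] assms by (intro antisym) auto
qed

text \<open>At scales at least \<open>tau k x\<close> all points of the cell have the same averages as
  \<open>x\<close>, so they stop at the same scale.\<close>

lemma stopping_Om: "stopping (Om k) (tau k)"
  unfolding stopping_def
proof (intro ballI)
  fix x y assume x: "x \<in> Om k" and "y \<in> dcell (tau k x) x"
  then have e: "idx (tau k x) y = idx (tau k x) x" by (simp add: dcell_def)
  have big: "F j y = F j x" if "tau k x \<le> j" for j
    using F_cong[OF idx_eq_coarser[OF that e]] .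
  have "ennreal (lev powr k) < F (tau k x) y" using tau(1)[OF x] big by simp
  moreover have "j \<le> tau k x" if "ennreal (lev powr k) < F j y" for j
  proof (rule ccontr)
    assume "\<not> j \<le> tau k x"
    then show False using that big[of j] tau(2)[OF x, of j] by simp
  qed
  ultimately show "y \<in> Om k \<and> tau k y = tau k x" using tau_eqI by (auto simp: Om_def)
qed

lemma lev_mono: "k \<le> l \<Longrightarrow> ennreal (lev powr real_of_int k) \<le> ennreal (lev powr real_of_int l)"
  using lev_gt1 by (intro ennreal_leI powr_mono) auto

lemma Om_antimono: "k \<le> l \<Longrightarrow> Om l \<subseteq> Om k"
  unfolding Om_def using lev_mono le_less_trans by blast

lemma tau_antimono: "k \<le> l \<Longrightarrow> x \<in> Om l \<Longrightarrow> tau l x \<le> tau k x"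
  using le_less_trans[OF lev_mono[of k l] tau(1)[of x l]] Om_antimono[of k l] by (intro tau(2)) auto

lemma Om_sets [measurable, simp]: "Om k \<in> sets lebesgue"
  by (rule stopping_measurable[OF stopping_Om])

lemma lam_le: assumes "x \<in> Om k" shows "lam k x \<le> ennreal (side (tau k x) powr \<alpha>) * F (tau k x) x"
proof -
  have "lam k x = ennreal (side (tau k x) powr \<alpha>) * ennreal (lev powr k)"
    by (simp add: lam_def mult.commute flip: ennreal_mult)
  also have "\<dots> \<le> ennreal (side (tau k x) powr \<alpha>) * F (tau k x) x"
    using tau(1)[OF assms] by (intro mult_left_mono) auto
  finally show ?thesis .
qed

lemma psi_measurable [measurable]: "psi k \<in> borel_measurable lebesgue"
  unfolding psi_def[abs_def]
proof (rule stopping_function_measurable[OF stopping_Om])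
  fix x y assume "x \<in> Om k" "y \<in> dcell (tau k x) x"
  then have "tau k y = tau k x" using stopping_Om[of k] unfolding stopping_def by blast
  then show "epow (lam k y) q = epow (lam k x) q" by (simp add: lam_def)
qed

text \<open>Cells of a higher level lie inside cells of a lower one.\<close>

lemma psi_const:
  assumes "x \<in> Om l" "k \<le> l" "y \<in> dcell (tau l x) x" shows "psi k y = psi k x"
proof -
  have x: "x \<in> Om k" using assms Om_antimono by blast
  have "y \<in> dcell (tau k x) x"
    using idx_eq_coarser[OF tau_antimono[OF assms(2,1)]] assms(3) by (simp add: dcell_def)
  then have "y \<in> Om k \<and> tau k y = tau k x" using stopping_Om[of k] x unfolding stopping_def by blast
  with x show ?thesis by (simp add: psi_def lam_def)
qed

text \<open>By maximality of the scale, \<open>F\<close> on the parent is at most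
  \<open>lev\<^sup>k\<close>; so the product of the averages \<open>A i\<close> over the cube of the cell is
  at most \<open>2\<^bsup>mn\<^esup> lev\<^sup>k\<close>. A point of the cell in the next level set has a
  smaller cube where the product exceeds \<open>lev\<^bsup>k+1\<^esup> = \<beta>\<^sup>m 2\<^bsup>mn\<^esup>
  lev\<^sup>k\<close>, so one of the \<open>m\<close> averages has grown by the factor
  \<open>\<beta>\<close>. The weak type bound, applied to each \<open>\<phi> i\<close> on the cube, limits
  the measure of such points, and \<open>\<beta>\<close> is just large enough for one half.\<close>

lemma level_sets_sparse:
  assumes x: "x \<in> Om k"
  shows "2 * emeasure lebesgue (dcell (tau k x) x \<inter> Om (k + 1)) \<le> emeasure lebesgue (dcell (tau k x) x)"
proof -
  define j where "j = tau k x"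
  define Q where "Q = dcell j x"
  define B where "B = bcube j x"
  define A where "A i = avg B (\<phi> i)" for i
  define n where "n = CARD('n)"
  define m where "m = CARD('m)"
  define w where "w = (20 * real n) ^ n"
  have [measurable]: "Q \<in> sets lebesgue" "B \<in> sets lebesgue" by (simp_all add: Q_def B_def)
  have prodA: "(\<Prod>i\<in>UNIV. A i) = F j x" by (simp add: A_def F_def B_def)
  have "0 < F j x" using tau(1)[OF x] unfolding j_def by (rule le_less_trans[rotated]) simp
  then have A0: "A i \<noteq> 0" for i unfolding prodA[symmetric] by (auto simp: zero_less_iff_neq_zero)
  have A_fin: "A i \<noteq> top" for i
  proof
    assume "A i = top"
    then have "(\<Prod>i\<in>UNIV. A i) = top" using A0 by (auto simp: ennreal_prod_eq_top)
    then show False using F_finite[of j x] by (simp add: prodA)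
  qed
  have A_up: "(\<Prod>i\<in>UNIV. A i) \<le> ennreal ((2 ^ n) ^ m * lev powr k)"
  proof -
    have "A i \<le> ennreal (2 ^ n) * avg (bcube (j + 1) x) (\<phi> i)" for i
    proof -
      have "(\<integral>\<^sup>+y\<in>B. \<phi> i y \<partial>lebesgue) \<le> (\<integral>\<^sup>+y\<in>bcube (j + 1) x. \<phi> i y \<partial>lebesgue)"
        unfolding B_def using bcube_mono[of j "j + 1" x] by (intro nn_integral_mono) (auto simp: indicator_def)
      then have "A i \<le> (\<integral>\<^sup>+y\<in>bcube (j + 1) x. \<phi> i y \<partial>lebesgue) / emeasure lebesgue B"
        unfolding A_def avg_def by (rule divide_right_mono_ennreal)
      also have "\<dots> = (avg (bcube (j + 1) x) (\<phi> i) * (ennreal (2 ^ n) * emeasure lebesgue B)) / emeasure lebesgue B"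
        unfolding avg_bcube_times[symmetric] B_def emeasure_bcube side_add1
        by (simp add: n_def power_mult_distrib ennreal_mult mult_ac)
      also have "\<dots> = (ennreal (2 ^ n) * avg (bcube (j + 1) x) (\<phi> i)) * emeasure lebesgue B / emeasure lebesgue B"
        by (simp add: mult_ac)
      also have "\<dots> = ennreal (2 ^ n) * avg (bcube (j + 1) x) (\<phi> i)"
        unfolding B_def emeasure_bcube by (rule mult_divide_eq_ennreal) simp_all
      finally show ?thesis .
    qed
    then have "(\<Prod>i\<in>UNIV. A i) \<le> (\<Prod>i\<in>UNIV. ennreal (2 ^ n) * avg (bcube (j + 1) x) (\<phi> i))"
      by (intro prod_mono_ennreal) simp
    also have "\<dots> = ennreal ((2 ^ n) ^ m) * F (j + 1) x"
      by (simp add: prod.distrib F_def m_def ennreal_power)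
    also have "\<dots> \<le> ennreal ((2 ^ n) ^ m) * ennreal (lev powr k)"
      using tau(2)[OF x, of "j + 1"] by (intro mult_left_mono) (auto simp: j_def not_less[symmetric])
    finally show ?thesis by (simp add: ennreal_mult)
  qed
  define E where "E i = {y. ennreal (\<beta> * enn2real (A i)) < maxf (\<lambda>y. \<phi> i y * indicator B y) y}" for i
  have A_real: "ennreal (enn2real (A i)) = A i" "0 < enn2real (A i)" for i
    using A0[of i] A_fin[of i] by (auto simp: less_top enn2real_positive_iff zero_less_iff_neq_zero)
  have [measurable]: "E i \<in> sets lebesgue" for i
    unfolding E_def by (rule lebesgue_less_set) measurable
  \<comment> \<open>If no single average had grown by \<open>\<beta>\<close>, the product would be too
    small.\<close>
  have cover: "Q \<inter> Om (k + 1) \<subseteq> (\<Union>i. E i)"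
  proof
    fix y assume "y \<in> Q \<inter> Om (k + 1)"
    then have yQ: "y \<in> Q" and y1: "y \<in> Om (k + 1)" by auto
    have idx: "idx j y = idx j x" using yQ by (simp add: Q_def dcell_def)
    obtain j' where j': "ennreal (lev powr real_of_int (k + 1)) < F j' y" using y1 by (auto simp: Om_def)
    have "y \<in> Om k \<and> tau k y = j"
      using stopping_Om[of k] x yQ unfolding stopping_def Q_def j_def by blast
    moreover have "ennreal (lev powr real_of_int k) < F j' y"
      by (rule le_less_trans[OF lev_mono j']) simp
    ultimately have "j' \<le> j" using tau(2)[of y k j'] by simp
    then have sub: "bcube j' y \<subseteq> B" using bcube_mono[of j' j y] bcube_cong[OF idx] by (simp add: B_def)
    have "\<exists>i. ennreal (\<beta> * enn2real (A i)) < avg (bcube j' y) (\<phi> i)"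
    proof (rule ccontr)
      assume "\<not> ?thesis"
      then have "F j' y \<le> (\<Prod>i\<in>UNIV. ennreal (\<beta> * enn2real (A i)))"
        unfolding F_def by (intro prod_mono_ennreal) (auto simp: not_less)
      also have "\<dots> = (\<Prod>i\<in>UNIV. ennreal \<beta> * A i)"
        using A_real \<beta>_pos by (intro prod.cong) (auto simp: ennreal_mult)
      also have "\<dots> = ennreal (\<beta> ^ m) * (\<Prod>i\<in>UNIV. A i)"
        using \<beta>_pos by (simp add: prod.distrib m_def ennreal_power)
      also have "\<dots> \<le> ennreal (\<beta> ^ m) * ennreal ((2 ^ n) ^ m * lev powr k)"
        by (intro mult_left_mono A_up) auto
      also have "\<dots> = ennreal (lev * lev powr k)"
        using \<beta>_pos by (simp add: lev_def n_def m_def power_mult_distrib mult_ac flip: ennreal_mult)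
      also have "lev * lev powr k = lev powr real_of_int (k + 1)"
        using lev_gt1 by (simp add: powr_add)
      finally show False using j' by simp
    qed
    then obtain i where "ennreal (\<beta> * enn2real (A i)) < avg (bcube j' y) (\<phi> i)" by blast
    also have "\<dots> = avg (bcube j' y) (\<lambda>y. \<phi> i y * indicator B y)"
      unfolding avg_def using sub by (intro arg_cong2[where f="(/)"] nn_integral_cong) (auto simp: indicator_def)
    also have "\<dots> \<le> maxf (\<lambda>y. \<phi> i y * indicator B y) y" by (rule avg_le_maxf)
    finally show "y \<in> (\<Union>i. E i)" by (auto simp: E_def)
  qed
  have Emeas: "emeasure lebesgue (E i) \<le> ennreal (w * 3 ^ n / \<beta>) * emeasure lebesgue Q" for i
  proof -
    define r where "r = \<beta> * enn2real (A i)"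
    have r: "0 < r" using A_real[of i] \<beta>_pos by (simp add: r_def)
    have "ennreal r * emeasure lebesgue (E i) \<le> ennreal w * (\<integral>\<^sup>+y. \<phi> i y * indicator B y \<partial>lebesgue)"
      unfolding E_def r_def[symmetric] w_def n_def using r by (intro maxf_weak_type) auto
    also have "(\<integral>\<^sup>+y. \<phi> i y * indicator B y \<partial>lebesgue) = A i * emeasure lebesgue B"
      unfolding A_def B_def by (rule avg_bcube_times[symmetric])
    also have "A i = ennreal (r / \<beta>)" using A_real[of i] \<beta>_pos by (simp add: r_def)
    also have "emeasure lebesgue B = ennreal (3 ^ n) * emeasure lebesgue Q"
      unfolding B_def Q_def emeasure_bcube emeasure_dcell n_def by (rule ennreal_mult) auto
    also have "ennreal w * (ennreal (r / \<beta>) * (ennreal (3 ^ n) * emeasure lebesgue Q)) =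
        ennreal r * (ennreal (w * 3 ^ n / \<beta>) * emeasure lebesgue Q)"
    proof -
      have "ennreal w * (ennreal (r / \<beta>) * (ennreal (3 ^ n) * emeasure lebesgue Q))
         = (ennreal w * ennreal (r / \<beta>) * ennreal (3 ^ n)) * emeasure lebesgue Q" by (simp only: mult_ac)
      also have "ennreal w * ennreal (r / \<beta>) * ennreal (3 ^ n) = ennreal (w * (r / \<beta>) * 3 ^ n)"
        using r \<beta>_pos by (simp add: w_def flip: ennreal_mult)
      also have "w * (r / \<beta>) * 3 ^ n = r * (w * 3 ^ n / \<beta>)" by simp
      also have "ennreal (r * (w * 3 ^ n / \<beta>)) = ennreal r * ennreal (w * 3 ^ n / \<beta>)"
        using r \<beta>_pos by (intro ennreal_mult) (auto simp: w_def)
      finally show ?thesis by (simp only: mult.assoc)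
    qed
    finally show ?thesis using r ennreal_mult_le_mult_iff[of "ennreal r"] by simp
  qed
  have "2 * emeasure lebesgue (Q \<inter> Om (k + 1)) \<le> 2 * emeasure lebesgue (\<Union>i. E i)"
    using cover by (intro mult_left_mono emeasure_mono) auto
  also have "emeasure lebesgue (\<Union>i. E i) \<le> (\<Sum>i\<in>UNIV. emeasure lebesgue (E i))"
    by (rule emeasure_subadditive_finite) auto
  also have "\<dots> \<le> (\<Sum>i\<in>(UNIV :: 'm set). ennreal (w * 3 ^ n / \<beta>) * emeasure lebesgue Q)"
    by (intro sum_mono Emeas)
  also have "\<dots> = ennreal (real m) * (ennreal (w * 3 ^ n / \<beta>) * emeasure lebesgue Q)"
    by (simp only: sum_constant m_def ennreal_of_nat_eq_real_of_nat)
  also have "2 * \<dots> = (ennreal 2 * ennreal (real m) * ennreal (w * 3 ^ n / \<beta>)) * emeasure lebesgue Q"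
    by (simp only: mult.assoc ennreal_numeral)
  also have "ennreal 2 * ennreal (real m) * ennreal (w * 3 ^ n / \<beta>) = ennreal (2 * real m * (w * 3 ^ n / \<beta>))"
  proof -
    have "0 \<le> w * 3 ^ n / \<beta>" using \<beta>_pos by (simp add: w_def)
    then show ?thesis by (simp only: ennreal_mult[symmetric] zero_le_numeral of_nat_0_le_iff mult_nonneg_nonneg)
  qed
  also have "2 * real m * (w * 3 ^ n / \<beta>) = 1"
    using \<beta>_pos by (simp add: \<beta>_def w_def n_def m_def field_simps)
  finally show ?thesis by (simp add: Q_def j_def mult_left_mono)
qed

end

section \<open>The weighted estimate for the dyadic potential\<close>

definition dyadic_potential :: "real \<Rightarrow> ('m::finite \<Rightarrow> real^'n \<Rightarrow> ennreal) \<Rightarrow> real^'n \<Rightarrow> ennreal" where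
  "dyadic_potential \<alpha> \<phi> x =
     (\<Sum>\<^sup>+j. ennreal (side j powr \<alpha>) * (\<Prod>i\<in>UNIV. avg (bcube j x) (\<phi> i)))"

lemma dyadic_potential_measurable [measurable]:
  "dyadic_potential \<alpha> \<phi> \<in> borel_measurable lebesgue"
proof -
  have eq: "dyadic_potential \<alpha> \<phi> = (\<lambda>x. \<Sum>n. ennreal (side (from_nat_into UNIV n) powr \<alpha>) *
      (\<Prod>i\<in>UNIV. avg (bcube (from_nat_into UNIV n) x) (\<phi> i)))"
    unfolding dyadic_potential_def
    by (rule ext, subst nn_integral_bij_count_space[symmetric, OF bij_betw_from_nat_into[of "UNIV :: int set"]])
       (auto simp: infinite_UNIV_int nn_integral_count_space_nat)
  show ?thesis unfolding eq by measurable
qed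

lemma ennreal_mult3:
  "0 \<le> x \<Longrightarrow> 0 \<le> y \<Longrightarrow> 0 \<le> z \<Longrightarrow> ennreal x * ennreal y * (ennreal z * g) = ennreal (x * y * z) * g"
  by (simp add: ennreal_mult mult.assoc)

text \<open>A geometric weight in the distance to the last index makes the \<open>q\<close>-th power of a
  sum comparable with the sum of the \<open>q\<close>-th powers, for \<open>q < 1\<close> and \<open>q >
  1\<close> alike: each \<open>g k\<close> is at most \<open>T\<^bsup>1/q\<^esup>\<close> times a geometric
  factor.\<close>

lemma quasi_sum_bound:
  fixes g :: "int \<Rightarrow> ennreal"
  assumes r: "1 < r" and q: "0 < q" and zero: "\<And>k. K < k \<Longrightarrow> g k = 0"
    and T: "\<And>k. k \<le> K \<Longrightarrow> ennreal (r powr real_of_int (K - k)) * epow (g k) q \<le> T"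
  shows "epow (\<Sum>\<^sup>+k. g k) q \<le> ennreal ((r powr (1 / q) / (r powr (1 / q) - 1)) powr q) * T"
proof -
  define b where "b = r powr (1 / q)"
  have b: "1 < b" using r q by (simp add: b_def)
  have "g k \<le> epow T (1 / q) * (ennreal (b powr real_of_int (- K)) * (ennreal (b powr real_of_int k) * indicator {..K} k))" for k
  proof (cases "k \<le> K")
    case True
    have bb: "b powr real_of_int (k - K) = (1 / r powr real_of_int (K - k)) powr (1 / q)"
      using r by (simp add: b_def powr_powr powr_divide divide_inverse flip: powr_minus) (simp add: algebra_simps)
    have "epow (g k) q = ennreal (1 / r powr real_of_int (K - k)) * (ennreal (r powr real_of_int (K - k)) * epow (g k) q)"
      using r by (simp flip: mult.assoc ennreal_mult)
    also have "\<dots> \<le> ennreal (1 / r powr real_of_int (K - k)) * T"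
      by (intro mult_left_mono T True) simp
    finally have "epow (epow (g k) q) (1 / q) \<le> epow (ennreal (1 / r powr real_of_int (K - k)) * T) (1 / q)"
      using q by (intro epow_mono) auto
    then have "g k \<le> ennreal (b powr real_of_int (k - K)) * epow T (1 / q)"
      using q unfolding bb by (simp add: epow_epow epow_mult epow_ennreal)
    also have "b powr real_of_int (k - K) = b powr real_of_int (- K) * b powr real_of_int k"
      by (simp add: powr_add[symmetric])
    finally show ?thesis using True by (simp add: ennreal_mult mult_ac)
  qed (simp add: zero)
  then have "(\<Sum>\<^sup>+k. g k)
     \<le> (\<Sum>\<^sup>+k. epow T (1 / q) * (ennreal (b powr real_of_int (- K)) * (ennreal (b powr real_of_int k) * indicator {..K} k)))"
    by (rule nn_integral_mono)
  also have "\<dots> = epow T (1 / q) * (ennreal (b powr real_of_int (- K)) * ennreal (b powr real_of_int K * (b / (b - 1))))"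
    by (simp add: nn_integral_cmult geometric_int[OF b])
  also have "ennreal (b powr real_of_int (- K)) * ennreal (b powr real_of_int K * (b / (b - 1))) = ennreal (b / (b - 1))"
    using b by (simp add: powr_minus flip: ennreal_mult)
  finally have "epow (\<Sum>\<^sup>+k. g k) q \<le> epow (epow T (1 / q) * ennreal (b / (b - 1))) q"
    using q by (intro epow_mono) auto
  also have "\<dots> = ennreal ((b / (b - 1)) powr q) * T"
    using q b by (simp add: epow_mult epow_epow epow_ennreal mult.commute)
  finally show ?thesis by (simp add: b_def)
qed

context frac_data
begin

text \<open>Every \<open>F j x\<close> is split into the levels below it. For a fixed level only scales up
  to \<open>tau k x\<close> contribute, and the sum of \<open>side\<^sup>\<alpha>\<close> over them is
  geometric because \<open>\<alpha> > 0\<close>.\<close>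

lemma potential_le_level_sum:
  "dyadic_potential \<alpha> \<phi> x \<le> ennreal (lev * (2 powr \<alpha> / (2 powr \<alpha> - 1))) *
     (\<Sum>\<^sup>+k. lam k x * indicator (Om k) x)"
proof -
  have gt1: "1 < (2::real) powr \<alpha>" using \<alpha>_pos by simp
  define c where "c = 2 powr \<alpha> / (2 powr \<alpha> - 1)"
  have c: "0 < c" using gt1 by (simp add: c_def)
  let ?f = "\<lambda>j k. ennreal (side j powr \<alpha>) *
    (ennreal (lev powr (1 * (real_of_int k + 1))) * indicator {k. ennreal (lev powr real_of_int k) < F j x} k)"
  have "dyadic_potential \<alpha> \<phi> x = (\<Sum>\<^sup>+j. ennreal (side j powr \<alpha>) * F j x)"
    by (simp add: dyadic_potential_def F_def)
  also have "\<dots> \<le> (\<Sum>\<^sup>+j. ennreal (side j powr \<alpha>) *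
      (\<Sum>\<^sup>+k. ennreal (lev powr (1 * (real_of_int k + 1))) * indicator {k. ennreal (lev powr real_of_int k) < F j x} k))"
    using level_sum[OF lev_gt1, of 1 "F _ x"] by (intro nn_integral_mono mult_left_mono) auto
  also have "\<dots> = (\<Sum>\<^sup>+j. (\<Sum>\<^sup>+k. ?f j k))"
    by (simp add: nn_integral_cmult)
  also have "\<dots> = (\<Sum>\<^sup>+k. (\<Sum>\<^sup>+j. ?f j k))"
    by (rule nn_integral_count_space_nn_integral) auto
  also have "\<dots> \<le> (\<Sum>\<^sup>+k. ennreal (lev * c) * (lam k x * indicator (Om k) x))"
  proof (rule nn_integral_mono)
    fix k :: int
    show "(\<Sum>\<^sup>+j. ?f j k)
      \<le> ennreal (lev * c) * (lam k x * indicator (Om k) x)"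
    proof (cases "x \<in> Om k")
      case False
      then have "\<not> ennreal (lev powr real_of_int k) < F j x" for j by (auto simp: Om_def)
      then show ?thesis by simp
    next
      case True
      have "(\<Sum>\<^sup>+j. ?f j k)
        \<le> (\<Sum>\<^sup>+j. ennreal (lev powr (real_of_int k + 1)) * (ennreal ((2 powr \<alpha>) powr real_of_int j) * indicator {..tau k x} j))"
      proof (rule nn_integral_mono)
        fix j
        show "?f j k
          \<le> ennreal (lev powr (real_of_int k + 1)) * (ennreal ((2 powr \<alpha>) powr real_of_int j) * indicator {..tau k x} j)"
          using tau(2)[OF True, of j] by (auto simp: indicator_def side_def powr_powr mult.commute)
      qed
      also have "\<dots> = ennreal (lev powr (real_of_int k + 1)) * ennreal ((2 powr \<alpha>) powr real_of_int (tau k x) * c)"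
        by (simp add: nn_integral_cmult geometric_int[OF gt1] c_def)
      also have "\<dots> = ennreal (lev * c) * lam k x"
        using lev_gt1 c by (simp add: lam_def side_def powr_powr powr_add mult_ac flip: ennreal_mult)
      finally show ?thesis using True by simp
    qed
  qed
  also have "\<dots> = ennreal (lev * c) * (\<Sum>\<^sup>+k. lam k x * indicator (Om k) x)"
    by (rule nn_integral_cmult) simp
  finally show ?thesis by (simp add: c_def)
qed

text \<open>The inner sum over \<open>l\<close> dominates \<open>r\<close> to the power of the number of
  levels above \<open>k\<close> at \<open>x\<close>. If \<open>x\<close> belongs to all level sets the
  right-hand side is infinite, so there is no need to exclude this case.\<close>

lemma level_sum_power:
  assumes r: "1 < r"
  shows "epow (\<Sum>\<^sup>+k. lam k x * indicator (Om k) x) q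
    \<le> ennreal ((r powr (1 / q) / (r powr (1 / q) - 1)) powr q) *
      (\<Sum>\<^sup>+k. psi k x * (\<Sum>\<^sup>+l. ennreal (r ^ l) * indicator (Om (k + int l)) x))"
    (is "_ \<le> ennreal ?C * ?T")
proof -
  have C: "0 < ?C" using r q_pos by simp
  have term_le: "psi k x * (ennreal (r ^ l) * indicator (Om (k + int l)) x) \<le> ?T" for k l
  proof -
    have "psi k x * (ennreal (r ^ l) * indicator (Om (k + int l)) x)
       \<le> psi k x * (\<Sum>\<^sup>+l. ennreal (r ^ l) * indicator (Om (k + int l)) x)"
      by (intro mult_left_mono nn_integral_ge_point) auto
    also have "\<dots> \<le> ?T" by (rule nn_integral_ge_point) simp
    finally show ?thesis .
  qed
  consider "\<And>k. x \<in> Om k" | "\<And>k. x \<notin> Om k" | k0 k1 where "x \<in> Om k0" "x \<notin> Om k1" by blast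
  then show ?thesis
  proof cases
    case 1
    have "psi 0 x * ennreal (r ^ l) \<le> ?T" for l using term_le[of 0 l] 1 by simp
    have "?T = top"
    proof (rule ccontr)
      assume fin: "?T \<noteq> top"
      then obtain t where t: "?T = ennreal t" "0 \<le> t" by (cases ?T) auto
      obtain s where s: "psi 0 x = ennreal s" "0 < s"
        using 1 lev_gt1 by (simp add: psi_def lam_def epow_ennreal)
      obtain l where l: "t / s < r ^ l" using real_arch_pow[OF r] by blast
      have "ennreal (s * r ^ l) \<le> ennreal t"
        using \<open>psi 0 x * ennreal (r ^ l) \<le> ?T\<close> s r unfolding t by (simp add: ennreal_mult)
      then have "s * r ^ l \<le> t" using t by (simp only: ennreal_le_iff)
      with l s show False by (simp add: field_simps)
    qed
    then show ?thesis using C by (simp add: ennreal_mult_top)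
  next
    case 2
    then show ?thesis using q_pos by simp
  next
    case 3
    have below: "k < k1" if "x \<in> Om k" for k
      using 3(2) that Om_antimono[of k1 k] by (cases "k < k1") auto
    obtain K where K: "x \<in> Om K" "\<And>k. x \<in> Om k \<Longrightarrow> k \<le> K"
    proof -
      obtain k where k: "x \<in> Om k" "\<And>k'. x \<in> Om k' \<Longrightarrow> nat (k1 - k) \<le> nat (k1 - k')"
        using ex_has_least_nat[of "\<lambda>k. x \<in> Om k" k0 "\<lambda>k. nat (k1 - k)"] 3(1) by blast
      have "k' \<le> k" if "x \<in> Om k'" for k' using k(2)[OF that] below[OF that] below[OF k(1)] by linarith
      with k(1) that show thesis by blast
    qed
    show ?thesis
    proof (rule quasi_sum_bound[OF r q_pos])
      fix k assume "K < k"
      then have "x \<notin> Om k" using K(2)[of k] by auto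
      then show "lam k x * indicator (Om k) x = 0" by simp
    next
      fix k assume k: "k \<le> K"
      then have xk: "x \<in> Om k" using K(1) Om_antimono by blast
      have "ennreal (r powr real_of_int (K - k)) * epow (lam k x * indicator (Om k) x) q
         = psi k x * (ennreal (r ^ nat (K - k)) * indicator (Om (k + int (nat (K - k)))) x)"
        using xk K(1) k r by (simp add: psi_def mult.commute flip: powr_realpow)
      also have "\<dots> \<le> ?T" by (rule term_le)
      finally show "ennreal (r powr real_of_int (K - k)) * epow (lam k x * indicator (Om k) x) q \<le> ?T" .
    qed
  qed
qed

text \<open>By sparseness \<open>Om (m + 1)\<close> carries at most the fraction \<open>\<theta>\<close> of
  \<open>V\<close> on each cell of level \<open>m\<close>, and \<open>psi k\<close> is constant
  there.\<close>

lemma psi_decay: "(\<integral>\<^sup>+x\<in>Om (k + int l). psi k x * V x \<partial>lebesgue) \<le> ennreal (\<theta> ^ l) * (\<integral>\<^sup>+x. psi k x * V x \<partial>lebesgue)"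
proof (induction l)
  case 0
  have "(\<integral>\<^sup>+x\<in>Om k. psi k x * V x \<partial>lebesgue) \<le> (\<integral>\<^sup>+x. psi k x * V x \<partial>lebesgue)"
    by (intro nn_integral_mono) (auto simp: indicator_def)
  then show ?case by simp
next
  case (Suc l)
  define m where "m = k + int l"
  have km: "k \<le> m" by (simp add: m_def)
  have sub: "Om (m + 1) \<subseteq> Om m" by (rule Om_antimono) simp
  have "(\<integral>\<^sup>+x\<in>Om (m + 1). psi k x * V x \<partial>lebesgue) = (\<integral>\<^sup>+x\<in>Om m. psi k x * V x * indicator (Om (m + 1)) x \<partial>lebesgue)"
    using sub by (intro nn_integral_cong) (auto simp: indicator_def)
  also have "\<dots> \<le> (\<integral>\<^sup>+x\<in>Om m. ennreal \<theta> * (psi k x * V x) \<partial>lebesgue)"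
  proof (rule stopping_nn_integral_mono[OF stopping_Om])
    fix x assume x: "x \<in> Om m"
    let ?Q = "dcell (tau m x) x"
    have const: "psi k y = psi k x" if "y \<in> ?Q" for y using psi_const[OF x km that] .
    have "(\<integral>\<^sup>+y\<in>?Q. psi k y * V y * indicator (Om (m + 1)) y \<partial>lebesgue)
        = (\<integral>\<^sup>+y. psi k x * (V y * indicator (?Q \<inter> Om (m + 1)) y) \<partial>lebesgue)"
    proof (rule nn_integral_cong)
      fix y show "psi k y * V y * indicator (Om (m + 1)) y * indicator ?Q y = psi k x * (V y * indicator (?Q \<inter> Om (m + 1)) y)"
        using const[of y] by (cases "y \<in> ?Q") (simp_all add: indicator_def)
    qed
    also have "\<dots> = psi k x * VV (?Q \<inter> Om (m + 1))"
      unfolding VV_def by (rule nn_integral_cmult) measurable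
    also have "\<dots> \<le> psi k x * (ennreal \<theta> * VV ?Q)"
      by (intro mult_left_mono decay level_sets_sparse x) auto
    also have "\<dots> = (\<integral>\<^sup>+y. (psi k x * ennreal \<theta>) * (V y * indicator ?Q y) \<partial>lebesgue)"
      unfolding VV_def by (subst nn_integral_cmult) (auto simp: mult.assoc)
    also have "\<dots> = (\<integral>\<^sup>+y\<in>?Q. ennreal \<theta> * (psi k y * V y) \<partial>lebesgue)"
    proof (rule nn_integral_cong)
      fix y show "psi k x * ennreal \<theta> * (V y * indicator ?Q y) = ennreal \<theta> * (psi k y * V y) * indicator ?Q y"
        using const[of y] by (cases "y \<in> ?Q") (simp_all add: mult_ac)
    qed
    finally show "(\<integral>\<^sup>+y\<in>?Q. psi k y * V y * indicator (Om (m + 1)) y \<partial>lebesgue)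
        \<le> (\<integral>\<^sup>+y\<in>?Q. ennreal \<theta> * (psi k y * V y) \<partial>lebesgue)" .
  qed measurable
  also have "\<dots> = ennreal \<theta> * (\<integral>\<^sup>+x\<in>Om m. psi k x * V x \<partial>lebesgue)"
    by (subst nn_integral_cmult[symmetric]) (auto simp: mult.assoc)
  also have "\<dots> \<le> ennreal \<theta> * (ennreal (\<theta> ^ l) * (\<integral>\<^sup>+x. psi k x * V x \<partial>lebesgue))"
    using Suc.IH by (intro mult_left_mono) (auto simp: m_def)
  also have "\<dots> = ennreal (\<theta> ^ Suc l) * (\<integral>\<^sup>+x. psi k x * V x \<partial>lebesgue)"
    using \<theta> by (simp add: ennreal_mult mult.assoc)
  finally have "(\<integral>\<^sup>+x\<in>Om (m + 1). psi k x * V x \<partial>lebesgue) \<le> ennreal (\<theta> ^ Suc l) * (\<integral>\<^sup>+x. psi k x * V x \<partial>lebesgue)" .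
  moreover have "m + 1 = k + int (Suc l)" by (simp add: m_def)
  ultimately show ?case by (simp only:)
qed

text \<open>On a cell of level \<open>k\<close> the weighted mass is bounded by its volume times
  \<open>u\<^sup>p\<close>; at least half of this volume lies outside the next level set, and
  \<open>u\<close> is at most the product of the maximal functions at every point of the cell.\<close>

lemma psi_integral_le:
  "(\<integral>\<^sup>+x. psi k x * V x \<partial>lebesgue) \<le> ennreal (2 * 3 ^ CARD('n) * K powr q) * epow G (q - p) *
     (\<integral>\<^sup>+x. (\<Prod>i\<in>UNIV. epow (maxf (h i) x) (p / a i)) * indicator (Om k - Om (k + 1)) x \<partial>lebesgue)"
proof -
  define c where "c = ennreal (2 * 3 ^ CARD('n) * K powr q) * epow G (q - p)"
  define M where "M x = (\<Prod>i\<in>UNIV. epow (maxf (h i) x) (p / a i))" for x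
  have [measurable]: "M \<in> borel_measurable lebesgue" unfolding M_def[abs_def] by measurable
  have uM: "epow (u j x) p \<le> M x" for j x
  proof -
    have "epow (u j x) p = (\<Prod>i\<in>UNIV. epow (avg (bcube j x) (h i)) (p / a i))"
      using p_pos by (simp add: u_def epow_prod epow_epow)
    also have "\<dots> \<le> M x"
      unfolding M_def using p_pos a_pos by (intro prod_mono_ennreal epow_mono avg_le_maxf) (auto intro: less_imp_le)
    finally show ?thesis .
  qed
  have "(\<integral>\<^sup>+x. psi k x * V x \<partial>lebesgue) = (\<integral>\<^sup>+x\<in>Om k. psi k x * V x \<partial>lebesgue)"
    by (intro nn_integral_cong) (auto simp: indicator_def psi_def)
  also have "\<dots> \<le> (\<integral>\<^sup>+x\<in>Om k. c * (M x * indicator (- Om (k + 1)) x) \<partial>lebesgue)"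
  proof (rule stopping_nn_integral_mono[OF stopping_Om])
    have "- Om (k + 1) \<in> sets lebesgue" using Om_sets by (simp only: Compl_in_sets_lebesgue)
    then show "(\<lambda>x. c * (M x * indicator (- Om (k + 1)) x)) \<in> borel_measurable lebesgue" by measurable
    fix x assume x: "x \<in> Om k"
    define j where "j = tau k x"
    define Q where "Q = dcell j x"
    have [measurable]: "Q \<in> sets lebesgue" by (simp add: Q_def)
    have const: "psi k y = psi k x" "u j y = u j x" if "y \<in> Q" for y
      using psi_const[of x k k y] u_cong[of j y x] x that by (auto simp: Q_def j_def dcell_def)
    have half: "emeasure lebesgue Q \<le> 2 * emeasure lebesgue (Q - Om (k + 1))"
      unfolding Q_def j_def by (rule emeasure_dcell_large_complement[OF Om_sets level_sets_sparse[OF x]])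
    have "(\<integral>\<^sup>+y\<in>Q. psi k y * V y \<partial>lebesgue) = (\<integral>\<^sup>+y. psi k x * (V y * indicator Q y) \<partial>lebesgue)"
    proof (rule nn_integral_cong)
      fix y show "psi k y * V y * indicator Q y = psi k x * (V y * indicator Q y)"
        using const(1)[of y] by (cases "y \<in> Q") simp_all
    qed
    also have "\<dots> = psi k x * VV Q" unfolding VV_def by (rule nn_integral_cmult) measurable
    also have "\<dots> \<le> epow (ennreal (side j powr \<alpha>) * F j x) q * VV (bcube j x)"
      using x q_pos lam_le[OF x] dcell_subset_bcube[of j x]
      by (intro mult_mono VV_mono) (auto simp: psi_def j_def Q_def intro!: epow_mono)
    also have "\<dots> \<le> ennreal (K powr q) * epow G (q - p) * (emeasure lebesgue (bcube j x) * epow (u j x) p)"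
      by (rule weighted_cell_bound)
    also have "emeasure lebesgue (bcube j x) = ennreal (3 ^ CARD('n)) * emeasure lebesgue Q"
      unfolding Q_def emeasure_bcube emeasure_dcell by (rule ennreal_mult) auto
    also have "ennreal (K powr q) * epow G (q - p) * (ennreal (3 ^ CARD('n)) * emeasure lebesgue Q * epow (u j x) p)
       \<le> ennreal (K powr q) * epow G (q - p) * (ennreal (3 ^ CARD('n)) * (2 * emeasure lebesgue (Q - Om (k + 1))) * epow (u j x) p)"
      by (intro mult_left_mono mult_right_mono half) auto
    also have "\<dots> = c * (epow (u j x) p * emeasure lebesgue (Q - Om (k + 1)))"
      by (simp add: c_def ennreal_mult mult_ac)
    also have "\<dots> = (\<integral>\<^sup>+y. c * epow (u j x) p * indicator (Q - Om (k + 1)) y \<partial>lebesgue)"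
      by (subst nn_integral_cmult_indicator) (auto simp: mult.assoc)
    also have "\<dots> \<le> (\<integral>\<^sup>+y\<in>Q. c * (M y * indicator (- Om (k + 1)) y) \<partial>lebesgue)"
    proof (rule nn_integral_mono)
      fix y
      show "c * epow (u j x) p * indicator (Q - Om (k + 1)) y \<le> c * (M y * indicator (- Om (k + 1)) y) * indicator Q y"
        using uM[of j y] const(2)[of y] by (auto simp: indicator_def intro!: mult_left_mono)
    qed
    finally show "(\<integral>\<^sup>+y\<in>dcell (tau k x) x. psi k y * V y \<partial>lebesgue)
       \<le> (\<integral>\<^sup>+y\<in>dcell (tau k x) x. c * (M y * indicator (- Om (k + 1)) y) \<partial>lebesgue)"
      by (simp add: Q_def j_def)
  qed measurable
  also have "\<dots> = (\<integral>\<^sup>+x. c * (M x * indicator (Om k - Om (k + 1)) x) \<partial>lebesgue)"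
    by (intro nn_integral_cong) (auto simp: indicator_def)
  also have "\<dots> = c * (\<integral>\<^sup>+x. M x * indicator (Om k - Om (k + 1)) x \<partial>lebesgue)"
    by (rule nn_integral_cmult) measurable
  finally show ?thesis by (simp add: c_def M_def)
qed

text \<open>The sets \<open>Om k - Om (k + 1)\<close> are disjoint, so the bounds for all levels add up to
  one integral of the product of the maximal functions. Hoelder's inequality with the exponents \<open>P i /
  p\<close> separates the factors.\<close>

lemma psi_total:
  assumes Mx: "\<And>i. 0 < Mx i"
    "\<And>i. (\<integral>\<^sup>+x. epow (maxf (h i) x) (P i / a i) \<partial>lebesgue) \<le> ennreal (Mx i) * (\<integral>\<^sup>+x. epow (h i x) (P i / a i) \<partial>lebesgue)"
  shows "(\<Sum>\<^sup>+k. (\<integral>\<^sup>+x. psi k x * V x \<partial>lebesgue))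
     \<le> ennreal (2 * 3 ^ CARD('n) * K powr q * (\<Prod>i\<in>UNIV. Mx i powr (p / P i))) * epow G q"
proof -
  define c where "c = 2 * 3 ^ CARD('n) * K powr q"
  have c0: "0 \<le> c" by (simp add: c_def)
  define M where "M x = (\<Prod>i\<in>UNIV. epow (maxf (h i) x) (p / a i))" for x
  have [measurable]: "M \<in> borel_measurable lebesgue" unfolding M_def[abs_def] by measurable
  have qp: "0 < q - p" using p_less_q by simp
  have "(\<Sum>\<^sup>+k. (\<integral>\<^sup>+x. psi k x * V x \<partial>lebesgue))
     \<le> (\<Sum>\<^sup>+k. ennreal c * epow G (q - p) * (\<integral>\<^sup>+x. M x * indicator (Om k - Om (k + 1)) x \<partial>lebesgue))"
    unfolding c_def M_def by (intro nn_integral_mono psi_integral_le)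
  also have "\<dots> = ennreal c * epow G (q - p) * (\<Sum>\<^sup>+k. (\<integral>\<^sup>+x. M x * indicator (Om k - Om (k + 1)) x \<partial>lebesgue))"
    by (rule nn_integral_cmult) simp
  also have "(\<Sum>\<^sup>+k. (\<integral>\<^sup>+x. M x * indicator (Om k - Om (k + 1)) x \<partial>lebesgue))
     = (\<integral>\<^sup>+x. (\<Sum>\<^sup>+k. M x * indicator (Om k - Om (k + 1)) x) \<partial>lebesgue)"
    by (rule nn_integral_count_space_nn_integral[symmetric]) auto
  also have "\<dots> \<le> (\<integral>\<^sup>+x. M x \<partial>lebesgue)"
  proof (rule nn_integral_mono)
    fix x
    show "(\<Sum>\<^sup>+k. M x * indicator (Om k - Om (k + 1)) x) \<le> M x"
    proof (cases "\<exists>k. x \<in> Om k - Om (k + 1)")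
      case False
      then show ?thesis by simp
    next
      case True
      then obtain k where k: "x \<in> Om k" "x \<notin> Om (k + 1)" by auto
      have uniq: "x \<notin> Om k' - Om (k' + 1)" if "k' \<noteq> k" for k'
        using k that Om_antimono[of "k' + 1" k] Om_antimono[of "k + 1" k'] by (cases "k' < k") auto
      have "(\<Sum>\<^sup>+k. M x * indicator (Om k - Om (k + 1)) x) = (\<Sum>k\<in>{k}. M x * indicator (Om k - Om (k + 1)) x)"
        using uniq by (intro nn_integral_count_space') auto
      also have "\<dots> = M x" using k by simp
      finally show ?thesis by simp
    qed
  qed
  also have "\<dots> = (\<integral>\<^sup>+x. (\<Prod>i\<in>UNIV. epow (epow (maxf (h i) x) (P i / a i)) (p / P i)) \<partial>lebesgue)"
    using P_pos a_pos by (simp add: M_def epow_epow less_imp_neq[symmetric])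
  also have "\<dots> \<le> (\<Prod>i\<in>UNIV. epow (\<integral>\<^sup>+x. epow (maxf (h i) x) (P i / a i) \<partial>lebesgue) (p / P i))"
  proof (rule generalized_Holder)
    have "(\<Sum>i\<in>UNIV. p / P i) = p * (\<Sum>i\<in>UNIV. 1 / P i)" by (simp add: sum_distrib_left)
    then show "(\<Sum>i\<in>UNIV. p / P i) = 1" using p_pos by (simp flip: p_sum)
  qed (use p_pos P_pos in auto)
  also have "\<dots> \<le> (\<Prod>i\<in>UNIV. epow (ennreal (Mx i) * (\<integral>\<^sup>+x. epow (h i x) (P i / a i) \<partial>lebesgue)) (p / P i))"
    using p_pos P_pos by (intro prod_mono_ennreal epow_mono Mx) (auto intro: less_imp_le)
  also have "\<dots> = (\<Prod>i\<in>UNIV. ennreal (Mx i powr (p / P i))) * epow G p"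
    using p_pos P_pos Mx(1) by (simp add: G_def epow_mult epow_ennreal prod.distrib epow_prod epow_epow less_imp_le)
  also have "(\<Prod>i\<in>UNIV. ennreal (Mx i powr (p / P i))) = ennreal (\<Prod>i\<in>UNIV. Mx i powr (p / P i))"
    by (rule prod_ennreal) simp
  also have "ennreal c * epow G (q - p) * (ennreal (\<Prod>i\<in>UNIV. Mx i powr (p / P i)) * epow G p)
     = ennreal (c * (\<Prod>i\<in>UNIV. Mx i powr (p / P i))) * (epow G (q - p) * epow G p)"
    using c0 by (simp add: ennreal_mult' mult_ac prod_nonneg)
  also have "epow G (q - p) * epow G p = epow G q" using epow_add[OF qp p_pos, of G] by simp
  finally show ?thesis by (simp add: c_def mult_left_mono)
qed

text \<open>The weights \<open>r\<^sup>l\<close> of the quasi-triangle inequality are compensated by the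
  decay \<open>\<theta>\<^sup>l\<close>, since \<open>r \<theta> < 1\<close>.\<close>

lemma potential_bound:
  assumes Mx: "\<And>i. 0 < Mx i"
    "\<And>i. (\<integral>\<^sup>+x. epow (maxf (h i) x) (P i / a i) \<partial>lebesgue) \<le> ennreal (Mx i) * (\<integral>\<^sup>+x. epow (h i x) (P i / a i) \<partial>lebesgue)"
    and r: "1 < r" "r * \<theta> < 1"
  shows "(\<integral>\<^sup>+x. epow (dyadic_potential \<alpha> \<phi> x) q * V x \<partial>lebesgue)
     \<le> ennreal ((lev * (2 powr \<alpha> / (2 powr \<alpha> - 1))) powr q * (r powr (1 / q) / (r powr (1 / q) - 1)) powr q
          * (1 / (1 - r * \<theta>)) * (2 * 3 ^ CARD('n) * K powr q * (\<Prod>i\<in>UNIV. Mx i powr (p / P i)))) * epow G q"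
proof -
  define A where "A = (lev * (2 powr \<alpha> / (2 powr \<alpha> - 1))) powr q"
  define B where "B = (r powr (1 / q) / (r powr (1 / q) - 1)) powr q"
  have gt1: "1 < (2::real) powr \<alpha>" using \<alpha>_pos by simp
  have AB: "0 \<le> A" "0 \<le> B" by (simp_all add: A_def B_def)
  have rt: "0 \<le> r * \<theta>" using r \<theta> by simp
  define w where "w k l x = psi k x * V x * (ennreal (r ^ l) * indicator (Om (k + int l)) x)" for k l x
  have [measurable]: "w k l \<in> borel_measurable lebesgue" for k l unfolding w_def[abs_def] by measurable
  have "(\<integral>\<^sup>+x. epow (dyadic_potential \<alpha> \<phi> x) q * V x \<partial>lebesgue)
      \<le> (\<integral>\<^sup>+x. ennreal (A * B) * (\<Sum>\<^sup>+k. (\<Sum>\<^sup>+l. w k l x)) \<partial>lebesgue)"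
  proof (rule nn_integral_mono)
    fix x
    let ?L = "\<integral>\<^sup>+k. lam k x * indicator (Om k) x \<partial>count_space UNIV"
    have "epow (dyadic_potential \<alpha> \<phi> x) q \<le> epow (ennreal (lev * (2 powr \<alpha> / (2 powr \<alpha> - 1))) * ?L) q"
      using q_pos by (intro epow_mono potential_le_level_sum) auto
    also have "\<dots> = ennreal A * epow ?L q"
      unfolding A_def using q_pos lev_gt1 gt1 by (subst epow_mult) (auto simp: epow_ennreal)
    also have "\<dots> \<le> ennreal A * (ennreal B *
      (\<Sum>\<^sup>+k. psi k x * (\<Sum>\<^sup>+l. ennreal (r ^ l) * indicator (Om (k + int l)) x)))"
      unfolding B_def by (intro mult_left_mono level_sum_power r) simp
    finally have "epow (dyadic_potential \<alpha> \<phi> x) q * V x \<le> ennreal A * (ennreal B *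
      (\<Sum>\<^sup>+k. psi k x * (\<Sum>\<^sup>+l. ennreal (r ^ l) * indicator (Om (k + int l)) x))) * V x"
      by (rule mult_right_mono) simp
    also have "\<dots> = ennreal (A * B) * (\<Sum>\<^sup>+k. (\<Sum>\<^sup>+l. w k l x))"
      using AB by (simp add: w_def nn_integral_cmult nn_integral_multc ennreal_mult mult_ac flip: nn_integral_cmult)
    finally show "epow (dyadic_potential \<alpha> \<phi> x) q * V x \<le> ennreal (A * B) * (\<Sum>\<^sup>+k. (\<Sum>\<^sup>+l. w k l x))" .
  qed
  also have "\<dots> = (\<integral>\<^sup>+x. (\<Sum>\<^sup>+k. (\<Sum>\<^sup>+l. ennreal (A * B) * w k l x)) \<partial>lebesgue)"
    by (simp add: nn_integral_cmult)
  also have "\<dots> = (\<Sum>\<^sup>+k. (\<integral>\<^sup>+x. (\<Sum>\<^sup>+l. ennreal (A * B) * w k l x) \<partial>lebesgue))"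
    by (rule nn_integral_count_space_nn_integral) (auto simp: nn_integral_count_space_nat)
  also have "\<dots> = (\<Sum>\<^sup>+k. (\<Sum>\<^sup>+l. (\<integral>\<^sup>+x. ennreal (A * B) * w k l x \<partial>lebesgue)))"
    by (intro nn_integral_cong nn_integral_count_space_nn_integral) auto
  also have "\<dots> \<le> (\<Sum>\<^sup>+k. (\<Sum>\<^sup>+l. ennreal (A * B) * (ennreal ((r * \<theta>) ^ l) * (\<integral>\<^sup>+x. psi k x * V x \<partial>lebesgue))))"
  proof (intro nn_integral_mono)
    fix k l
    have "(\<integral>\<^sup>+x. w k l x \<partial>lebesgue) = (\<integral>\<^sup>+x. ennreal (r ^ l) * (psi k x * V x * indicator (Om (k + int l)) x) \<partial>lebesgue)"
      by (simp add: w_def mult_ac)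
    also have "\<dots> = ennreal (r ^ l) * (\<integral>\<^sup>+x\<in>Om (k + int l). psi k x * V x \<partial>lebesgue)"
      by (rule nn_integral_cmult) measurable
    also have "\<dots> \<le> ennreal (r ^ l) * (ennreal (\<theta> ^ l) * (\<integral>\<^sup>+x. psi k x * V x \<partial>lebesgue))"
      by (intro mult_left_mono psi_decay) simp
    also have "\<dots> = ennreal ((r * \<theta>) ^ l) * (\<integral>\<^sup>+x. psi k x * V x \<partial>lebesgue)"
      using r \<theta> by (simp add: power_mult_distrib ennreal_mult mult.assoc)
    finally have "(\<integral>\<^sup>+x. w k l x \<partial>lebesgue) \<le> ennreal ((r * \<theta>) ^ l) * (\<integral>\<^sup>+x. psi k x * V x \<partial>lebesgue)" .
    then show "(\<integral>\<^sup>+x. ennreal (A * B) * w k l x \<partial>lebesgue) \<le> ennreal (A * B) * (ennreal ((r * \<theta>) ^ l) * (\<integral>\<^sup>+x. psi k x * V x \<partial>lebesgue))"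
      by (subst nn_integral_cmult) (auto intro: mult_left_mono)
  qed
  also have "\<dots> = (\<Sum>\<^sup>+k. ennreal (A * B) * (ennreal (1 / (1 - r * \<theta>)) * (\<integral>\<^sup>+x. psi k x * V x \<partial>lebesgue)))"
  proof (intro nn_integral_cong)
    fix k
    have geo: "(\<Sum>\<^sup>+l. ennreal ((r * \<theta>) ^ l)) = ennreal (1 / (1 - r * \<theta>))"
      using rt r by (simp only: nn_integral_count_space_nat) (intro suminf_ennreal_eq geometric_sums zero_le_power, auto)
    have "(\<Sum>\<^sup>+l. ennreal (A * B) * (ennreal ((r * \<theta>) ^ l) * (\<integral>\<^sup>+x. psi k x * V x \<partial>lebesgue)))
       = (\<Sum>\<^sup>+l. ennreal ((r * \<theta>) ^ l) * (ennreal (A * B) * (\<integral>\<^sup>+x. psi k x * V x \<partial>lebesgue)))"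
      by (simp only: mult_ac)
    also have "\<dots> = ennreal (1 / (1 - r * \<theta>)) * (ennreal (A * B) * (\<integral>\<^sup>+x. psi k x * V x \<partial>lebesgue))"
      unfolding geo[symmetric] by (rule nn_integral_multc) simp
    finally show "(\<Sum>\<^sup>+l. ennreal (A * B) * (ennreal ((r * \<theta>) ^ l) * (\<integral>\<^sup>+x. psi k x * V x \<partial>lebesgue)))
       = ennreal (A * B) * (ennreal (1 / (1 - r * \<theta>)) * (\<integral>\<^sup>+x. psi k x * V x \<partial>lebesgue))"
      by (simp only: mult_ac)
  qed
  also have "\<dots> = ennreal (A * B) * ennreal (1 / (1 - r * \<theta>)) * (\<Sum>\<^sup>+k. (\<integral>\<^sup>+x. psi k x * V x \<partial>lebesgue))"
    by (simp add: nn_integral_cmult mult.assoc)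
  also have "\<dots> \<le> ennreal (A * B) * ennreal (1 / (1 - r * \<theta>)) *
     (ennreal (2 * 3 ^ CARD('n) * K powr q * (\<Prod>i\<in>UNIV. Mx i powr (p / P i))) * epow G q)"
    by (intro mult_left_mono psi_total Mx) auto
  also have "\<dots> = ennreal (A * B * (1 / (1 - r * \<theta>)) * (2 * 3 ^ CARD('n) * K powr q * (\<Prod>i\<in>UNIV. Mx i powr (p / P i)))) * epow G q"
    by (rule ennreal_mult3) (use AB r in \<open>auto intro!: mult_nonneg_nonneg prod_nonneg\<close>)
  finally show ?thesis by (simp add: A_def B_def)
qed

end

text \<open>The constant depends on the weights and exponents only, not on \<open>\<phi>\<close> and
  \<open>h\<close>.\<close>

theorem (in frac_weights) dyadic_potential_bound:
  "\<exists>C>0. \<forall>\<phi> h. (\<forall>i. \<phi> i \<in> borel_measurable lebesgue) \<longrightarrow> (\<forall>i. h i \<in> borel_measurable lebesgue) \<longrightarrow>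
     (\<forall>i. AE x in lebesgue. \<phi> i x \<le> epow (h i x) (1 / a i) * epow (\<sigma> i x) (1 / \<rho> i)) \<longrightarrow>
     (\<forall>i. (\<integral>\<^sup>+x. epow (h i x) (P i / a i) \<partial>lebesgue) < top) \<longrightarrow>
     (\<integral>\<^sup>+x. epow (dyadic_potential \<alpha> \<phi> x) q * V x \<partial>lebesgue)
       \<le> ennreal C * epow (\<Prod>i\<in>UNIV. epow (\<integral>\<^sup>+x. epow (h i x) (P i / a i) \<partial>lebesgue) (1 / P i)) q"
proof -
  obtain \<theta> where \<theta>: "0 < \<theta>" "\<theta> < 1" and decay: "\<And>j x E. E \<in> sets lebesgue \<Longrightarrow>
     2 * emeasure lebesgue (dcell j x \<inter> E) \<le> emeasure lebesgue (dcell j x) \<Longrightarrow>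
     VV (dcell j x \<inter> E) \<le> ennreal \<theta> * VV (dcell j x)"
    using V_decay_off_large_subsets by blast
  have "\<exists>C. 0 < C \<and> (\<forall>h :: real^'n \<Rightarrow> ennreal. h \<in> borel_measurable lebesgue \<longrightarrow>
      (\<integral>\<^sup>+x. epow (maxf h x) (P i / a i) \<partial>lebesgue) \<le> ennreal C * (\<integral>\<^sup>+x. epow (h x) (P i / a i) \<partial>lebesgue))" for i
  proof -
    have "1 < P i / a i" using a_pos a_less by simp
    then show ?thesis by (rule maxf_strong_type) blast
  qed
  then obtain Mx where Mx: "\<And>i. 0 < Mx i" "\<And>i h. (h :: real^'n \<Rightarrow> ennreal) \<in> borel_measurable lebesgue \<Longrightarrow>
      (\<integral>\<^sup>+x. epow (maxf h x) (P i / a i) \<partial>lebesgue) \<le> ennreal (Mx i) * (\<integral>\<^sup>+x. epow (h x) (P i / a i) \<partial>lebesgue)"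
    by metis
  define \<beta> where "\<beta> = 2 * real CARD('m) * (20 * real CARD('n)) ^ CARD('n) * 3 ^ CARD('n)"
  define lev where "lev = (2 ^ CARD('n) * \<beta>) ^ CARD('m)"
  define r where "r = (1 + 1 / \<theta>) / 2"
  have r: "1 < r" "r * \<theta> < 1" using \<theta> by (simp_all add: r_def field_simps)
  define C where "C = (lev * (2 powr \<alpha> / (2 powr \<alpha> - 1))) powr q * (r powr (1 / q) / (r powr (1 / q) - 1)) powr q
          * (1 / (1 - r * \<theta>)) * (2 * 3 ^ CARD('n) * K powr q * (\<Prod>i\<in>UNIV. Mx i powr (p / P i)))"
  have C0: "0 \<le> C" unfolding C_def using r by (auto intro!: mult_nonneg_nonneg prod_nonneg divide_nonneg_nonneg)
  have main: "(\<integral>\<^sup>+x. epow (dyadic_potential \<alpha> \<phi> x) q * V x \<partial>lebesgue)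
       \<le> ennreal (C + 1) * epow (\<Prod>i\<in>UNIV. epow (\<integral>\<^sup>+x. epow (h i x) (P i / a i) \<partial>lebesgue) (1 / P i)) q"
    if "\<And>i. \<phi> i \<in> borel_measurable lebesgue" "\<And>i. h i \<in> borel_measurable lebesgue"
     "\<And>i. AE x in lebesgue. \<phi> i x \<le> epow (h i x) (1 / a i) * epow (\<sigma> i x) (1 / \<rho> i)"
     "\<And>i. (\<integral>\<^sup>+x. epow (h i x) (P i / a i) \<partial>lebesgue) < top" for \<phi> h
  proof -
    interpret frac_data V \<sigma> P a \<rho> \<alpha> p q K \<phi> h \<theta> \<beta> lev
      by unfold_locales (use that \<theta> decay in \<open>simp_all add: \<beta>_def lev_def\<close>)
    have "(\<integral>\<^sup>+x. epow (dyadic_potential \<alpha> \<phi> x) q * V x \<partial>lebesgue) \<le> ennreal C * epow G q"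
      unfolding C_def by (rule potential_bound) (use Mx that r in auto)
    also have "\<dots> \<le> ennreal (C + 1) * epow G q" using C0 by (intro mult_right_mono ennreal_leI) auto
    finally show ?thesis by (simp add: G_def)
  qed
  show ?thesis by (rule exI[of _ "C + 1"]) (use C0 main in auto)
qed

section \<open>Kernels of the prescribed size\<close>

lemma vec_lambda_measurable_PiM:
  "(\<lambda>g. (\<chi> i. g i) :: real^'n^'m) \<in> (\<Pi>\<^sub>M i\<in>UNIV. (lborel :: (real^'n) measure)) \<rightarrow>\<^sub>M borel"
  proof (subst borel_measurable_euclidean_space, rule ballI)
    fix b :: "real^'n^'m" assume "b \<in> Basis"
    then obtain i c where b: "b = axis i c" by (auto simp: Basis_vec_def)
    have "(\<lambda>g. g i \<bullet> c) \<in> borel_measurable (\<Pi>\<^sub>M i\<in>UNIV. lborel)"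
    proof -
      have "(\<lambda>g. g i) \<in> (\<Pi>\<^sub>M i\<in>UNIV. lborel) \<rightarrow>\<^sub>M lborel"
        by (rule measurable_component_singleton) simp
      then show ?thesis by simp
    qed
    then show "(\<lambda>g. ((\<chi> i. g i) :: real^'n^'m) \<bullet> b) \<in> borel_measurable (\<Pi>\<^sub>M i\<in>UNIV. lborel)"
      by (simp add: b inner_axis)
  qed

text \<open>Both measures give a box the product of its sides. This makes Tonelli's theorem for finite
  products available on \<open>(\<real>\<^sup>n)\<^sup>m\<close>.\<close>

lemma lborel_vec_eq_distr:
  "(lborel :: (real^'n^'m) measure) = distr (\<Pi>\<^sub>M i\<in>UNIV. lborel) borel (\<lambda>g. \<chi> i. g i)"
proof (rule lborel_eqI)
  interpret product_sigma_finite "\<lambda>_ :: 'm. lborel :: (real^'n) measure" by standard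
  interpret fp: finite_product_sigma_finite "\<lambda>_ :: 'm. lborel :: (real^'n) measure" UNIV by standard simp
  fix l u :: "real^'n^'m" assume le: "\<And>b. b \<in> Basis \<Longrightarrow> l \<bullet> b \<le> u \<bullet> b"
  have le': "l $ i \<bullet> c \<le> u $ i \<bullet> c" if "c \<in> Basis" for i c
    using le[of "axis i c"] that by (simp add: axis_in_Basis_iff inner_axis)
  have "emeasure (distr (\<Pi>\<^sub>M i\<in>UNIV. lborel) borel (\<lambda>g. \<chi> i. g i)) (box l u)
     = emeasure (\<Pi>\<^sub>M i\<in>UNIV. lborel) ((\<lambda>g. \<chi> i. g i) -` box l u \<inter> space (\<Pi>\<^sub>M i\<in>UNIV. lborel))"
    by (rule emeasure_distr[OF vec_lambda_measurable_PiM]) simp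
  also have "(\<lambda>g. \<chi> i. g i) -` box l u \<inter> space (\<Pi>\<^sub>M i\<in>UNIV. lborel)
     = Pi\<^sub>E UNIV (\<lambda>i. box (l $ i) (u $ i))"
    by (auto simp: box_def Basis_vec_def inner_axis space_PiM PiE_UNIV_domain Pi_iff)
  also have "emeasure (\<Pi>\<^sub>M i\<in>UNIV. lborel) (Pi\<^sub>E UNIV (\<lambda>i. box (l $ i) (u $ i)))
     = (\<Prod>i\<in>UNIV. emeasure lborel (box (l $ i) (u $ i)))"
    by (rule emeasure_PiM) auto
  also have "\<dots> = (\<Prod>i\<in>UNIV. ennreal (\<Prod>c\<in>Basis. (u $ i - l $ i) \<bullet> c))"
    using le' by (intro prod.cong) (auto simp: emeasure_lborel_box)
  also have "\<dots> = ennreal (\<Prod>i\<in>UNIV. \<Prod>c\<in>Basis. (u $ i - l $ i) \<bullet> c)"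
    using le' by (intro prod_ennreal prod_nonneg) (auto simp: inner_diff_left)
  also have "(\<Prod>i\<in>UNIV. \<Prod>c\<in>Basis. (u $ i - l $ i) \<bullet> c) = (\<Prod>b\<in>Basis. (u - l) \<bullet> b)"
  proof -
    have "(\<Prod>b\<in>Basis. (u - l) \<bullet> b) = (\<Prod>p\<in>UNIV \<times> Basis. (u - l) \<bullet> axis (fst p) (snd p))"
    proof (rule prod.reindex_bij_betw[symmetric])
      have B: "(Basis :: (real^'n^'m) set) = (\<Union>i. \<Union>c\<in>Basis. {axis i c})" by (rule Basis_vec_def)
      show "bij_betw (\<lambda>p. axis (fst p) (snd p)) (UNIV \<times> Basis) (Basis :: (real^'n^'m) set)"
        unfolding bij_betw_def
      proof
        show "inj_on (\<lambda>p. axis (fst p) (snd p) :: real^'n^'m) (UNIV \<times> Basis)"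
        proof (rule inj_onI)
          fix p p' :: "'m \<times> (real^'n)"
          assume "p \<in> UNIV \<times> Basis" "p' \<in> UNIV \<times> Basis" "axis (fst p) (snd p) = axis (fst p') (snd p')"
          moreover from this have "snd p \<noteq> 0" by (metis mem_Times_iff nonzero_Basis)
          ultimately show "p = p'" by (simp add: axis_eq_axis prod_eq_iff)
        qed
        show "(\<lambda>p. axis (fst p) (snd p)) ` (UNIV \<times> Basis) = (Basis :: (real^'n^'m) set)"
          unfolding B by (rule set_eqI) (auto simp: image_iff Bex_def)
      qed
    qed
    also have "\<dots> = (\<Prod>p\<in>UNIV \<times> Basis. (u $ fst p - l $ fst p) \<bullet> snd p)"
      by (simp add: inner_axis)
    also have "\<dots> = (\<Prod>i\<in>UNIV. \<Prod>c\<in>Basis. (u $ i - l $ i) \<bullet> c)"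
      by (simp add: prod.cartesian_product case_prod_beta)
    finally show ?thesis by simp
  qed
  finally show "emeasure (distr (\<Pi>\<^sub>M i\<in>UNIV. lborel) borel (\<lambda>g. \<chi> i. g i)) (box l u)
     = ennreal (\<Prod>b\<in>Basis. (u - l) \<bullet> b)" .
qed simp

lemma vec_nth_borel_measurable [measurable]: "(\<lambda>y :: real^'n^'m. y $ i) \<in> borel \<rightarrow>\<^sub>M borel"
  by (intro borel_measurable_continuous_onI continuous_intros)

lemma nn_integral_lborel_vec_prod:
  fixes f :: "'m::finite \<Rightarrow> real^'n \<Rightarrow> ennreal"
  assumes [measurable]: "\<And>i. f i \<in> borel_measurable borel"
  shows "(\<integral>\<^sup>+y. (\<Prod>i\<in>UNIV. f i (y $ i)) \<partial>(lborel :: (real^'n^'m) measure)) = (\<Prod>i\<in>UNIV. \<integral>\<^sup>+x. f i x \<partial>lborel)"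
proof -
  interpret product_sigma_finite "\<lambda>_ :: 'm. lborel :: (real^'n) measure" by standard
  have "(\<integral>\<^sup>+y. (\<Prod>i\<in>UNIV. f i (y $ i)) \<partial>(lborel :: (real^'n^'m) measure))
      = (\<integral>\<^sup>+g. (\<Prod>i\<in>UNIV. f i (((\<chi> i. g i) :: real^'n^'m) $ i)) \<partial>(\<Pi>\<^sub>M i\<in>UNIV. (lborel :: (real^'n) measure)))"
    by (subst lborel_vec_eq_distr, subst nn_integral_distr[OF vec_lambda_measurable_PiM]) auto
  also have "\<dots> = (\<integral>\<^sup>+g. (\<Prod>i\<in>UNIV. f i (g i)) \<partial>(\<Pi>\<^sub>M i\<in>UNIV. (lborel :: (real^'n) measure)))"
    by simp
  also have "\<dots> = (\<Prod>i\<in>UNIV. \<integral>\<^sup>+x. f i x \<partial>lborel)"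
    by (rule product_nn_integral_prod) auto
  finally show ?thesis .
qed

lemma vec_nth_null_set:
  assumes "N \<in> null_sets (lborel :: (real^'n) measure)"
  shows "(\<lambda>y :: real^'n^'m. y $ i) -` N \<in> null_sets lborel"
proof (rule null_setsI)
  have N[measurable]: "N \<in> sets borel" and N0: "emeasure lborel N = 0" using assms by auto
  show s: "(\<lambda>y :: real^'n^'m. y $ i) -` N \<in> sets lborel"
    using measurable_sets[OF vec_nth_borel_measurable[of i] N] by simp
  have "emeasure lborel ((\<lambda>y :: real^'n^'m. y $ i) -` N) = (\<integral>\<^sup>+y. indicator ((\<lambda>y :: real^'n^'m. y $ i) -` N) y \<partial>lborel)"
    using s by simp
  also have "\<dots> = (\<integral>\<^sup>+y. (\<Prod>l\<in>UNIV. (if l = i then indicator N else (\<lambda>_. 1)) (y $ l)) \<partial>(lborel :: (real^'n^'m) measure))"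
  proof (rule nn_integral_cong)
    fix y :: "real^'n^'m"
    have "(\<Prod>l\<in>UNIV. (if l = i then indicator N else (\<lambda>_. 1)) (y $ l)) = (\<Prod>l\<in>UNIV. if l = i then indicator N (y $ i) else (1::ennreal))"
      by (intro prod.cong) auto
    then show "indicator ((\<lambda>y :: real^'n^'m. y $ i) -` N) y = (\<Prod>l\<in>UNIV. (if l = i then indicator N else (\<lambda>_. 1)) (y $ l) :: ennreal)"
      by (simp add: prod.delta indicator_def)
  qed
  also have "\<dots> = (\<Prod>l\<in>UNIV. \<integral>\<^sup>+x. (if l = i then indicator N else (\<lambda>_. 1)) x \<partial>(lborel :: (real^'n) measure))"
    by (rule nn_integral_lborel_vec_prod) auto
  also have "\<dots> = 0"
    using N0 by (intro prod_zero) (auto intro!: bexI[of _ i])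
  finally show "emeasure lborel ((\<lambda>y :: real^'n^'m. y $ i) -` N) = 0" .
qed

text \<open>Lebesgue measurable functions of one component are Lebesgue measurable, since preimages of null
  sets under the projection are null.\<close>

lemma vec_nth_lebesgue_measurable [measurable]:
  "(\<lambda>y :: real^'n^'m. y $ i) \<in> lebesgue \<rightarrow>\<^sub>M lebesgue"
proof -
  have "complete_measure (lebesgue :: (real^'n^'m) measure)" by standard
  then show ?thesis
  proof (rule complete_measure.measurable_completion2)
    show m: "(\<lambda>y :: real^'n^'m. y $ i) \<in> lebesgue \<rightarrow>\<^sub>M lborel" by (simp add: measurable_completion)
    show "null_sets lborel \<subseteq> null_sets (distr lebesgue lborel (\<lambda>y :: real^'n^'m. y $ i))"
    proof
      fix N :: "(real^'n) set" assume "N \<in> null_sets lborel"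
      moreover from this have "N \<in> sets borel" by auto
      ultimately show "N \<in> null_sets (distr lebesgue lborel (\<lambda>y :: real^'n^'m. y $ i))"
        using vec_nth_null_set[of N i] m by (simp add: null_sets_distr_iff null_sets_completionI)
    qed
  qed
qed

lemma AE_vec_nth:
  assumes "AE x in (lborel :: (real^'n) measure). Q x"
  shows "AE y in (lborel :: (real^'n^'m) measure). Q (y $ i)"
proof -
  obtain N where N: "{x. \<not> Q x} \<subseteq> N" "N \<in> null_sets lborel"
    using assms by (auto elim!: AE_E simp: null_sets_def)
  show ?thesis
    by (rule AE_I'[OF vec_nth_null_set[OF N(2), of i]]) (use N(1) in auto)
qed

lemma nn_integral_lebesgue_vec_prod:
  fixes f :: "'m::finite \<Rightarrow> real^'n \<Rightarrow> ennreal"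
  assumes f: "\<And>i. f i \<in> borel_measurable lebesgue"
  shows "(\<integral>\<^sup>+y. (\<Prod>i\<in>UNIV. f i (y $ i)) \<partial>(lebesgue :: (real^'n^'m) measure)) = (\<Prod>i\<in>UNIV. \<integral>\<^sup>+x. f i x \<partial>lebesgue)"
proof -
  have "\<exists>g. g \<in> borel_measurable lborel \<and> (AE x in lborel. f i x = g x)" for i
    using completion_ex_borel_measurable[OF f[of i]] by blast
  then obtain g where g: "\<And>i. g i \<in> borel_measurable lborel" "\<And>i. AE x in lborel. f i x = g i x" by metis
  have "AE y in (lborel :: (real^'n^'m) measure). \<forall>i. f i (y $ i) = g i (y $ i)"
    unfolding AE_all_countable by (intro allI AE_vec_nth[OF g(2)])
  then have "AE y in (lborel :: (real^'n^'m) measure). (\<Prod>i\<in>UNIV. f i (y $ i)) = (\<Prod>i\<in>UNIV. g i (y $ i))"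
    by eventually_elim simp
  then have "(\<integral>\<^sup>+y. (\<Prod>i\<in>UNIV. f i (y $ i)) \<partial>(lebesgue :: (real^'n^'m) measure)) = (\<integral>\<^sup>+y. (\<Prod>i\<in>UNIV. g i (y $ i)) \<partial>lborel)"
    unfolding nn_integral_completion by (rule nn_integral_cong_AE)
  also have "\<dots> = (\<Prod>i\<in>UNIV. \<integral>\<^sup>+x. g i x \<partial>lborel)"
    using g(1) by (intro nn_integral_lborel_vec_prod) simp
  also have "\<dots> = (\<Prod>i\<in>UNIV. \<integral>\<^sup>+x. f i x \<partial>lebesgue)"
    unfolding nn_integral_completion
  proof (rule prod.cong)
    fix i show "integral\<^sup>N lborel (g i) = (\<integral>\<^sup>+x. f i x \<partial>lborel)"
      by (rule nn_integral_cong_AE) (use g(2)[of i] in eventually_elim, simp)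
  qed simp
  finally show ?thesis .
qed

text \<open>Take the scale \<open>j\<close> with \<open>side j / 2 < \<Sum>\<^sub>i |x - y\<^sub>i| \<le>
  side j\<close>: then all \<open>y\<^sub>i\<close> lie in the cube of scale \<open>j\<close> at
  \<open>x\<close>, and already the term for this \<open>j\<close> suffices.\<close>

lemma kernel_dominated_by_dyadic_sum:
  fixes x :: "real^'n" and y :: "real^'n^'m" and \<phi> :: "'m::finite \<Rightarrow> real^'n \<Rightarrow> ennreal"
  assumes d: "0 < d" and off: "(x, y) \<notin> diagonal"
  shows "ennreal ((\<Sum>j\<in>UNIV. norm (x - y $ j)) powr (- d)) * (\<Prod>i\<in>UNIV. \<phi> i (y $ i))
     \<le> (\<Sum>\<^sup>+j. ennreal (2 powr d * side j powr (- d)) * (\<Prod>i\<in>UNIV. \<phi> i (y $ i) * indicator (bcube j x) (y $ i)))"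
proof -
  define S where "S = (\<Sum>j\<in>UNIV. norm (x - y $ j))"
  have "0 < S"
  proof -
    obtain j where "y $ j \<noteq> x" using off by (auto simp: diagonal_def)
    then have "0 < norm (x - y $ j)" by simp
    also have "\<dots> \<le> S" unfolding S_def by (rule member_le_sum) auto
    finally show ?thesis .
  qed
  then obtain k :: int where k: "ennreal (2 powr k) < ennreal S" "ennreal S \<le> ennreal (2 powr (k + 1))"
    using level_exists[of 2 "ennreal S"] by auto
  define j where "j = k + 1"
  have Sj: "S \<le> side j" using k(2) by (simp add: side_def j_def)
  have jS: "side j < 2 * S" using k(1) \<open>0 < S\<close> by (simp add: side_def j_def powr_add ennreal_less_iff)
  have inB: "y $ i \<in> bcube j x" for i
  proof (rule near_mem_bcube)
    fix c
    have "\<bar>y $ i $ c - x $ c\<bar> \<le> norm (x - y $ i)"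
      using component_le_norm_cart[of "x - y $ i" c] by (simp add: abs_minus_commute)
    also have "\<dots> \<le> S" unfolding S_def by (rule member_le_sum) auto
    finally show "\<bar>y $ i $ c - x $ c\<bar> \<le> side j" using Sj by simp
  qed
  have "S powr (- d) \<le> (side j / 2) powr (- d)" using jS d by (intro powr_mono2') auto
  also have "\<dots> = 2 powr d * side j powr (- d)" by (simp add: powr_divide powr_minus_divide)
  finally have "ennreal (S powr (- d)) * (\<Prod>i\<in>UNIV. \<phi> i (y $ i))
     \<le> ennreal (2 powr d * side j powr (- d)) * (\<Prod>i\<in>UNIV. \<phi> i (y $ i) * indicator (bcube j x) (y $ i))"
    using inB by (intro mult_mono ennreal_leI) auto
  also have "\<dots> \<le> (\<Sum>\<^sup>+j. ennreal (2 powr d * side j powr (- d)) * (\<Prod>i\<in>UNIV. \<phi> i (y $ i) * indicator (bcube j x) (y $ i)))"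
    by (rule nn_integral_ge_point) simp
  finally show ?thesis by (simp add: S_def)
qed

lemma AE_off_diagonal: "AE y in (lebesgue :: (real^'n^'m) measure). (x, y) \<notin> diagonal"
proof -
  have "{(\<chi> j. x) :: real^'n^'m} \<in> null_sets (lebesgue :: (real^'n^'m) measure)"
    by (intro null_sets_completionI finite_imp_null_set_lborel) simp
  moreover have "{y \<in> space lebesgue. \<not> (x, y) \<notin> diagonal} \<subseteq> {(\<chi> j. x) :: real^'n^'m}"
  proof
    fix y :: "real^'n^'m" assume "y \<in> {y \<in> space lebesgue. \<not> (x, y) \<notin> diagonal}"
    then have "\<forall>j. y $ j = x" by (simp add: diagonal_def)
    then have "(\<chi> j. x) = y" by (simp only: vec_lambda_unique)
    then show "y \<in> {(\<chi> j. x) :: real^'n^'m}" by simp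
  qed
  ultimately show ?thesis by (rule AE_I')
qed

lemma kernel_potential_bound:
  fixes K :: "real^'n \<Rightarrow> real^'n^'m \<Rightarrow> complex"
  assumes size: "kernel_size \<alpha> K" and \<alpha>: "\<alpha> < real CARD('m) * real CARD('n)"
  shows "\<exists>C>0. \<forall>\<phi> x. (\<forall>i. \<phi> i \<in> borel_measurable lebesgue) \<longrightarrow>
    (\<integral>\<^sup>+y. ennreal (norm (K x y)) * (\<Prod>i\<in>UNIV. \<phi> i (y $ i)) \<partial>lebesgue) \<le> ennreal C * dyadic_potential \<alpha> \<phi> x"
proof -
  define d where "d = real CARD('m) * real CARD('n) - \<alpha>"
  have d: "0 < d" using \<alpha> by (simp add: d_def)
  obtain A where A: "0 < A" "\<And>x y. (x, y) \<notin> diagonal \<Longrightarrow>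
      norm (K x y) \<le> A * (\<Sum>j\<in>UNIV. norm (x - y $ j)) powr (- d)"
    using size unfolding kernel_size_def d_def by blast
  define C where "C = A * 2 powr d * (3 ^ CARD('n)) ^ CARD('m)"
  have C: "0 < C" using A by (simp add: C_def)
  have main: "(\<integral>\<^sup>+y. ennreal (norm (K x y)) * (\<Prod>i\<in>UNIV. \<phi> i (y $ i)) \<partial>lebesgue) \<le> ennreal C * dyadic_potential \<alpha> \<phi> x"
    if [measurable]: "\<And>i. \<phi> i \<in> borel_measurable lebesgue" for \<phi> :: "'m \<Rightarrow> real^'n \<Rightarrow> ennreal" and x
  proof -
    let ?b = "\<lambda>j y. \<Prod>i\<in>UNIV. \<phi> i (y $ i) * indicator (bcube j x) (y $ i)"
    define w where "w j y = ennreal A * (ennreal (2 powr d * side j powr (- d)) * ?b j y)"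
      for j and y :: "real^'n^'m"
    have m1: "(\<lambda>z. \<phi> i z * indicator (bcube j x) z) \<in> borel_measurable lebesgue" for i j by measurable
    have m2: "(\<lambda>y :: real^'n^'m. \<phi> i (y $ i) * indicator (bcube j x) (y $ i)) \<in> borel_measurable lebesgue" for i j
      using measurable_compose[OF vec_nth_lebesgue_measurable m1] .
    have wm: "w j \<in> borel_measurable lebesgue" for j
      unfolding w_def[abs_def] by (intro borel_measurable_times_ennreal borel_measurable_prod_ennreal m2) auto
    have "(\<integral>\<^sup>+y. ennreal (norm (K x y)) * (\<Prod>i\<in>UNIV. \<phi> i (y $ i)) \<partial>lebesgue)
        \<le> (\<integral>\<^sup>+y. (\<Sum>\<^sup>+j. w j y) \<partial>lebesgue)"
    proof (rule nn_integral_mono_AE, use AE_off_diagonal in eventually_elim)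
      fix y :: "real^'n^'m" assume off: "(x, y) \<notin> diagonal"
      have "ennreal (norm (K x y)) * (\<Prod>i\<in>UNIV. \<phi> i (y $ i))
         \<le> ennreal (A * (\<Sum>j\<in>UNIV. norm (x - y $ j)) powr (- d)) * (\<Prod>i\<in>UNIV. \<phi> i (y $ i))"
        by (intro mult_right_mono ennreal_leI A off) simp
      also have "\<dots> = ennreal A * (ennreal ((\<Sum>j\<in>UNIV. norm (x - y $ j)) powr (- d)) * (\<Prod>i\<in>UNIV. \<phi> i (y $ i)))"
        using A by (simp add: ennreal_mult mult.assoc)
      also have "\<dots> \<le> ennreal A * (\<Sum>\<^sup>+j. ennreal (2 powr d * side j powr (- d)) * ?b j y)"
        by (intro mult_left_mono kernel_dominated_by_dyadic_sum d off) simp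
      also have "\<dots> = (\<Sum>\<^sup>+j. w j y)"
        unfolding w_def by (rule nn_integral_cmult[symmetric]) simp
      finally show "ennreal (norm (K x y)) * (\<Prod>i\<in>UNIV. \<phi> i (y $ i)) \<le> (\<Sum>\<^sup>+j. w j y)" .
    qed
    also have "\<dots> = (\<Sum>\<^sup>+j. (\<integral>\<^sup>+y. w j y \<partial>lebesgue))"
      by (rule nn_integral_count_space_nn_integral) (auto intro: wm)
    also have "\<dots> = (\<Sum>\<^sup>+j. ennreal C * (ennreal (side j powr \<alpha>) * (\<Prod>i\<in>UNIV. avg (bcube j x) (\<phi> i))))"
    proof (rule nn_integral_cong)
      fix j
      have "(\<integral>\<^sup>+y. w j y \<partial>lebesgue) = ennreal A * (ennreal (2 powr d * side j powr (- d)) *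
         (\<integral>\<^sup>+y. ?b j y \<partial>(lebesgue :: (real^'n^'m) measure)))"
        unfolding w_def
        by (subst nn_integral_cmult, intro borel_measurable_times_ennreal borel_measurable_prod_ennreal m2, simp,
            subst nn_integral_cmult, intro borel_measurable_prod_ennreal m2, simp)
      also have "(\<integral>\<^sup>+y. ?b j y \<partial>(lebesgue :: (real^'n^'m) measure))
         = (\<Prod>i\<in>UNIV. (\<integral>\<^sup>+z. \<phi> i z * indicator (bcube j x) z \<partial>lebesgue))"
        by (rule nn_integral_lebesgue_vec_prod[OF m1])
      also have "\<dots> = (\<Prod>i\<in>(UNIV :: 'm set). avg (bcube j x) (\<phi> i) * ennreal (3 ^ CARD('n) * side j ^ CARD('n)))"
        by (simp only: avg_bcube_times[symmetric] emeasure_bcube)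
      also have "\<dots> = (\<Prod>i\<in>UNIV. avg (bcube j x) (\<phi> i)) * ennreal ((3 ^ CARD('n) * side j ^ CARD('n)) ^ CARD('m))"
        by (simp add: prod.distrib ennreal_power)
      also have "ennreal A * (ennreal (2 powr d * side j powr (- d)) * ((\<Prod>i\<in>UNIV. avg (bcube j x) (\<phi> i)) * ennreal ((3 ^ CARD('n) * side j ^ CARD('n)) ^ CARD('m))))
        = ennreal (A * (2 powr d * side j powr (- d)) * (3 ^ CARD('n) * side j ^ CARD('n)) ^ CARD('m)) * (\<Prod>i\<in>UNIV. avg (bcube j x) (\<phi> i))"
        using A by (simp only: ennreal_mult' ennreal_mult zero_le_mult_iff mult_nonneg_nonneg powr_ge_zero zero_le_power side_nonneg zero_le_numeral less_imp_le mult_ac)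
      also have "A * (2 powr d * side j powr (- d)) * (3 ^ CARD('n) * side j ^ CARD('n)) ^ CARD('m) = C * side j powr \<alpha>"
      proof -
        have "side j powr (- d) * (side j ^ CARD('n)) ^ CARD('m) = side j powr (- d) * side j powr (real CARD('m) * real CARD('n))"
          by (simp add: powr_realpow[symmetric] powr_powr mult.commute flip: power_mult)
        also have "\<dots> = side j powr \<alpha>" by (simp add: d_def flip: powr_add)
        finally show ?thesis by (simp add: C_def power_mult_distrib mult_ac)
      qed
      also have "ennreal (C * side j powr \<alpha>) = ennreal C * ennreal (side j powr \<alpha>)" using C by (simp add: ennreal_mult)
      finally show "(\<integral>\<^sup>+y. w j y \<partial>lebesgue) = ennreal C * (ennreal (side j powr \<alpha>) * (\<Prod>i\<in>UNIV. avg (bcube j x) (\<phi> i)))"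
        by (simp only: mult.assoc)
    qed
    also have "\<dots> = ennreal C * dyadic_potential \<alpha> \<phi> x"
      unfolding dyadic_potential_def by (rule nn_integral_cmult) simp
    finally show ?thesis .
  qed
  show ?thesis by (rule exI[of _ C]) (use C main in blast)
qed

section \<open>Bounded functions of compact support\<close>

text \<open>Small scales sum because \<open>\<alpha> > 0\<close>. At large scales the averages decay like
  \<open>side\<^bsup>-mn\<^esup>\<close>, and the sum converges because \<open>\<alpha> < m
  n\<close>.\<close>

lemma dyadic_potential_local:
  fixes \<phi> :: "'m::finite \<Rightarrow> real^'n \<Rightarrow> ennreal"
  assumes \<alpha>: "0 < \<alpha>" "\<alpha> < real CARD('m) * real CARD('n)" and M: "0 \<le> M"
    and \<phi>: "\<And>i y. \<phi> i y \<le> ennreal M * indicator (bcube k x) y"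
  shows "dyadic_potential \<alpha> \<phi> x
     \<le> ennreal (M ^ CARD('m) * side k powr \<alpha> *
          (2 powr \<alpha> / (2 powr \<alpha> - 1) + 1 / (2 powr (real CARD('m) * real CARD('n) - \<alpha>) - 1)))"
proof -
  define m where "m = CARD('m)"
  define n where "n = CARD('n)"
  define d where "d = real m * real n - \<alpha>"
  have d: "0 < d" using \<alpha> by (simp add: d_def m_def n_def)
  have gt1: "1 < (2::real) powr \<alpha>" "1 < (2::real) powr d" using \<alpha> d by simp_all
  define g1 where "g1 j = ennreal (M ^ m) * (ennreal ((2 powr \<alpha>) powr real_of_int j) * indicator {..k} j)" for j :: int
  define g2 where "g2 i = ennreal (M ^ m * side k powr (real m * real n)) * (ennreal ((2 powr d) powr real_of_int i) * indicator {..- k - 1} i)" for i :: int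
  have \<phi>M: "\<phi> i y \<le> ennreal M" for i y using \<phi>[of i y] by (cases "y \<in> bcube k x") auto
  have avg1: "avg (bcube j x) (\<phi> i) \<le> ennreal M" for i j
  proof -
    have "(\<integral>\<^sup>+y\<in>bcube j x. \<phi> i y \<partial>lebesgue) \<le> (\<integral>\<^sup>+y. ennreal M * indicator (bcube j x) y \<partial>lebesgue)"
      using \<phi>M[of i] by (intro nn_integral_mono) (auto simp: indicator_def)
    also have "\<dots> = ennreal M * emeasure lebesgue (bcube j x)" by (rule nn_integral_cmult_indicator) simp
    finally have "avg (bcube j x) (\<phi> i) \<le> ennreal M * emeasure lebesgue (bcube j x) / emeasure lebesgue (bcube j x)"
      unfolding avg_def by (rule divide_right_mono_ennreal)
    also have "\<dots> = ennreal M" unfolding emeasure_bcube by (rule mult_divide_eq_ennreal) simp_all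
    finally show ?thesis .
  qed
  have avg2: "avg (bcube j x) (\<phi> i) \<le> ennreal (M * (side k / side j) ^ n)" for i j
  proof -
    have "(\<integral>\<^sup>+y\<in>bcube j x. \<phi> i y \<partial>lebesgue) \<le> (\<integral>\<^sup>+y. ennreal M * indicator (bcube k x) y \<partial>lebesgue)"
    proof (rule nn_integral_mono)
      fix y
      have "\<phi> i y * indicator (bcube j x) y \<le> \<phi> i y" by (simp add: indicator_def)
      then show "\<phi> i y * indicator (bcube j x) y \<le> ennreal M * indicator (bcube k x) y"
        using \<phi>[of i y] by (rule order_trans)
    qed
    also have "\<dots> = ennreal M * emeasure lebesgue (bcube k x)" by (rule nn_integral_cmult_indicator) simp
    also have "\<dots> = ennreal (M * (3 ^ n * side k ^ n))" unfolding emeasure_bcube n_def using M by (simp add: ennreal_mult)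
    finally have "avg (bcube j x) (\<phi> i) \<le> ennreal (M * (3 ^ n * side k ^ n)) / ennreal (3 ^ n * side j ^ n)"
      unfolding avg_bcube n_def by (rule divide_right_mono_ennreal)
    also have "\<dots> = ennreal (M * (side k / side j) ^ n)"
      using M by (subst divide_ennreal) (auto simp: power_divide)
    finally show ?thesis .
  qed
  have "dyadic_potential \<alpha> \<phi> x \<le> (\<Sum>\<^sup>+j. g1 j + g2 (- j))"
    unfolding dyadic_potential_def
  proof (rule nn_integral_mono)
    fix j
    show "ennreal (side j powr \<alpha>) * (\<Prod>i\<in>UNIV. avg (bcube j x) (\<phi> i)) \<le> g1 j + g2 (- j)"
    proof (cases "j \<le> k")
      case True
      have "(\<Prod>i\<in>UNIV. avg (bcube j x) (\<phi> i)) \<le> (\<Prod>i\<in>(UNIV :: 'm set). ennreal M)"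
        by (intro prod_mono_ennreal avg1)
      also have "\<dots> = ennreal (M ^ m)" using M by (simp add: m_def ennreal_power)
      finally have "ennreal (side j powr \<alpha>) * (\<Prod>i\<in>UNIV. avg (bcube j x) (\<phi> i)) \<le> ennreal (side j powr \<alpha>) * ennreal (M ^ m)"
        by (rule mult_left_mono) simp
      also have "\<dots> = g1 j" using True by (simp add: g1_def side_def powr_powr mult.commute)
      also have "\<dots> \<le> g1 j + g2 (- j)" by simp
      finally show ?thesis .
    next
      case False
      have "(\<Prod>i\<in>UNIV. avg (bcube j x) (\<phi> i)) \<le> (\<Prod>i\<in>(UNIV :: 'm set). ennreal (M * (side k / side j) ^ n))"
        by (intro prod_mono_ennreal avg2)
      also have "\<dots> = ennreal ((M * (side k / side j) ^ n) ^ m)" using M by (simp add: m_def ennreal_power)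
      finally have "ennreal (side j powr \<alpha>) * (\<Prod>i\<in>UNIV. avg (bcube j x) (\<phi> i)) \<le> ennreal (side j powr \<alpha>) * ennreal ((M * (side k / side j) ^ n) ^ m)"
        by (rule mult_left_mono) simp
      also have "\<dots> = ennreal (side j powr \<alpha> * (M * (side k / side j) ^ n) ^ m)" using M by (simp add: ennreal_mult)
      also have "side j powr \<alpha> * (M * (side k / side j) ^ n) ^ m = M ^ m * side k powr (real m * real n) * (2 powr d) powr real_of_int (- j)"
      proof -
        have "((side k / side j) ^ n) ^ m = side k powr (real m * real n) / side j powr (real m * real n)"
          by (simp add: power_divide powr_realpow[symmetric] powr_powr mult.commute flip: power_mult)
        moreover have "(2 powr d) powr real_of_int (- j) = side j powr \<alpha> / side j powr (real m * real n)"
          by (simp add: side_def powr_powr d_def algebra_simps flip: powr_diff)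
        ultimately show ?thesis by (simp add: power_mult_distrib)
      qed
      also have "ennreal (M ^ m * side k powr (real m * real n) * (2 powr d) powr real_of_int (- j)) = g2 (- j)"
        using False M by (simp add: g2_def ennreal_mult)
      also have "\<dots> \<le> g1 j + g2 (- j)" by simp
      finally show ?thesis .
    qed
  qed
  also have "\<dots> = (\<Sum>\<^sup>+j. g1 j) + (\<Sum>\<^sup>+j. g2 (- j))"
    by (rule nn_integral_add) auto
  also have "(\<Sum>\<^sup>+j. g2 (- j)) = (\<Sum>\<^sup>+i. g2 i)"
    by (rule nn_integral_bij_count_space) (rule bij_uminus)
  also have "\<dots> = ennreal (M ^ m * side k powr (real m * real n)) * ennreal ((2 powr d) powr real_of_int (- k - 1) * (2 powr d / (2 powr d - 1)))"
    unfolding g2_def by (simp add: nn_integral_cmult geometric_int[OF gt1(2)])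
  also have "\<dots> = ennreal (M ^ m * side k powr (real m * real n) * ((2 powr d) powr real_of_int (- k - 1) * (2 powr d / (2 powr d - 1))))"
    by (rule ennreal_mult[symmetric]) (use M gt1 in auto)
  also have "M ^ m * side k powr (real m * real n) * ((2 powr d) powr real_of_int (- k - 1) * (2 powr d / (2 powr d - 1)))
      = M ^ m * side k powr \<alpha> * (1 / (2 powr d - 1))"
  proof -
    have "side k powr (real m * real n) * (2 powr d) powr real_of_int (- k - 1) * 2 powr d = side k powr \<alpha>"
      by (simp add: side_def powr_powr d_def algebra_simps flip: powr_add)
    then show ?thesis by (simp add: mult_ac)
  qed
  also have "(\<Sum>\<^sup>+j. g1 j) = ennreal (M ^ m) * ennreal ((2 powr \<alpha>) powr real_of_int k * (2 powr \<alpha> / (2 powr \<alpha> - 1)))"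
    unfolding g1_def by (simp add: nn_integral_cmult geometric_int[OF gt1(1)])
  also have "\<dots> = ennreal (M ^ m * side k powr \<alpha> * (2 powr \<alpha> / (2 powr \<alpha> - 1)))"
    using M gt1 by (simp add: side_def powr_powr mult_ac flip: ennreal_mult)
  also have "ennreal (M ^ m * side k powr \<alpha> * (2 powr \<alpha> / (2 powr \<alpha> - 1))) + ennreal (M ^ m * side k powr \<alpha> * (1 / (2 powr d - 1)))
     = ennreal (M ^ m * side k powr \<alpha> * (2 powr \<alpha> / (2 powr \<alpha> - 1) + 1 / (2 powr d - 1)))"
    using M gt1 by (subst ennreal_plus[symmetric]) (auto simp: distrib_left)
  finally show ?thesis by (simp add: m_def n_def d_def)
qed

lemma bounded_compact_suppE:
  assumes "f \<in> bounded_compact_supp"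
  obtains M where "0 < M" "\<And>x. norm (f x) \<le> M" "bounded {x. f x \<noteq> 0}" "f \<in> borel_measurable lebesgue"
proof -
  from assms have f: "f \<in> borel_measurable lebesgue" "bounded (range f)" "compact (supp f)"
    by (auto simp: bounded_compact_supp_def)
  from f(2) obtain M where "0 < M" "\<forall>x\<in>range f. norm x \<le> M" by (auto simp: bounded_pos)
  moreover have "bounded {x. f x \<noteq> 0}"
    using compact_imp_bounded[OF f(3)] closure_subset bounded_subset unfolding supp_def by blast
  ultimately show thesis using f(1) that by blast
qed

lemma bounded_compact_suppI:
  assumes "f \<in> borel_measurable lebesgue" "\<And>x. norm (f x) \<le> M" "bounded {x. f x \<noteq> 0}"
  shows "f \<in> bounded_compact_supp"
  using assms by (auto simp: bounded_compact_supp_def supp_def compact_closure bounded_iff)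

lemma bounded_compact_supp_restrict:
  assumes "f \<in> bounded_compact_supp" "A \<in> sets lebesgue"
  shows "(\<lambda>x. f x * indicator A x) \<in> bounded_compact_supp"
proof -
  obtain M where M: "0 < M" "\<And>x. norm (f x) \<le> M" "bounded {x. f x \<noteq> 0}" "f \<in> borel_measurable lebesgue"
    using assms(1) by (rule bounded_compact_suppE) blast
  show ?thesis
  proof (rule bounded_compact_suppI[of _ M])
    show "(\<lambda>x. f x * indicator A x) \<in> borel_measurable lebesgue"
      using M(4) assms(2) by measurable
    show "norm (f x * indicator A x) \<le> M" for x using M(1) M(2)[of x] by (auto simp: indicator_def norm_mult)
    show "bounded {x. f x * indicator A x \<noteq> 0}" by (rule bounded_subset[OF M(3)]) auto
  qed
qed

lemma Lp_norm_bounded_on: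
  fixes f :: "real^'n \<Rightarrow> complex"
  assumes M: "0 \<le> M" "\<And>x. norm (f x) \<le> M * indicator A x" and A: "A \<in> sets lebesgue" and s: "0 < s"
  shows "Lp_norm s (\<lambda>_. 1) f \<le> ennreal M * epow (emeasure lebesgue A) (1 / s)"
proof -
  have "(\<integral>\<^sup>+x. ennreal (norm (f x) powr s * 1) \<partial>lebesgue) \<le> (\<integral>\<^sup>+x. ennreal (M powr s) * indicator A x \<partial>lebesgue)"
  proof (rule nn_integral_mono)
    fix x
    show "ennreal (norm (f x) powr s * 1) \<le> ennreal (M powr s) * indicator A x"
    proof (cases "x \<in> A")
      case True
      then show ?thesis using M(2)[of x] s by (simp add: powr_mono2)
    next
      case False
      then show ?thesis using M(2)[of x] by simp
    qed
  qed
  also have "\<dots> = ennreal (M powr s) * emeasure lebesgue A" using A by (rule nn_integral_cmult_indicator)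
  finally have "Lp_norm s (\<lambda>_. 1) f \<le> epow (ennreal (M powr s) * emeasure lebesgue A) (1 / s)"
    unfolding Lp_norm_def using s by (intro epow_mono) auto
  also have "\<dots> = ennreal M * epow (emeasure lebesgue A) (1 / s)"
    using s M(1) by (simp add: epow_mult epow_ennreal powr_powr)
  finally show ?thesis .
qed

lemma bounded_compact_supp_Lp_space:
  fixes f :: "real^'n \<Rightarrow> complex"
  assumes "f \<in> bounded_compact_supp" "0 < s" shows "f \<in> Lp_space s (\<lambda>_. 1)"
proof -
  obtain M where M: "0 < M" "\<And>x. norm (f x) \<le> M" "bounded {x. f x \<noteq> 0}" "f \<in> borel_measurable lebesgue"
    using assms(1) by (rule bounded_compact_suppE) blast
  obtain j where j: "{x. f x \<noteq> 0} \<subseteq> bcube j (0 :: real^'n)" using bounded_subset_bcube[OF M(3)] by blast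
  have "Lp_norm s (\<lambda>_. 1) f \<le> ennreal M * epow (emeasure lebesgue (bcube j (0 :: real^'n))) (1 / s)"
  proof (rule Lp_norm_bounded_on)
    fix x show "norm (f x) \<le> M * indicator (bcube j 0) x"
      using M(2)[of x] j by (cases "f x = 0") (auto simp: indicator_def)
  qed (use M assms in auto)
  also have "\<dots> < top" unfolding emeasure_bcube by (simp add: ennreal_mult_less_top)
  finally show ?thesis using M(4) by (simp add: Lp_space_def)
qed

lemma prod_vec_nth_measurable:
  fixes f :: "'m::finite \<Rightarrow> real^'n \<Rightarrow> complex"
  assumes "\<And>j. f j \<in> borel_measurable lebesgue"
  shows "(\<lambda>y :: real^'n^'m. \<Prod>j\<in>UNIV. f j (y $ j)) \<in> borel_measurable lebesgue"
  using measurable_compose[OF vec_nth_lebesgue_measurable assms] by (intro borel_measurable_prod) auto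

lemma kernel_integral_bound:
  fixes f :: "'m::finite \<Rightarrow> real^'n \<Rightarrow> complex"
  assumes K: "K x \<in> borel_measurable lebesgue"
    and bound: "\<And>\<phi>. (\<And>i. \<phi> i \<in> borel_measurable lebesgue) \<Longrightarrow>
      (\<integral>\<^sup>+y. ennreal (norm (K x y)) * (\<Prod>i\<in>UNIV. \<phi> i (y $ i)) \<partial>lebesgue) \<le> ennreal C * dyadic_potential \<alpha> \<phi> x"
    and f: "\<And>i. f i \<in> borel_measurable lebesgue"
    and fin: "dyadic_potential \<alpha> (\<lambda>i y. ennreal (norm (f i y))) x < top"
  shows "integrable lebesgue (\<lambda>y. K x y * (\<Prod>j\<in>UNIV. f j (y $ j)))"
    and "ennreal (norm (kernel_integral K f x)) \<le> ennreal C * dyadic_potential \<alpha> (\<lambda>i y. ennreal (norm (f i y))) x"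
proof -
  have "(\<integral>\<^sup>+y. ennreal (norm (K x y * (\<Prod>j\<in>UNIV. f j (y $ j)))) \<partial>lebesgue)
      = (\<integral>\<^sup>+y. ennreal (norm (K x y)) * (\<Prod>i\<in>UNIV. ennreal (norm (f i (y $ i)))) \<partial>lebesgue)"
    by (simp add: norm_mult prod_norm prod_ennreal ennreal_mult prod_nonneg flip: prod_norm)
  also have "\<dots> \<le> ennreal C * dyadic_potential \<alpha> (\<lambda>i y. ennreal (norm (f i y))) x"
    using f by (intro bound) measurable
  finally have le: "(\<integral>\<^sup>+y. ennreal (norm (K x y * (\<Prod>j\<in>UNIV. f j (y $ j)))) \<partial>lebesgue)
     \<le> ennreal C * dyadic_potential \<alpha> (\<lambda>i y. ennreal (norm (f i y))) x" .
  also have "\<dots> < top" using fin by (simp add: ennreal_mult_less_top)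
  finally show int: "integrable lebesgue (\<lambda>y. K x y * (\<Prod>j\<in>UNIV. f j (y $ j)))"
    using K prod_vec_nth_measurable[OF f] by (intro integrableI_bounded borel_measurable_times) auto
  show "ennreal (norm (kernel_integral K f x)) \<le> ennreal C * dyadic_potential \<alpha> (\<lambda>i y. ennreal (norm (f i y))) x"
    unfolding kernel_integral_def using integral_norm_bound_ennreal[OF int] le by (rule order_trans)
qed

section \<open>The operator is given by its kernel everywhere\<close>

text \<open>The inequality \<open>\<sigma> < t\<close> says that the operator improves integrability. It
  excludes a part such as \<open>b f\<^sub>1 \<cdots> f\<^sub>m\<close>, which the kernel formula off the
  supports would not see.\<close>

locale kernel_operator =
  fixes K :: "real^'n \<Rightarrow> real^'n^'m \<Rightarrow> complex"
    and T :: "('m::finite \<Rightarrow> real^'n \<Rightarrow> complex) \<Rightarrow> real^'n \<Rightarrow> complex"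
    and s :: "'m \<Rightarrow> real" and \<sigma> \<alpha> t B CK :: real
  assumes K_meas: "\<And>x. K x \<in> borel_measurable lebesgue"
    and \<alpha>: "0 < \<alpha>" "\<alpha> < real CARD('m) * real CARD('n)"
    and CK: "0 < CK"
    and K_bound: "\<And>\<phi> x. (\<And>i. \<phi> i \<in> borel_measurable lebesgue) \<Longrightarrow>
      (\<integral>\<^sup>+y. ennreal (norm (K x y)) * (\<Prod>i\<in>UNIV. \<phi> i (y $ i)) \<partial>lebesgue) \<le> ennreal CK * dyadic_potential \<alpha> \<phi> x"
    and s: "\<And>j. 0 < s j" and \<sigma>: "0 < \<sigma>" "1 / \<sigma> = (\<Sum>j\<in>UNIV. 1 / s j)" "\<sigma> < t"
    and B: "0 < B"
    and T_meas: "\<And>f. (\<And>j. f j \<in> Lp_space (s j) (\<lambda>_. 1)) \<Longrightarrow> T f \<in> borel_measurable lebesgue"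
    and T_linear: "\<And>f i g a b. (\<And>j. f j \<in> Lp_space (s j) (\<lambda>_. 1)) \<Longrightarrow> g \<in> Lp_space (s i) (\<lambda>_. 1) \<Longrightarrow>
        AE x in lebesgue. T (f(i := \<lambda>x. a * f i x + b * g x)) x = a * T f x + b * T (f(i := g)) x"
    and T_bound: "\<And>f. (\<And>j. f j \<in> Lp_space (s j) (\<lambda>_. 1)) \<Longrightarrow>
        weak_Lp_norm t (\<lambda>_. 1) (T f) \<le> ennreal B * (\<Prod>j\<in>UNIV. Lp_norm (s j) (\<lambda>_. 1) (f j))"
    and T_off: "\<And>f. (\<And>j. f j \<in> bounded_compact_supp) \<Longrightarrow>
        AE x in lebesgue. x \<notin> (\<Inter>j. supp (f j)) \<longrightarrow> T f x = kernel_integral K f x"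
begin

abbreviation bcs :: "(real^'n \<Rightarrow> complex) set" where "bcs \<equiv> bounded_compact_supp"

lemma bcs_Lp: "f \<in> bcs \<Longrightarrow> f \<in> Lp_space (s j) (\<lambda>_. 1)"
  using bounded_compact_supp_Lp_space s by blast

lemma bcs_meas: "f \<in> bcs \<Longrightarrow> f \<in> borel_measurable lebesgue"
  by (simp add: bounded_compact_supp_def)

definition loc_const :: real where
  "loc_const = 2 powr \<alpha> / (2 powr \<alpha> - 1) + 1 / (2 powr (real CARD('m) * real CARD('n) - \<alpha>) - 1)"

lemma loc_const_pos: "0 < loc_const"
proof -
  have "1 < (2::real) powr \<alpha>" "1 < (2::real) powr (real CARD('m) * real CARD('n) - \<alpha>)" using \<alpha> by simp_all
  then show ?thesis unfolding loc_const_def by (intro add_pos_pos) auto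
qed

lemma kernel_integral_local:
  assumes f: "\<And>i. f i \<in> borel_measurable lebesgue" and M: "0 \<le> M" "\<And>i y. norm (f i y) \<le> M * indicator (bcube k x) y"
  shows "integrable lebesgue (\<lambda>y. K x y * (\<Prod>j\<in>UNIV. f j (y $ j)))"
    and "norm (kernel_integral K f x) \<le> CK * (M ^ CARD('m) * side k powr \<alpha> * loc_const)"
proof -
  have "dyadic_potential \<alpha> (\<lambda>i y. ennreal (norm (f i y))) x \<le> ennreal (M ^ CARD('m) * side k powr \<alpha> * loc_const)"
    unfolding loc_const_def
  proof (rule dyadic_potential_local[OF \<alpha> M(1)])
    fix i y
    show "ennreal (norm (f i y)) \<le> ennreal M * indicator (bcube k x) y"
      using M(2)[of i y] by (cases "y \<in> bcube k x") (auto intro: ennreal_leI)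
  qed
  note le = this
  then have fin: "dyadic_potential \<alpha> (\<lambda>i y. ennreal (norm (f i y))) x < top"
    by (rule le_less_trans) simp
  show "integrable lebesgue (\<lambda>y. K x y * (\<Prod>j\<in>UNIV. f j (y $ j)))"
    by (rule kernel_integral_bound(1)[where K=K and x=x, OF K_meas K_bound f fin])
  have "ennreal (norm (kernel_integral K f x)) \<le> ennreal CK * dyadic_potential \<alpha> (\<lambda>i y. ennreal (norm (f i y))) x"
    by (rule kernel_integral_bound(2)[where K=K and x=x, OF K_meas K_bound f fin])
  also have "\<dots> \<le> ennreal CK * ennreal (M ^ CARD('m) * side k powr \<alpha> * loc_const)"
    using le by (rule mult_left_mono) simp
  also have "\<dots> = ennreal (CK * (M ^ CARD('m) * side k powr \<alpha> * loc_const))"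
    using CK M(1) loc_const_pos by (intro ennreal_mult[symmetric]) auto
  finally show "norm (kernel_integral K f x) \<le> CK * (M ^ CARD('m) * side k powr \<alpha> * loc_const)"
    using CK M(1) loc_const_pos by (subst (asm) ennreal_le_iff) auto
qed

lemma kernel_integrable_bcs:
  assumes "\<And>i. f i \<in> bcs"
  shows "integrable lebesgue (\<lambda>y. K x y * (\<Prod>j\<in>UNIV. f j (y $ j)))"
proof -
  have "\<exists>M>0. \<forall>y. norm (f i y) \<le> M" and bd: "bounded {y. f i y \<noteq> 0}" for i
    using bounded_compact_suppE[OF assms[of i]] by metis+
  then obtain M where M: "\<And>i. 0 < M i" "\<And>i y. norm (f i y) \<le> M i" by metis
  have "bounded (\<Union>i. {y. f i y \<noteq> 0})" using bd by (intro bounded_UN) auto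
  then obtain k where k: "(\<Union>i. {y. f i y \<noteq> 0}) \<subseteq> bcube k x" using bounded_subset_bcube by blast
  show ?thesis
  proof (rule kernel_integral_local(1))
    show "f i \<in> borel_measurable lebesgue" for i using bcs_meas assms by blast
    show "0 \<le> (\<Sum>i\<in>UNIV. M i)" using M by (intro sum_nonneg) (auto intro: less_imp_le)
    fix i y
    have "M i \<le> (\<Sum>i\<in>UNIV. M i)" by (rule member_le_sum) (use M(1) in \<open>auto intro: less_imp_le\<close>)
    with M(2)[of i y] have "norm (f i y) \<le> (\<Sum>i\<in>UNIV. M i)" by (rule order_trans)
    moreover have "y \<in> bcube k x" if "f i y \<noteq> 0" using k that by blast
    moreover have "0 \<le> (\<Sum>i\<in>UNIV. M i)" using M by (intro sum_nonneg) (auto intro: less_imp_le)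
    ultimately show "norm (f i y) \<le> (\<Sum>i\<in>UNIV. M i) * indicator (bcube k x) y"
      by (cases "f i y = 0") (simp_all add: indicator_def)
  qed
qed

text \<open>One function after the other is restricted to the cell. The change in each step is the value at
  a tuple one of whose members vanishes on the cell; an interior point of the cell is outside the support of
  this member, so the kernel formula applies there.\<close>

lemma kernel_defect_local:
  assumes f: "\<And>i. f i \<in> bcs"
  shows "AE x in lebesgue. x \<in> dcell k x0 \<longrightarrow>
    T f x - kernel_integral K f x =
    T (\<lambda>i x. f i x * indicator (dcell k x0) x) x - kernel_integral K (\<lambda>i x. f i x * indicator (dcell k x0) x) x"
proof -
  define Q where "Q = dcell k x0"
  have [measurable]: "Q \<in> sets lebesgue" by (simp add: Q_def)
  define r where "r A = (\<lambda>i. if i \<in> A then (\<lambda>x. f i x * indicator Q x) else f i)" for A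
  have fQ: "(\<lambda>x. f i x * indicator Q x) \<in> bcs" and fQ': "(\<lambda>x. f i x * indicator (- Q) x) \<in> bcs" for i
    by (rule bounded_compact_supp_restrict[OF f]; simp add: Compl_in_sets_lebesgue)+
  have r_bcs: "r A i \<in> bcs" for A i using f fQ by (simp add: r_def)
  have "finite (A :: 'm set) \<Longrightarrow> AE x in lebesgue. x \<in> Q \<longrightarrow>
      T f x - kernel_integral K f x = T (r A) x - kernel_integral K (r A) x" for A
  proof (induction A rule: finite_induct)
    case empty
    have "r {} = f" by (simp add: r_def)
    then show ?case by simp
  next
    case (insert i A)
    define g' where "g' = r (insert i A)"
    define g'' where "g'' = g'(i := \<lambda>x. f i x * indicator (- Q) x)"
    have g'_bcs: "g' j \<in> bcs" for j by (simp add: g'_def r_bcs)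
    have g''_bcs: "g'' j \<in> bcs" for j using g'_bcs fQ' by (simp add: g''_def)
    \<comment> \<open>\<open>r A\<close> arises from \<open>g'\<close> by putting back the part of \<open>f
      i\<close> outside the cell.\<close>
    have split: "r A = g'(i := \<lambda>x. 1 * g' i x + 1 * (f i x * indicator (- Q) x))"
      using insert.hyps by (auto simp: fun_eq_iff g'_def r_def indicator_def)
    have Tsplit: "AE x in lebesgue. T (r A) x = 1 * T g' x + 1 * T g'' x"
      unfolding split g''_def by (rule T_linear) (use bcs_Lp g'_bcs fQ' in auto)
    have Ksplit: "kernel_integral K (r A) x = kernel_integral K g' x + kernel_integral K g'' x" for x
    proof -
      have "(\<Prod>j\<in>UNIV. r A j (y $ j)) = (\<Prod>j\<in>UNIV. g' j (y $ j)) + (\<Prod>j\<in>UNIV. g'' j (y $ j))" for y :: "real^'n^'m"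
      proof -
        have rest: "(\<Prod>j\<in>UNIV - {i}. r A j (y $ j)) = (\<Prod>j\<in>UNIV - {i}. g' j (y $ j))"
          "(\<Prod>j\<in>UNIV - {i}. g'' j (y $ j)) = (\<Prod>j\<in>UNIV - {i}. g' j (y $ j))"
          by (intro prod.cong; simp add: split g''_def)+
        show ?thesis
          unfolding prod.remove[OF finite, of i UNIV, simplified] rest
          by (simp add: split g''_def distrib_right)
      qed
      then show ?thesis
        unfolding kernel_integral_def
        by (simp add: distrib_left Bochner_Integration.integral_add kernel_integrable_bcs g'_bcs g''_bcs)
    qed
    have off: "AE x in lebesgue. x \<in> Q \<longrightarrow> T g'' x = kernel_integral K g'' x"
      using T_off[OF g''_bcs] AE_interior_dcell[of k x0]
    proof eventually_elim
      fix x
      assume 1: "x \<notin> (\<Inter>j. supp (g'' j)) \<longrightarrow> T g'' x = kernel_integral K g'' x"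
        and 2: "x \<in> dcell k x0 \<longrightarrow> x \<in> interior (dcell k x0)"
      show "x \<in> Q \<longrightarrow> T g'' x = kernel_integral K g'' x"
      proof
        assume "x \<in> Q"
        then have "x \<in> interior Q" using 2 by (simp add: Q_def)
        moreover have "supp (g'' i) \<subseteq> closure (- Q)"
          unfolding supp_def g''_def by (intro closure_mono) (auto simp: indicator_def split: if_splits)
        ultimately have "x \<notin> supp (g'' i)" by (auto simp: closure_complement)
        with 1 show "T g'' x = kernel_integral K g'' x" by blast
      qed
    qed
    from insert.IH Tsplit off show ?case
      by eventually_elim (auto simp: Ksplit g'_def)
  qed
  from this[of UNIV] show ?thesis by (simp add: r_def Q_def)
qed

lemma weak_distribution:
  assumes f: "\<And>j. f j \<in> bcs" and M: "0 \<le> M" "\<And>j x. norm (f j x) \<le> M * indicator Q x" and Q: "Q \<in> sets lebesgue"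
    and l: "0 < l"
  shows "emeasure lebesgue {x. l < norm (T f x)}
     \<le> ennreal ((B * M ^ CARD('m) / l) powr t) * epow (emeasure lebesgue Q) (t / \<sigma>)"
proof -
  have t: "0 < t" using \<sigma> by simp
  have [measurable]: "T f \<in> borel_measurable lebesgue" using T_meas bcs_Lp f by blast
  have "{x \<in> space lebesgue. l < norm (T f x)} \<in> sets lebesgue" by measurable
  then have [measurable]: "{x. l < norm (T f x)} \<in> sets lebesgue" by simp
  have "ennreal l * epow (emeasure lebesgue {x. l < norm (T f x)}) (1 / t)
     = ennreal l * epow (\<integral>\<^sup>+x\<in>{x. l < norm (T f x)}. ennreal 1 \<partial>lebesgue) (1 / t)" by simp
  also have "\<dots> \<le> weak_Lp_norm t (\<lambda>_. 1) (T f)"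
    unfolding weak_Lp_norm_def using l by (intro SUP_upper) auto
  also have "\<dots> \<le> ennreal B * (\<Prod>j\<in>UNIV. Lp_norm (s j) (\<lambda>_. 1) (f j))"
    by (rule T_bound) (use bcs_Lp f in blast)
  also have "\<dots> \<le> ennreal B * (\<Prod>j\<in>UNIV. ennreal M * epow (emeasure lebesgue Q) (1 / s j))"
    by (intro mult_left_mono prod_mono_ennreal Lp_norm_bounded_on M Q s) auto
  also have "(\<Prod>j\<in>UNIV. ennreal M * epow (emeasure lebesgue Q) (1 / s j)) = ennreal (M ^ CARD('m)) * epow (emeasure lebesgue Q) (1 / \<sigma>)"
    unfolding \<sigma>(2) using M s by (subst prod_epow_sum[symmetric]) (auto simp: prod.distrib ennreal_power)
  finally have "ennreal (1 / l) * (ennreal l * epow (emeasure lebesgue {x. l < norm (T f x)}) (1 / t))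
      \<le> ennreal (1 / l) * (ennreal B * (ennreal (M ^ CARD('m)) * epow (emeasure lebesgue Q) (1 / \<sigma>)))"
    by (rule mult_left_mono) simp
  also have "ennreal (1 / l) * (ennreal l * epow (emeasure lebesgue {x. l < norm (T f x)}) (1 / t))
     = epow (emeasure lebesgue {x. l < norm (T f x)}) (1 / t)"
    using l by (simp flip: mult.assoc ennreal_mult)
  also have "ennreal (1 / l) * (ennreal B * (ennreal (M ^ CARD('m)) * epow (emeasure lebesgue Q) (1 / \<sigma>)))
     = ennreal (B * M ^ CARD('m) / l) * epow (emeasure lebesgue Q) (1 / \<sigma>)"
    using l B M by (simp flip: mult.assoc ennreal_mult)
  finally have "epow (epow (emeasure lebesgue {x. l < norm (T f x)}) (1 / t)) t
     \<le> epow (ennreal (B * M ^ CARD('m) / l) * epow (emeasure lebesgue Q) (1 / \<sigma>)) t"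
    using t by (intro epow_mono) auto
  then show ?thesis using t B M l by (simp add: epow_epow epow_mult epow_ennreal)
qed

text \<open>For a small cell \<open>Q\<close> and a threshold \<open>l\<close>, the kernel integral of the
  restricted tuple is at most \<open>l\<close> on \<open>Q\<close>. So the difference exceeds \<open>2
  l\<close> only where the operator on the restricted tuple exceeds \<open>l\<close>, a set of measure at
  most \<open>c |Q|\<^bsup>t/\<sigma>\<^esup>\<close> with \<open>t/\<sigma> > 1\<close>. Summed over the
  cells of scale \<open>k\<close> in a fixed cell this tends to zero as \<open>k \<rightarrow>
  -\<infinity>\<close>.\<close>

lemma operator_eq_kernel_integral:
  assumes f: "\<And>j. f j \<in> bcs"
  shows "AE x in lebesgue. T f x = kernel_integral K f x"
proof -
  have "\<exists>M>0. \<forall>y. norm (f i y) \<le> M" for i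
    using bounded_compact_suppE[OF f[of i]] by metis
  then obtain Mi where Mi: "\<And>i. 0 < Mi i" "\<And>i y. norm (f i y) \<le> Mi i" by metis
  define M where "M = (\<Sum>i\<in>UNIV. Mi i)"
  have M: "0 \<le> M" unfolding M_def using Mi by (intro sum_nonneg) (auto intro: less_imp_le)
  have "Mi i \<le> M" for i
    unfolding M_def by (rule member_le_sum) (use Mi(1) in \<open>auto intro: less_imp_le\<close>)
  then have fM: "norm (f i y) \<le> M" for i y using Mi(2) by (rule order_trans[rotated])
  define D where "D x = T f x - kernel_integral K f x" for x
  define \<delta> where "\<delta> = t / \<sigma> - 1"
  have \<delta>: "0 < \<delta>" using \<sigma> by (simp add: \<delta>_def)
  have small: "AE x in lebesgue. norm (D x) \<le> 2 * l" if l: "0 < l" for l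
  proof -
    define c where "c = (B * M ^ CARD('m) / l) powr t"
    define rst where "rst k z = (\<lambda>i x. f i x * indicator {x. idx k x = z} x)" for k z
    define W where "W k = {x. l < norm (T (rst k (idx k x)) x)}" for k
    have cell_eq: "{y. idx k y = idx k x} = dcell k x" for k and x :: "real^'n" by (simp add: dcell_def)
    have rst_bcs: "rst k (idx k x) i \<in> bcs" for k x i
      unfolding rst_def cell_eq by (rule bounded_compact_supp_restrict[OF f]) simp
    have rst_bound: "norm (rst k (idx k x) i y) \<le> M * indicator (dcell k x) y" for k x i y
      unfolding rst_def cell_eq using fM[of i y] M by (simp add: indicator_def)
    have W_cell: "W k \<inter> dcell k x = {y. l < norm (T (rst k (idx k x)) y)} \<inter> dcell k x" for k x
      by (auto simp: W_def dcell_def)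
    have level_sets: "{y. l < norm (T (rst k (idx k x)) y)} \<in> sets lebesgue" for k x
    proof -
      have [measurable]: "T (rst k (idx k x)) \<in> borel_measurable lebesgue" using T_meas bcs_Lp rst_bcs by blast
      have "{y \<in> space lebesgue. l < norm (T (rst k (idx k x)) y)} \<in> sets lebesgue" by measurable
      then show ?thesis by simp
    qed
    \<comment> \<open>The set \<open>W k\<close> is used in place of the set where the difference is large,
      because it is a countable union of measurable pieces.\<close>
    have W_sets [measurable]: "W k \<in> sets lebesgue" for k
    proof -
      define wz where "wz z = (if \<exists>x :: real^'n. idx k x = z then W k \<inter> {x. idx k x = z} else {})" for z
      have "wz z \<in> sets lebesgue" for z
      proof (cases "\<exists>x :: real^'n. idx k x = z")
        case True
        then obtain x :: "real^'n" where "idx k x = z" by blast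
        then have "wz z = W k \<inter> dcell k x" by (auto simp: wz_def dcell_def)
        then show ?thesis unfolding W_cell using level_sets by simp
      qed (simp add: wz_def)
      then have "(\<Union>z. wz z) \<in> sets lebesgue" by (intro sets.countable_UN) auto
      moreover have "(\<Union>z. wz z) = W k" by (auto simp: wz_def)
      ultimately show ?thesis by simp
    qed
    have W_small: "emeasure lebesgue (W k \<inter> dcell k x) \<le> ennreal (c * side k powr (real CARD('n) * \<delta>)) * emeasure lebesgue (dcell k x)" for k x
    proof -
      have "emeasure lebesgue (W k \<inter> dcell k x) \<le> emeasure lebesgue {y. l < norm (T (rst k (idx k x)) y)}"
        unfolding W_cell by (intro emeasure_mono level_sets) auto
      also have "\<dots> \<le> ennreal c * epow (emeasure lebesgue (dcell k x)) (t / \<sigma>)"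
        unfolding c_def by (rule weak_distribution) (use rst_bcs rst_bound M l in auto)
      also have "epow (emeasure lebesgue (dcell k x)) (t / \<sigma>) = epow (emeasure lebesgue (dcell k x)) \<delta> * emeasure lebesgue (dcell k x)"
        using epow_add[of \<delta> 1 "emeasure lebesgue (dcell k x)"] \<delta> by (simp add: \<delta>_def)
      also have "epow (emeasure lebesgue (dcell k x)) \<delta> = ennreal (side k powr (real CARD('n) * \<delta>))"
        unfolding emeasure_dcell by (simp add: epow_ennreal powr_powr flip: powr_realpow)
      finally show ?thesis by (simp add: c_def ennreal_mult mult.assoc)
    qed
    obtain k0 where k0: "\<And>k. k \<le> k0 \<Longrightarrow> CK * (M ^ CARD('m) * side k powr \<alpha> * loc_const) \<le> l"
    proof -
      define e where "e = CK * M ^ CARD('m) * loc_const"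
      have e: "0 \<le> e" using CK M loc_const_pos by (simp add: e_def)
      obtain j where j: "(e / l) powr (1 / \<alpha>) \<le> side j" using side_unbounded[of 0] by blast
      have "CK * (M ^ CARD('m) * side k powr \<alpha> * loc_const) \<le> l" if "k \<le> - j" for k
      proof -
        have "e / l = ((e / l) powr (1 / \<alpha>)) powr \<alpha>" using e l \<alpha> by (simp add: powr_powr)
        also have "\<dots> \<le> side j powr \<alpha>" using j \<alpha> by (intro powr_mono2) auto
        finally have "e \<le> l * side j powr \<alpha>" using l by (simp add: field_simps)
        moreover have "side k powr \<alpha> \<le> side (- j) powr \<alpha>" using that \<alpha> by (intro powr_mono2 side_mono) auto
        moreover have "side (- j) powr \<alpha> * side j powr \<alpha> = 1"
          by (simp add: side_def powr_minus flip: powr_mult)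
        ultimately have "side k powr \<alpha> * e \<le> side (- j) powr \<alpha> * (l * side j powr \<alpha>)"
          using e l by (intro mult_mono) auto
        also have "\<dots> = l" using \<open>side (- j) powr \<alpha> * side j powr \<alpha> = 1\<close> by (simp add: mult.left_commute)
        finally show ?thesis by (simp add: e_def mult_ac)
      qed
      then show thesis by (rule that)
    qed
    have in_W: "AE x in lebesgue. \<forall>k\<le>k0. 2 * l < norm (D x) \<longrightarrow> x \<in> W k"
    proof -
      have "AE x in lebesgue. k \<le> k0 \<longrightarrow> 2 * l < norm (D x) \<longrightarrow> x \<in> W k" for k
      proof -
        have "AE x in lebesgue. idx k x = z \<longrightarrow> D x = T (rst k z) x - kernel_integral K (rst k z) x" for z
        proof (cases "\<exists>x0 :: real^'n. idx k x0 = z")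
          case True
          then obtain x0 :: "real^'n" where x0: "idx k x0 = z" by blast
          have "rst k z = (\<lambda>i x. f i x * indicator (dcell k x0) x)" by (simp add: rst_def dcell_def x0)
          with kernel_defect_local[OF f, of k x0] show ?thesis by (simp add: D_def dcell_def x0)
        qed auto
        then have "AE x in lebesgue. \<forall>z. idx k x = z \<longrightarrow> D x = T (rst k z) x - kernel_integral K (rst k z) x"
          unfolding AE_all_countable by (rule allI)
        then show ?thesis
        proof eventually_elim
          fix x assume *: "\<forall>z. idx k x = z \<longrightarrow> D x = T (rst k z) x - kernel_integral K (rst k z) x"
          show "k \<le> k0 \<longrightarrow> 2 * l < norm (D x) \<longrightarrow> x \<in> W k"
          proof (intro impI)
            assume k: "k \<le> k0" and big: "2 * l < norm (D x)"
            have D: "D x = T (rst k (idx k x)) x - kernel_integral K (rst k (idx k x)) x" using * by blast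
            have "norm (kernel_integral K (rst k (idx k x)) x) \<le> CK * (M ^ CARD('m) * side k powr \<alpha> * loc_const)"
            proof (rule kernel_integral_local(2))
              show "rst k (idx k x) i \<in> borel_measurable lebesgue" for i using bcs_meas rst_bcs by blast
              show "norm (rst k (idx k x) i y) \<le> M * indicator (bcube k x) y" for i y
                by (rule order_trans[OF rst_bound]) (use M dcell_subset_bcube[of k x] in \<open>auto simp: indicator_def\<close>)
            qed (rule M)
            with k0[OF k] have "norm (kernel_integral K (rst k (idx k x)) x) \<le> l" by simp
            then have "l < norm (T (rst k (idx k x)) x)"
              using big norm_triangle_ineq4[of "T (rst k (idx k x)) x" "kernel_integral K (rst k (idx k x)) x"] unfolding D by linarith
            then show "x \<in> W k" by (simp add: W_def)
          qed
        qed
      qed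
      then show ?thesis by (simp add: AE_all_countable)
    qed
    have null: "(\<Inter>k\<in>{..k0}. W k) \<inter> dcell k0 x0 \<in> null_sets lebesgue" for x0
    proof (rule null_setsI)
      show "(\<Inter>k\<in>{..k0}. W k) \<inter> dcell k0 x0 \<in> sets lebesgue"
        by (intro sets.Int sets.countable_INT') auto
      define R where "R = dcell k0 x0"
      have R_fin: "emeasure lebesgue R = ennreal (side k0 ^ CARD('n))" by (simp only: R_def emeasure_dcell)
      have le: "emeasure lebesgue ((\<Inter>k\<in>{..k0}. W k) \<inter> R) \<le> ennreal (c * side k powr (real CARD('n) * \<delta>) * side k0 ^ CARD('n))"
        if k: "k \<le> k0" for k
      proof -
        define e where "e = ennreal (c * side k powr (real CARD('n) * \<delta>))"
        have [measurable]: "R \<in> sets lebesgue" by (simp add: R_def)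
        have st: "stopping R (\<lambda>_. k)"
          unfolding stopping_def R_def dcell_def by (auto dest: idx_eq_coarser[OF k])
        have "emeasure lebesgue ((\<Inter>k\<in>{..k0}. W k) \<inter> R) \<le> emeasure lebesgue (W k \<inter> R)"
          using k by (intro emeasure_mono) auto
        also have "\<dots> = (\<integral>\<^sup>+x\<in>R. indicator (W k) x \<partial>lebesgue)"
          by (simp only: indicator_inter_arith[symmetric] nn_integral_indicator sets.Int W_sets \<open>R \<in> sets lebesgue\<close>)
        also have "\<dots> \<le> (\<integral>\<^sup>+x\<in>R. e \<partial>lebesgue)"
        proof (rule stopping_nn_integral_mono[OF st])
          fix x assume "x \<in> R"
          have "(\<integral>\<^sup>+y\<in>dcell k x. indicator (W k) y \<partial>lebesgue) = emeasure lebesgue (W k \<inter> dcell k x)"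
            by (simp only: indicator_inter_arith[symmetric] nn_integral_indicator sets.Int W_sets dcell_sets)
          also have "\<dots> \<le> e * emeasure lebesgue (dcell k x)" unfolding e_def by (rule W_small)
          also have "\<dots> = (\<integral>\<^sup>+y\<in>dcell k x. e \<partial>lebesgue)" by (rule nn_integral_cmult_indicator[symmetric]) simp
          finally show "(\<integral>\<^sup>+y\<in>dcell k x. indicator (W k) y \<partial>lebesgue) \<le> (\<integral>\<^sup>+y\<in>dcell k x. e \<partial>lebesgue)" .
        qed auto
        also have "\<dots> = e * emeasure lebesgue R" by (rule nn_integral_cmult_indicator) simp
        also have "\<dots> = ennreal (c * side k powr (real CARD('n) * \<delta>) * side k0 ^ CARD('n))"
          unfolding R_fin e_def by (rule ennreal_mult[symmetric]) (auto simp: c_def)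
        finally show ?thesis .
      qed
      have lim: "(\<lambda>i. ennreal (c * side (k0 - int i) powr (real CARD('n) * \<delta>) * side k0 ^ CARD('n))) \<longlonglongrightarrow> ennreal (c * 0 * side k0 ^ CARD('n))"
      proof -
        define b where "b = 2 powr (- (real CARD('n) * \<delta>))"
        have "0 < real CARD('n) * \<delta>" using \<delta> by simp
        then have "b < 1" by (simp add: b_def powr_minus_divide)
        then have "(\<lambda>i. side k0 powr (real CARD('n) * \<delta>) * b ^ i) \<longlonglongrightarrow> side k0 powr (real CARD('n) * \<delta>) * 0"
          by (intro tendsto_mult tendsto_const LIMSEQ_power_zero) (simp add: b_def)
        moreover have "side k0 powr (real CARD('n) * \<delta>) * b ^ i = side (k0 - int i) powr (real CARD('n) * \<delta>)" for i
          by (simp add: b_def side_def powr_powr algebra_simps flip: powr_realpow powr_add)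
        ultimately have "(\<lambda>i. side (k0 - int i) powr (real CARD('n) * \<delta>)) \<longlonglongrightarrow> 0" by simp
        then show ?thesis by (intro tendsto_ennrealI tendsto_mult tendsto_const)
      qed
      have "emeasure lebesgue ((\<Inter>k\<in>{..k0}. W k) \<inter> R) \<le> ennreal (c * 0 * side k0 ^ CARD('n))"
        by (rule LIMSEQ_le_const[OF lim]) (use le in auto)
      then show "emeasure lebesgue ((\<Inter>k\<in>{..k0}. W k) \<inter> dcell k0 x0) = 0" by (simp add: R_def)
    qed
    have "AE x in lebesgue. idx k0 x = z \<longrightarrow> x \<notin> (\<Inter>k\<in>{..k0}. W k)" for z
    proof (cases "\<exists>x0 :: real^'n. idx k0 x0 = z")
      case True
      then obtain x0 :: "real^'n" where x0: "idx k0 x0 = z" by blast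
      show ?thesis by (rule AE_I'[OF null[of x0]]) (auto simp: dcell_def x0)
    qed auto
    then have "AE x in lebesgue. \<forall>z. idx k0 x = z \<longrightarrow> x \<notin> (\<Inter>k\<in>{..k0}. W k)"
      unfolding AE_all_countable by (rule allI)
    with in_W show ?thesis
    proof eventually_elim
      fix x
      assume 1: "\<forall>k\<le>k0. 2 * l < norm (D x) \<longrightarrow> x \<in> W k" and 2: "\<forall>z. idx k0 x = z \<longrightarrow> x \<notin> (\<Inter>k\<in>{..k0}. W k)"
      show "norm (D x) \<le> 2 * l"
      proof (rule ccontr)
        assume "\<not> norm (D x) \<le> 2 * l"
        then have "x \<in> (\<Inter>k\<in>{..k0}. W k)" using 1 by auto
        with 2 show False by blast
      qed
    qed
  qed
  have "AE x in lebesgue. norm (D x) \<le> 2 * (1 / real (Suc i))" for i :: nat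
    by (rule small) simp
  then have "AE x in lebesgue. \<forall>i :: nat. norm (D x) \<le> 2 * (1 / real (Suc i))"
    by (simp only: AE_all_countable) simp
  then show ?thesis
  proof eventually_elim
    fix x assume *: "\<forall>i :: nat. norm (D x) \<le> 2 * (1 / real (Suc i))"
    have "norm (D x) \<le> 2 * 0"
      by (rule LIMSEQ_le_const[OF tendsto_mult[OF tendsto_const LIMSEQ_inverse_real_of_nat]])
         (use * in \<open>auto simp: inverse_eq_divide\<close>)
    then show "T f x = kernel_integral K f x" by (simp add: D_def)
  qed
qed

end

section \<open>Weighted bounds and continuous extension\<close>

lemma Lp_norm_dominated:
  assumes q: "0 < q" and c: "0 \<le> c" and g: "AE x in lebesgue. ennreal (norm (g x)) \<le> ennreal c * J x"
    and [measurable]: "J \<in> borel_measurable lebesgue" "w \<in> borel_measurable lebesgue"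
    and w: "\<And>x. 0 \<le> w x"
  shows "Lp_norm q w g \<le> ennreal c * epow (\<integral>\<^sup>+x. epow (J x) q * ennreal (w x) \<partial>lebesgue) (1 / q)"
proof -
  have "(\<integral>\<^sup>+x. ennreal (norm (g x) powr q * w x) \<partial>lebesgue)
     \<le> (\<integral>\<^sup>+x. ennreal (c powr q) * (epow (J x) q * ennreal (w x)) \<partial>lebesgue)"
  proof (rule nn_integral_mono_AE, use g in eventually_elim)
    fix x assume "ennreal (norm (g x)) \<le> ennreal c * J x"
    then have "epow (ennreal (norm (g x))) q \<le> epow (ennreal c * J x) q" using q by (intro epow_mono) auto
    then have "ennreal (norm (g x) powr q) \<le> ennreal (c powr q) * epow (J x) q"
      using q c by (simp add: epow_mult epow_ennreal)
    then have "ennreal (norm (g x) powr q) * ennreal (w x) \<le> ennreal (c powr q) * epow (J x) q * ennreal (w x)"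
      by (rule mult_right_mono) simp
    then show "ennreal (norm (g x) powr q * w x) \<le> ennreal (c powr q) * (epow (J x) q * ennreal (w x))"
      using w by (simp add: ennreal_mult mult.assoc)
  qed
  also have "\<dots> = ennreal (c powr q) * (\<integral>\<^sup>+x. epow (J x) q * ennreal (w x) \<partial>lebesgue)"
    by (rule nn_integral_cmult) measurable
  finally have "Lp_norm q w g \<le> epow (ennreal (c powr q) * (\<integral>\<^sup>+x. epow (J x) q * ennreal (w x) \<partial>lebesgue)) (1 / q)"
    unfolding Lp_norm_def using q by (intro epow_mono) auto
  also have "\<dots> = ennreal c * epow (\<integral>\<^sup>+x. epow (J x) q * ennreal (w x) \<partial>lebesgue) (1 / q)"
    using q c by (simp add: epow_mult epow_ennreal powr_powr)
  finally show ?thesis .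
qed

text \<open>Chebyshev's inequality.\<close>

lemma weak_Lp_norm_le_Lp_norm:
  assumes q: "0 < q" and w: "\<And>x. 0 \<le> w x"
    and [measurable]: "w \<in> borel_measurable lebesgue" "g \<in> borel_measurable lebesgue"
  shows "weak_Lp_norm q w g \<le> Lp_norm q w g"
  unfolding weak_Lp_norm_def
proof (rule SUP_least)
  fix l :: real assume "l \<in> {0<..}"
  then have l: "0 < l" by simp
  have "{x \<in> space lebesgue. l < norm (g x)} \<in> sets lebesgue" by measurable
  then have [measurable]: "{x. l < norm (g x)} \<in> sets lebesgue" by simp
  have "ennreal l * epow (\<integral>\<^sup>+x\<in>{x. l < norm (g x)}. ennreal (w x) \<partial>lebesgue) (1 / q)
     = epow (ennreal (l powr q) * (\<integral>\<^sup>+x\<in>{x. l < norm (g x)}. ennreal (w x) \<partial>lebesgue)) (1 / q)"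
    using q l by (simp add: epow_mult epow_ennreal powr_powr)
  also have "\<dots> \<le> Lp_norm q w g" unfolding Lp_norm_def
  proof (rule epow_mono)
    have "ennreal (l powr q) * (\<integral>\<^sup>+x\<in>{x. l < norm (g x)}. ennreal (w x) \<partial>lebesgue)
       = (\<integral>\<^sup>+x. ennreal (l powr q) * (ennreal (w x) * indicator {x. l < norm (g x)} x) \<partial>lebesgue)"
      by (rule nn_integral_cmult[symmetric]) measurable
    also have "\<dots> \<le> (\<integral>\<^sup>+x. ennreal (norm (g x) powr q * w x) \<partial>lebesgue)"
    proof (rule nn_integral_mono)
      fix x
      show "ennreal (l powr q) * (ennreal (w x) * indicator {x. l < norm (g x)} x) \<le> ennreal (norm (g x) powr q * w x)"
        using l q w[of x] by (auto simp: indicator_def ennreal_mult[symmetric] intro!: ennreal_leI mult_right_mono powr_mono2)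
    qed
    finally show "ennreal (l powr q) * (\<integral>\<^sup>+x\<in>{x. l < norm (g x)}. ennreal (w x) \<partial>lebesgue)
       \<le> (\<integral>\<^sup>+x. ennreal (norm (g x) powr q * w x) \<partial>lebesgue)" .
  qed (use q in simp)
  finally show "ennreal l * epow (\<integral>\<^sup>+x\<in>{x. l < norm (g x)}. ennreal (w x) \<partial>lebesgue) (1 / q) \<le> Lp_norm q w g" .
qed

text \<open>Each summand for \<open>A \<noteq> {}\<close> contains a difference \<open>d i\<close> and
  otherwise only factors of the limit tuple, which are independent of the approximation.\<close>

lemma norm_prod_diff_expansion:
  fixes b d :: "'m::finite \<Rightarrow> complex"
  shows "ennreal (norm ((\<Prod>i\<in>UNIV. b i + d i) - (\<Prod>i\<in>UNIV. b i)))
     \<le> (\<Sum>A\<in>Pow UNIV - {{}}. \<Prod>i\<in>UNIV. ennreal (norm (if i \<in> A then d i else b i)))"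
proof -
  define c where "c A = (\<Prod>i\<in>UNIV. if i \<in> A then d i else b i)" for A
  have c: "c A = (\<Prod>i\<in>UNIV - A. b i) * (\<Prod>i\<in>A. d i)" for A
    unfolding c_def by (simp add: prod.If_cases Compl_eq_Diff_UNIV mult.commute)
  have "(\<Prod>i\<in>UNIV. d i + b i) = (\<Sum>A\<in>Pow UNIV. (\<Prod>i\<in>A. d i) * (\<Prod>i\<in>UNIV - A. b i))"
    by (rule prod_add) simp
  also have "\<dots> = (\<Sum>A\<in>Pow UNIV. c A)" by (simp add: c mult.commute)
  also have "\<dots> = c {} + (\<Sum>A\<in>Pow UNIV - {{}}. c A)" by (rule sum.remove) auto
  finally have "(\<Prod>i\<in>UNIV. b i + d i) - (\<Prod>i\<in>UNIV. b i) = (\<Sum>A\<in>Pow UNIV - {{}}. c A)"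
    by (simp add: c add.commute)
  then have "norm ((\<Prod>i\<in>UNIV. b i + d i) - (\<Prod>i\<in>UNIV. b i)) \<le> (\<Sum>A\<in>Pow UNIV - {{}}. norm (c A))"
    by (simp only: norm_sum)
  then have "ennreal (norm ((\<Prod>i\<in>UNIV. b i + d i) - (\<Prod>i\<in>UNIV. b i))) \<le> ennreal (\<Sum>A\<in>Pow UNIV - {{}}. norm (c A))"
    by (rule ennreal_leI)
  also have "\<dots> = (\<Sum>A\<in>Pow UNIV - {{}}. \<Prod>i\<in>UNIV. ennreal (norm (if i \<in> A then d i else b i)))"
    by (subst sum_ennreal[symmetric]) (auto simp: c_def prod_norm[symmetric] prod_ennreal prod_nonneg)
  finally show ?thesis .
qed

text \<open>Everything that is needed about the weights is the estimate \<open>potential\<close> and the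
  positivity of \<open>v\<close>, which makes the potential finite almost everywhere for Lebesgue
  measure.\<close>

locale weighted_kernel =
  fixes K :: "real^'n \<Rightarrow> real^'n^'m \<Rightarrow> complex"
    and T :: "('m::finite \<Rightarrow> real^'n \<Rightarrow> complex) \<Rightarrow> real^'n \<Rightarrow> complex"
    and w :: "'m \<Rightarrow> real^'n \<Rightarrow> real" and v :: "real^'n \<Rightarrow> real"
    and P :: "'m \<Rightarrow> real" and q \<alpha> CK C :: real
  assumes K_meas: "\<And>x. K x \<in> borel_measurable lebesgue"
    and CK: "0 < CK"
    and K_bound: "\<And>\<phi> x. (\<And>i. \<phi> i \<in> borel_measurable lebesgue) \<Longrightarrow>
      (\<integral>\<^sup>+y. ennreal (norm (K x y)) * (\<Prod>i\<in>UNIV. \<phi> i (y $ i)) \<partial>lebesgue) \<le> ennreal CK * dyadic_potential \<alpha> \<phi> x"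
    and T_meas: "\<And>f. (\<And>j. f j \<in> bounded_compact_supp) \<Longrightarrow> T f \<in> borel_measurable lebesgue"
    and T_eq: "\<And>f. (\<And>j. f j \<in> bounded_compact_supp) \<Longrightarrow> AE x in lebesgue. T f x = kernel_integral K f x"
    and v_meas [measurable]: "v \<in> borel_measurable lebesgue" and v_nonneg: "\<And>x. 0 \<le> v x"
    and v_pos: "AE x in lebesgue. 0 < v x"
    and q: "0 < q" and C: "0 < C"
    and potential: "\<And>f. (\<And>j. f j \<in> Lp_space (P j) (w j)) \<Longrightarrow>
      (\<integral>\<^sup>+x. epow (dyadic_potential \<alpha> (\<lambda>i y. ennreal (norm (f i y))) x) q * ennreal (v x) \<partial>lebesgue)
        \<le> ennreal C * epow (\<Prod>i\<in>UNIV. Lp_norm (P i) (w i) (f i)) q"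
begin

abbreviation pot :: "('m \<Rightarrow> real^'n \<Rightarrow> complex) \<Rightarrow> real^'n \<Rightarrow> ennreal" where
  "pot f \<equiv> dyadic_potential \<alpha> (\<lambda>i y. ennreal (norm (f i y)))"

lemma Lp_meas: "f \<in> Lp_space r u \<Longrightarrow> f \<in> borel_measurable lebesgue"
  by (simp add: Lp_space_def)

lemma pot_finite:
  assumes f: "\<And>j. f j \<in> Lp_space (P j) (w j)"
  shows "AE x in lebesgue. pot f x < top"
proof -
  have "(\<integral>\<^sup>+x. epow (pot f x) q * ennreal (v x) \<partial>lebesgue) \<le> ennreal C * epow (\<Prod>i\<in>UNIV. Lp_norm (P i) (w i) (f i)) q"
    by (rule potential[OF f])
  also have "\<dots> < top"
  proof -
    have "(\<Prod>i\<in>UNIV. Lp_norm (P i) (w i) (f i)) \<noteq> top"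
      using f by (auto simp: ennreal_prod_eq_top Lp_space_def less_top)
    then show ?thesis by (simp add: ennreal_mult_less_top less_top)
  qed
  finally have "AE x in lebesgue. epow (pot f x) q * ennreal (v x) \<noteq> \<infinity>"
    by (intro nn_integral_noteq_infinite) (auto simp: less_top)
  then show ?thesis using v_pos
    by eventually_elim (auto simp: ennreal_mult_eq_top_iff less_top[symmetric])
qed

lemma kernel_integrable:
  assumes "\<And>j. f j \<in> borel_measurable lebesgue" "pot f x < top"
  shows "integrable lebesgue (\<lambda>y. K x y * (\<Prod>j\<in>UNIV. f j (y $ j)))"
  by (rule kernel_integral_bound(1)[where K=K and x=x, OF K_meas K_bound assms])

text \<open>The operator maps truncations of \<open>f\<close> to measurable functions, and by dominated
  convergence these converge to the kernel integral of \<open>f\<close> wherever the potential is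
  finite.\<close>

lemma kernel_integral_measurable:
  assumes f: "\<And>j. f j \<in> Lp_space (P j) (w j)"
  shows "kernel_integral K f \<in> borel_measurable lebesgue"
proof -
  define A where "A k j = {y \<in> cball 0 (real k). norm (f j y) \<le> real k}" for k j
  define g where "g k j y = f j y * indicator (A k j) y" for k j y
  have [measurable]: "f j \<in> borel_measurable lebesgue" for j using f Lp_meas by blast
  have "{y \<in> space lebesgue. y \<in> cball 0 (real k) \<and> norm (f j y) \<le> real k} \<in> sets lebesgue" for k j
  proof -
    have "{y \<in> space lebesgue. norm (f j y) \<le> real k} \<in> sets lebesgue" by measurable
    then have "cball 0 (real k) \<inter> {y \<in> space lebesgue. norm (f j y) \<le> real k} \<in> sets lebesgue" by (intro sets.Int) auto
    moreover have "cball 0 (real k) \<inter> {y \<in> space lebesgue. norm (f j y) \<le> real k} = {y \<in> space lebesgue. y \<in> cball 0 (real k) \<and> norm (f j y) \<le> real k}"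
      by auto
    ultimately show ?thesis by simp
  qed
  then have A_sets [measurable]: "A k j \<in> sets lebesgue" for k j by (simp add: A_def)
  have g_meas: "g k j \<in> borel_measurable lebesgue" for k j unfolding g_def[abs_def] by measurable
  have g_bcs: "g k j \<in> bounded_compact_supp" for k j
  proof (rule bounded_compact_suppI[OF g_meas])
    show "norm (g k j x) \<le> real k" for x by (auto simp: g_def A_def indicator_def)
    show "bounded {x. g k j x \<noteq> 0}"
      by (rule bounded_subset[OF bounded_cball[of 0 "real k"]]) (auto simp: g_def A_def indicator_def)
  qed
  have g_le: "norm (g k j y) \<le> norm (f j y)" for k j y by (auto simp: g_def indicator_def)
  have g_lim: "(\<lambda>k. g k j y) \<longlonglongrightarrow> f j y" for j y
  proof -
    obtain k0 where k0: "max (norm y) (norm (f j y)) \<le> real k0" using real_arch_simple by blast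
    have "\<forall>\<^sub>F k in sequentially. g k j y = f j y"
      using eventually_ge_at_top[of k0]
    proof eventually_elim
      fix k assume "k0 \<le> k"
      then have "max (norm y) (norm (f j y)) \<le> real k" using k0 by simp
      then show "g k j y = f j y" by (simp add: g_def A_def)
    qed
    then show ?thesis by (rule tendsto_eventually)
  qed
  have "AE x in lebesgue. \<forall>k. T (g k) x = kernel_integral K (g k) x"
    unfolding AE_all_countable using T_eq g_bcs by blast
  then have lim: "AE x in lebesgue. lim (\<lambda>k. T (g k) x) = kernel_integral K f x"
    using pot_finite[OF f]
  proof eventually_elim
    fix x assume eq: "\<forall>k. T (g k) x = kernel_integral K (g k) x" and fin: "pot f x < top"
    have int: "integrable lebesgue (\<lambda>y. K x y * (\<Prod>j\<in>UNIV. f j (y $ j)))"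
      by (rule kernel_integrable[OF _ fin]) measurable
    have "(\<lambda>k. kernel_integral K (g k) x) \<longlonglongrightarrow> kernel_integral K f x"
      unfolding kernel_integral_def
    proof (rule integral_dominated_convergence[where w="\<lambda>y. norm (K x y * (\<Prod>j\<in>UNIV. f j (y $ j)))"])
      show "(\<lambda>y. K x y * (\<Prod>j\<in>UNIV. g k j (y $ j))) \<in> borel_measurable lebesgue" for k
        using K_meas prod_vec_nth_measurable[OF g_meas] by (intro borel_measurable_times) auto
      show "AE y in lebesgue. (\<lambda>k. K x y * (\<Prod>j\<in>UNIV. g k j (y $ j))) \<longlonglongrightarrow> K x y * (\<Prod>j\<in>UNIV. f j (y $ j))"
        by (intro always_eventually allI tendsto_mult tendsto_const tendsto_prod g_lim)
      show "AE y in lebesgue. norm (K x y * (\<Prod>j\<in>UNIV. g k j (y $ j))) \<le> norm (K x y * (\<Prod>j\<in>UNIV. f j (y $ j)))" for k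
        by (intro always_eventually allI) (simp add: norm_mult prod_norm[symmetric] mult_left_mono prod_mono g_le)
    qed (use int in auto)
    then show "lim (\<lambda>k. T (g k) x) = kernel_integral K f x" using eq by (simp add: limI)
  qed
  have "(\<lambda>x. lim (\<lambda>k. T (g k) x)) \<in> borel_measurable lebesgue"
    by (rule borel_measurable_lim_metric) (use T_meas g_bcs in blast)
  then show ?thesis by (rule borel_measurable_AE) (rule lim)
qed

lemma kernel_integral_Lp_bound:
  assumes f: "\<And>j. f j \<in> Lp_space (P j) (w j)"
  shows "Lp_norm q v (kernel_integral K f) \<le> ennreal (CK * C powr (1 / q)) * (\<Prod>i\<in>UNIV. Lp_norm (P i) (w i) (f i))"
proof -
  have [measurable]: "f j \<in> borel_measurable lebesgue" for j using f Lp_meas by blast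
  have "AE x in lebesgue. ennreal (norm (kernel_integral K f x)) \<le> ennreal CK * pot f x"
    using pot_finite[OF f]
    by eventually_elim (rule kernel_integral_bound(2)[where K=K, OF K_meas K_bound], auto)
  then have "Lp_norm q v (kernel_integral K f) \<le> ennreal CK * epow (\<integral>\<^sup>+x. epow (pot f x) q * ennreal (v x) \<partial>lebesgue) (1 / q)"
    using CK q v_nonneg by (intro Lp_norm_dominated) auto
  also have "\<dots> \<le> ennreal CK * epow (ennreal C * epow (\<Prod>i\<in>UNIV. Lp_norm (P i) (w i) (f i)) q) (1 / q)"
    using q potential[OF f] by (intro mult_left_mono epow_mono) auto
  also have "\<dots> = ennreal (CK * C powr (1 / q)) * (\<Prod>i\<in>UNIV. Lp_norm (P i) (w i) (f i))"
    using q C CK by (simp add: epow_mult epow_epow epow_ennreal ennreal_mult mult.assoc)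
  finally show ?thesis .
qed

definition diff_const :: real where
  "diff_const = CK * (real (card (Pow (UNIV :: 'm set) - {{}})) powr q * C * real (card (Pow (UNIV :: 'm set) - {{}}))) powr (1 / q)"

text \<open>The difference of two products is expanded over the nonempty sets \<open>A\<close> of indices.
  Each resulting tuple has norms at most \<open>F\<close>, and at least one at most
  \<open>D\<close>.\<close>

lemma difference_bound:
  assumes f: "\<And>j. f j \<in> Lp_space (P j) (w j)" and g: "\<And>j. g j \<in> Lp_space (P j) (w j)" "\<And>j. g j \<in> bounded_compact_supp"
    and D: "D = (\<Sum>j\<in>UNIV. Lp_norm (P j) (w j) (\<lambda>x. g j x - f j x))" "D \<le> 1"
    and F: "F = 1 + (\<Sum>j\<in>UNIV. Lp_norm (P j) (w j) (f j))"
  shows "Lp_norm q v (\<lambda>x. T g x - kernel_integral K f x)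
     \<le> ennreal diff_const * F ^ CARD('m) * D"
proof -
  let ?k = "\<lambda>f x (y :: real^'n^'m). K x y * (\<Prod>j\<in>UNIV. f j (y $ j))"
  let ?P = "Pow (UNIV :: 'm set) - {{}}"
  define N where "N = real (card ?P)"
  have [measurable]: "f j \<in> borel_measurable lebesgue" "g j \<in> borel_measurable lebesgue" for j
    using f g Lp_meas by blast+
  define h where "h A j x = (if j \<in> A then g j x - f j x else f j x)" for A j x
  have h_meas [measurable]: "h A j \<in> borel_measurable lebesgue" for A j
    unfolding h_def by (cases "j \<in> A") auto
  have D_le: "Lp_norm (P j) (w j) (\<lambda>x. g j x - f j x) \<le> D" for j
    unfolding D(1) by (rule member_le_sum) auto
  have F_le: "Lp_norm (P j) (w j) (f j) \<le> F" for j
  proof -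
    have "Lp_norm (P j) (w j) (f j) \<le> (\<Sum>j\<in>UNIV. Lp_norm (P j) (w j) (f j))" by (rule member_le_sum) auto
    also have "\<dots> \<le> F" by (simp add: F)
    finally show ?thesis .
  qed
  have F1: "1 \<le> F" by (simp add: F)
  have h_Lp: "h A j \<in> Lp_space (P j) (w j)" for A j
  proof (cases "j \<in> A")
    case True
    then have "h A j = (\<lambda>x. g j x - f j x)" by (simp add: h_def fun_eq_iff)
    moreover have "Lp_norm (P j) (w j) (\<lambda>x. g j x - f j x) < top"
      using order_trans[OF D_le D(2)] by (rule le_less_trans) simp
    ultimately show ?thesis using h_meas[of A j] by (simp add: Lp_space_def)
  next
    case False
    then have "h A j = f j" by (simp add: h_def fun_eq_iff)
    then show ?thesis using f by simp
  qed
  have h_prod: "(\<Prod>j\<in>UNIV. Lp_norm (P j) (w j) (h A j)) \<le> F ^ CARD('m) * D" if A: "A \<in> ?P" for A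
  proof -
    obtain i where i: "i \<in> A" using A by blast
    have "h A i = (\<lambda>x. g i x - f i x)" using i by (simp add: h_def fun_eq_iff)
    then have hi: "Lp_norm (P i) (w i) (h A i) \<le> D" using D_le by simp
    have hF: "Lp_norm (P j) (w j) (h A j) \<le> F" for j
    proof (cases "j \<in> A")
      case True
      then have "h A j = (\<lambda>x. g j x - f j x)" by (simp add: h_def fun_eq_iff)
      then show ?thesis using order_trans[OF D_le D(2)] F1 by (metis order_trans)
    next
      case False
      then have "h A j = f j" by (simp add: h_def fun_eq_iff)
      then show ?thesis using F_le by simp
    qed
    have "(\<Prod>j\<in>UNIV. Lp_norm (P j) (w j) (h A j)) = Lp_norm (P i) (w i) (h A i) * (\<Prod>j\<in>UNIV - {i}. Lp_norm (P j) (w j) (h A j))"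
      by (rule prod.remove) auto
    also have "\<dots> \<le> D * (\<Prod>j\<in>UNIV - {i}. F)"
      by (intro mult_mono hi prod_mono_ennreal hF) auto
    also have "(\<Prod>j\<in>UNIV - {i}. F) \<le> F ^ CARD('m)"
      using F1 by (simp add: power_increasing)
    finally have "(\<Prod>j\<in>UNIV. Lp_norm (P j) (w j) (h A j)) \<le> D * F ^ CARD('m)"
      by (simp add: mult_left_mono)
    then show ?thesis by (simp only: mult.commute)
  qed
  define J where "J x = (\<Sum>A\<in>?P. pot (h A) x)" for x
  have [measurable]: "J \<in> borel_measurable lebesgue" unfolding J_def[abs_def] by measurable
  have "AE x in lebesgue. ennreal (norm (T g x - kernel_integral K f x)) \<le> ennreal CK * J x"
    using pot_finite[OF f] pot_finite[OF g(1)] T_eq[OF g(2)]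
  proof eventually_elim
    fix x assume pf: "pot f x < top" and pg: "pot g x < top" and eq: "T g x = kernel_integral K g x"
    have intg: "integrable lebesgue (\<lambda>y. ?k g x y)"
      by (rule kernel_integrable[OF _ pg]) measurable
    have intf: "integrable lebesgue (\<lambda>y. ?k f x y)"
      by (rule kernel_integrable[OF _ pf]) measurable
    have intd: "integrable lebesgue (\<lambda>y. ?k g x y - ?k f x y)"
      by (rule Bochner_Integration.integrable_diff[OF intg intf])
    have "T g x - kernel_integral K f x = (LINT y|lebesgue. ?k g x y - ?k f x y)"
      unfolding eq kernel_integral_def by (rule Bochner_Integration.integral_diff[OF intg intf, symmetric])
    then have "ennreal (norm (T g x - kernel_integral K f x))
       \<le> (\<integral>\<^sup>+y. ennreal (norm (?k g x y - ?k f x y)) \<partial>lebesgue)"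
      using integral_norm_bound_ennreal[OF intd] by simp
    also have "\<dots> \<le> (\<integral>\<^sup>+y. (\<Sum>A\<in>?P. ennreal (norm (K x y)) * (\<Prod>i\<in>UNIV. ennreal (norm (h A i (y $ i))))) \<partial>lebesgue)"
    proof (rule nn_integral_mono)
      fix y :: "real^'n^'m"
      have "ennreal (norm (?k g x y - ?k f x y))
         = ennreal (norm (K x y)) * ennreal (norm ((\<Prod>j\<in>UNIV. f j (y $ j) + (g j (y $ j) - f j (y $ j))) - (\<Prod>j\<in>UNIV. f j (y $ j))))"
        by (simp add: norm_mult ennreal_mult flip: right_diff_distrib)
      also have "\<dots> \<le> ennreal (norm (K x y)) * (\<Sum>A\<in>?P. \<Prod>i\<in>UNIV. ennreal (norm (if i \<in> A then g i (y $ i) - f i (y $ i) else f i (y $ i))))"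
        by (intro mult_left_mono norm_prod_diff_expansion) simp
      finally show "ennreal (norm (?k g x y - ?k f x y))
         \<le> (\<Sum>A\<in>?P. ennreal (norm (K x y)) * (\<Prod>i\<in>UNIV. ennreal (norm (h A i (y $ i)))))"
        by (simp add: h_def sum_distrib_left)
    qed
    also have "\<dots> = (\<Sum>A\<in>?P. (\<integral>\<^sup>+y. ennreal (norm (K x y)) * (\<Prod>i\<in>UNIV. ennreal (norm (h A i (y $ i)))) \<partial>lebesgue))"
    proof (rule nn_integral_sum)
      fix A
      have "(\<lambda>y :: real^'n^'m. ennreal (norm (h A i (y $ i)))) \<in> borel_measurable lebesgue" for i
        using measurable_compose[OF vec_nth_lebesgue_measurable h_meas[of A i]] by measurable
      then show "(\<lambda>y. ennreal (norm (K x y)) * (\<Prod>i\<in>UNIV. ennreal (norm (h A i (y $ i))))) \<in> borel_measurable lebesgue"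
        using K_meas[of x] by (intro borel_measurable_times_ennreal borel_measurable_prod_ennreal) measurable
    qed
    also have "\<dots> \<le> (\<Sum>A\<in>?P. ennreal CK * pot (h A) x)"
      by (intro sum_mono K_bound) measurable
    finally show "ennreal (norm (T g x - kernel_integral K f x)) \<le> ennreal CK * J x"
      by (simp add: J_def sum_distrib_left)
  qed
  then have "Lp_norm q v (\<lambda>x. T g x - kernel_integral K f x) \<le> ennreal CK * epow (\<integral>\<^sup>+x. epow (J x) q * ennreal (v x) \<partial>lebesgue) (1 / q)"
    using CK q v_nonneg by (intro Lp_norm_dominated) auto
  also have "(\<integral>\<^sup>+x. epow (J x) q * ennreal (v x) \<partial>lebesgue)
     \<le> (\<integral>\<^sup>+x. (\<Sum>A\<in>?P. ennreal (N powr q) * (epow (pot (h A) x) q * ennreal (v x))) \<partial>lebesgue)"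
  proof (rule nn_integral_mono)
    fix x
    have "epow (J x) q \<le> ennreal (N powr q) * (\<Sum>A\<in>?P. epow (pot (h A) x) q)"
      unfolding J_def N_def using q by (intro epow_sum_le) auto
    then have "epow (J x) q * ennreal (v x) \<le> ennreal (N powr q) * (\<Sum>A\<in>?P. epow (pot (h A) x) q) * ennreal (v x)"
      by (rule mult_right_mono) simp
    then show "epow (J x) q * ennreal (v x) \<le> (\<Sum>A\<in>?P. ennreal (N powr q) * (epow (pot (h A) x) q * ennreal (v x)))"
      by (simp add: sum_distrib_left sum_distrib_right mult.assoc)
  qed
  also have "\<dots> = (\<Sum>A\<in>?P. ennreal (N powr q) * (\<integral>\<^sup>+x. epow (pot (h A) x) q * ennreal (v x) \<partial>lebesgue))"
    by (subst nn_integral_sum) (auto simp: nn_integral_cmult)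
  also have "\<dots> \<le> (\<Sum>A\<in>?P. ennreal (N powr q) * (ennreal C * epow (F ^ CARD('m) * D) q))"
  proof (intro sum_mono mult_left_mono)
    fix A assume A: "A \<in> ?P"
    have "(\<integral>\<^sup>+x. epow (pot (h A) x) q * ennreal (v x) \<partial>lebesgue) \<le> ennreal C * epow (\<Prod>j\<in>UNIV. Lp_norm (P j) (w j) (h A j)) q"
      by (rule potential[OF h_Lp])
    also have "\<dots> \<le> ennreal C * epow (F ^ CARD('m) * D) q"
      using q h_prod[OF A] by (intro mult_left_mono epow_mono) auto
    finally show "(\<integral>\<^sup>+x. epow (pot (h A) x) q * ennreal (v x) \<partial>lebesgue) \<le> ennreal C * epow (F ^ CARD('m) * D) q" .
  qed simp
  also have "\<dots> = ennreal N * (ennreal (N powr q) * (ennreal C * epow (F ^ CARD('m) * D) q))"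
    by (simp only: sum_constant N_def ennreal_of_nat_eq_real_of_nat)
  also have "\<dots> = ennreal (N powr q * C * N) * epow (F ^ CARD('m) * D) q"
    using C by (simp add: N_def ennreal_mult mult_ac)
  finally have "Lp_norm q v (\<lambda>x. T g x - kernel_integral K f x)
     \<le> ennreal CK * epow (ennreal (N powr q * C * N) * epow (F ^ CARD('m) * D) q) (1 / q)"
    using q by (simp add: epow_mono mult_left_mono)
  also have "\<dots> = ennreal (CK * (N powr q * C * N) powr (1 / q)) * F ^ CARD('m) * D"
  proof -
    have "0 \<le> N powr q * C * N" using C by (simp add: N_def)
    then show ?thesis using q CK by (simp add: epow_mult epow_epow epow_ennreal ennreal_mult mult.assoc)
  qed
  finally show ?thesis by (simp add: N_def diff_const_def)
qed

lemma kernel_integral_extends: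
  "continuous_extension P w (Lp_norm q v) T (kernel_integral K)"
  unfolding continuous_extension_def
proof (intro allI impI conjI)
  fix f assume f: "\<forall>j. f j \<in> Lp_space (P j) (w j)"
  then show "kernel_integral K f \<in> borel_measurable lebesgue" by (intro kernel_integral_measurable) auto
  fix g assume g: "(\<forall>k::nat. \<forall>j. g k j \<in> bounded_compact_supp \<inter> Lp_space (P j) (w j)) \<and>
     (\<forall>j. (\<lambda>k. Lp_norm (P j) (w j) (\<lambda>x. g k j x - f j x)) \<longlonglongrightarrow> 0)"
  define D where "D k = (\<Sum>j\<in>UNIV. Lp_norm (P j) (w j) (\<lambda>x. g k j x - f j x))" for k
  define F where "F = 1 + (\<Sum>j\<in>UNIV. Lp_norm (P j) (w j) (f j))"
  define c where "c = ennreal diff_const * F ^ CARD('m)"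
  have "F < top" unfolding F_def using f by (simp add: Lp_space_def less_top)
  then have c: "c < top" by (simp add: c_def ennreal_mult_less_top power_less_top_ennreal)
  have D0: "D \<longlonglongrightarrow> (\<Sum>j\<in>(UNIV :: 'm set). 0)"
    unfolding D_def using g by (intro tendsto_sum) auto
  then have "(\<lambda>k. c * D k) \<longlonglongrightarrow> c * 0" using c by (intro ennreal_tendsto_cmult) auto
  then have up: "(\<lambda>k. c * D k) \<longlonglongrightarrow> 0" by simp
  have "\<forall>\<^sub>F k in sequentially. D k < 1" using D0 by (intro order_tendstoD(2)) auto
  then have "\<forall>\<^sub>F k in sequentially. Lp_norm q v (\<lambda>x. T (g k) x - kernel_integral K f x) \<le> c * D k"
    by eventually_elim (unfold c_def, rule difference_bound, use f g D_def F_def in auto)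
  then show "(\<lambda>k. Lp_norm q v (\<lambda>x. T (g k) x - kernel_integral K f x)) \<longlonglongrightarrow> 0"
    by (intro tendsto_sandwich[OF _ _ tendsto_const up]) auto
qed

end

lemma continuous_extension_weak:
  assumes "continuous_extension P w (Lp_norm q v) T S" "0 < q" "\<And>x. 0 \<le> v x"
    and [measurable]: "v \<in> borel_measurable lebesgue"
    and T: "\<And>f. (\<And>j. f j \<in> bounded_compact_supp) \<Longrightarrow> T f \<in> borel_measurable lebesgue"
  shows "continuous_extension P w (weak_Lp_norm q v) T S"
  unfolding continuous_extension_def
proof (intro allI impI conjI)
  fix f assume f: "\<forall>j. f j \<in> Lp_space (P j) (w j)"
  then show S [measurable]: "S f \<in> borel_measurable lebesgue" using assms(1) by (simp add: continuous_extension_def)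
  fix g assume g: "(\<forall>k::nat. \<forall>j. g k j \<in> bounded_compact_supp \<inter> Lp_space (P j) (w j)) \<and>
     (\<forall>j. (\<lambda>k. Lp_norm (P j) (w j) (\<lambda>x. g k j x - f j x)) \<longlonglongrightarrow> 0)"
  then have lim: "(\<lambda>k. Lp_norm q v (\<lambda>x. T (g k) x - S f x)) \<longlonglongrightarrow> 0"
    using assms(1) f unfolding continuous_extension_def by blast
  have [measurable]: "T (g k) \<in> borel_measurable lebesgue" for k using T g by blast
  have "weak_Lp_norm q v (\<lambda>x. T (g k) x - S f x) \<le> Lp_norm q v (\<lambda>x. T (g k) x - S f x)" for k
    by (rule weak_Lp_norm_le_Lp_norm[OF assms(2,3)]) measurable
  then show "(\<lambda>k. weak_Lp_norm q v (\<lambda>x. T (g k) x - S f x)) \<longlonglongrightarrow> 0"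
    by (intro tendsto_sandwich[OF _ _ tendsto_const lim]) auto
qed

section \<open>The weight class\<close>

lemma cube_measure_pos:
  fixes x :: "real^'n"
  assumes "0 < r"
  shows "emeasure lebesgue (cube x r) \<noteq> 0" "emeasure lebesgue (cube x r) \<noteq> top"
  using assms by (simp_all only: emeasure_cube less_imp_le) (simp_all)

lemma avg_const: "0 < r \<Longrightarrow> avg (cube x r) (\<lambda>_. c) = c"
  unfolding avg_def using cube_measure_pos[of r x]
  by (simp add: nn_integral_cmult_indicator mult_divide_eq_ennreal)

lemma integral_cube_eq_avg: "0 < r \<Longrightarrow> (\<integral>\<^sup>+y\<in>cube x r. g y \<partial>lebesgue) = avg (cube x r) g * emeasure lebesgue (cube x r)"
  unfolding avg_def using cube_measure_pos[of r x] by (simp add: ennreal_divide_times less_top)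

lemma cube_in_cube:
  fixes x :: "real^'n"
  shows "\<exists>z R. 0 < R \<and> cube x r \<union> cube x' r' \<subseteq> cube z R"
proof -
  have "bounded (cube x r \<union> cube x' r')" by (simp add: cube_def bounded_cbox)
  then obtain j where "cube x r \<union> cube x' r' \<subseteq> bcube j (0 :: real^'n)" using bounded_subset_bcube by blast
  then show ?thesis unfolding bcube_def by (intro exI conjI) (auto intro!: mult_pos_pos)
qed

lemma AE_lebesgue_if_AE_cubes:
  assumes "\<And>x r. 0 < r \<Longrightarrow> AE y in lebesgue. y \<in> cube x r \<longrightarrow> Q (y :: real^'n)"
  shows "AE y in lebesgue. Q y"
proof -
  have "AE y in lebesgue. \<forall>j :: nat. y \<in> bcube (int j) (0 :: real^'n) \<longrightarrow> Q y"
    unfolding AE_all_countable bcube_def by (intro allI assms) simp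
  then show ?thesis
  proof eventually_elim
    fix y :: "real^'n" assume *: "\<forall>j :: nat. y \<in> bcube (int j) (0 :: real^'n) \<longrightarrow> Q y"
    obtain j where "0 \<le> j" "{y} \<subseteq> bcube j (0 :: real^'n)" using bounded_subset_bcube[of "{y}" 0 0] by auto
    then show "Q y" using *[rule_format, of "nat j"] by simp
  qed
qed

text \<open>The supremum in the definition is that of a sequence, so the exceptional set is a countable
  union of null sets.\<close>

lemma ess_inf_on_le: "AE x in lebesgue. x \<in> Q \<longrightarrow> ess_inf_on Q w \<le> ennreal (w x)"
proof -
  define A where "A = {c. AE x in lebesgue. x \<in> Q \<longrightarrow> c \<le> ennreal (w x)}"
  have "0 \<in> A" by (simp add: A_def)
  then obtain c :: "nat \<Rightarrow> ennreal" where c: "range c \<subseteq> A" "Sup A = (SUP i. c i)"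
    using ennreal_Sup_countable_SUP[of A] by auto
  have "AE x in lebesgue. \<forall>i. x \<in> Q \<longrightarrow> c i \<le> ennreal (w x)"
    unfolding AE_all_countable using c(1) by (auto simp: A_def)
  then show ?thesis
    by eventually_elim (auto simp: ess_inf_on_def A_def[symmetric] c(2) intro: SUP_least)
qed

lemma ennreal_inverse_antimono:
  fixes a b :: ennreal
  assumes "a \<le> b" shows "inverse b \<le> inverse a"
proof -
  consider "a = 0" | "b = top" | x y where "a = ennreal x" "b = ennreal y" "0 < x" "x \<le> y"
    using assms by (cases a; cases b) (auto simp: top_unique less_le)
  then show ?thesis by cases (auto simp: inverse_ennreal intro!: ennreal_leI le_imp_inverse_le)
qed

lemma inverse_power_weight: "0 \<le> (w :: real) \<Longrightarrow> inverse (ennreal (w powr b)) = epow (inverse (ennreal w)) b"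
  by (cases "w = 0") (simp_all add: inverse_ennreal epow_ennreal powr_divide inverse_eq_divide)

text \<open>For \<open>r = 1\<close> the essential infimum controls averages of every power of the inverse
  weight, so the exponent \<open>b\<close> may be any positive number.\<close>

lemma dual_average_le_dual_factor:
  fixes w :: "real^'n \<Rightarrow> real"
  assumes rho: "0 < \<rho>" and r: "1 \<le> r" and w: "\<And>x. 0 \<le> w x"
    and b: "r \<noteq> 1 \<Longrightarrow> b = r / (r - 1)" "0 < b"
  shows "epow (avg (cube x \<rho>) (\<lambda>y. epow (inverse (ennreal (w y))) b)) (1 / b) \<le> dual_factor (cube x \<rho>) r w"
proof (cases "r = 1")
  case False
  have "(r - 1) / r = 1 / b" using b(1)[OF False] by simp
  then show ?thesis using False w b(1)[OF False] by (simp add: dual_factor_def inverse_power_weight)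
next
  case True
  let ?e = "inverse (ess_inf_on (cube x \<rho>) w)"
  have "avg (cube x \<rho>) (\<lambda>y. epow (inverse (ennreal (w y))) b) \<le> avg (cube x \<rho>) (\<lambda>_. epow ?e b)"
  proof (rule avg_mono_AE, use ess_inf_on_le[of "cube x \<rho>" w] in eventually_elim)
    fix y assume "y \<in> cube x \<rho> \<longrightarrow> ess_inf_on (cube x \<rho>) w \<le> ennreal (w y)"
    then show "y \<in> cube x \<rho> \<longrightarrow> epow (inverse (ennreal (w y))) b \<le> epow ?e b"
      using b(2) by (auto intro!: epow_mono ennreal_inverse_antimono)
  qed
  then have "epow (avg (cube x \<rho>) (\<lambda>y. epow (inverse (ennreal (w y))) b)) (1 / b) \<le> epow (epow ?e b) (1 / b)"
    using b(2) rho by (intro epow_mono) (auto simp: avg_const)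
  then show ?thesis using b(2) True by (simp add: epow_epow dual_factor_def)
qed

text \<open>The exponent conditions and the weight class, separated from the operator.\<close>

locale admissible_weights =
  fixes \<omega> :: "'m::finite \<Rightarrow> real^'n \<Rightarrow> real" and P :: "'m \<Rightarrow> real" and p0' p q \<alpha> :: real
  assumes p0': "1 < p0'" and P: "\<And>j. p0' \<le> P j"
    and p_sum: "1 / p = (\<Sum>j\<in>UNIV. 1 / P j)" and \<alpha>: "0 < \<alpha>"
    and q_def: "1 / q = 1 / p - \<alpha> / real CARD('n)" and q_pos: "0 < 1 / q"
    and in_class: "\<omega> \<in> weight_class (\<lambda>j. P j / p0') (q / p0')"
begin

text \<open>The exponent of \<open>1/\<omega>\<^sub>j\<close> in the dual averages. For \<open>P j =
  p0'\<close> it may be chosen freely, and \<open>2 / (p0' - 1)\<close> makes \<open>\<rho> j = b j *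
  p0'\<close> twice the conjugate exponent of \<open>P j\<close>; for \<open>P j > p0'\<close> it is the
  conjugate exponent of \<open>P j / p0'\<close>.\<close>

definition b :: "'m \<Rightarrow> real" where
  "b j = (if P j = p0' then 2 / (p0' - 1) else P j / (P j - p0'))"

definition V :: "real^'n \<Rightarrow> ennreal" where "V x = ennreal (v_weight \<omega> x powr (q / p0'))"
definition \<sigma> :: "'m \<Rightarrow> real^'n \<Rightarrow> ennreal" where "\<sigma> j x = epow (inverse (ennreal (\<omega> j x))) (b j)"
definition \<rho> :: "'m \<Rightarrow> real" where "\<rho> j = b j * p0'"
definition a :: "'m \<Rightarrow> real" where "a j = \<rho> j / (\<rho> j - 1)"

lemma q0: "0 < q" using q_pos by simp
lemma P0: "0 < P j" using p0' P[of j] by simp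

lemma \<omega>_meas [measurable]: "\<omega> j \<in> borel_measurable lebesgue" and \<omega>_nonneg: "0 \<le> \<omega> j x"
  using in_class by (auto simp: weight_class_def)

lemma v_meas [measurable]: "v_weight \<omega> \<in> borel_measurable lebesgue"
  unfolding v_weight_def[abs_def] by measurable

lemma v_nonneg: "0 \<le> v_weight \<omega> x"
  unfolding v_weight_def by (intro prod_nonneg) (simp add: \<omega>_nonneg)

lemma V_meas [measurable]: "V \<in> borel_measurable lebesgue"
  unfolding V_def[abs_def] by measurable

lemma \<sigma>_meas [measurable]: "\<sigma> j \<in> borel_measurable lebesgue"
  unfolding \<sigma>_def[abs_def] by measurable

lemma b_pos: "0 < b j"
  using p0' P[of j] P0[of j] by (auto simp: b_def)

text \<open>In other words \<open>\<rho> j\<close> exceeds the conjugate exponent of \<open>P j\<close>;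
  this is the gain from \<open>p0' > 1\<close>.\<close>

lemma inverse_\<rho>: "0 < 1 / \<rho> j" "1 / \<rho> j < 1 - 1 / P j"
proof -
  show "0 < 1 / \<rho> j" using b_pos p0' by (simp add: \<rho>_def)
  show "1 / \<rho> j < 1 - 1 / P j"
  proof (cases "P j = p0'")
    case True
    then have "1 / \<rho> j = (1 - 1 / p0') / 2" using p0' by (simp add: \<rho>_def b_def field_simps)
    moreover have "0 < 1 - 1 / p0'" using p0' by simp
    ultimately show ?thesis using True by simp
  next
    case False
    then have "1 / \<rho> j = 1 / p0' - 1 / P j" using p0' P0[of j] by (simp add: \<rho>_def b_def field_simps)
    moreover have "1 / p0' < 1" using p0' by simp
    ultimately show ?thesis by simp
  qed
qed

lemma \<rho>_gt1: "1 < \<rho> j"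
proof -
  have "1 / \<rho> j < 1" using inverse_\<rho>(2)[of j] P0[of j] by (smt (verit) divide_pos_pos)
  then show ?thesis using inverse_\<rho>(1)[of j] by simp
qed

lemma a_facts: "0 < a j" "1 / a j + 1 / \<rho> j = 1" "a j < P j"
proof -
  have r: "1 < \<rho> j" by (rule \<rho>_gt1)
  show a0: "0 < a j" using r by (simp add: a_def)
  show sum: "1 / a j + 1 / \<rho> j = 1" using r by (simp add: a_def field_simps)
  have "1 / P j < 1 / a j" using sum inverse_\<rho>(2)[of j] by linarith
  then show "a j < P j" using a0 P0[of j] by (simp add: field_simps)
qed

lemma weight_condition_dual:
  obtains K where "0 < K" "\<And>x r. 0 < r \<Longrightarrow>
    epow (avg (cube x r) V) (p0' / q) * (\<Prod>j\<in>UNIV. dual_factor (cube x r) (P j / p0') (\<omega> j)) \<le> ennreal K"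
proof -
  define X where "X = (SUP (x, \<rho>) \<in> UNIV \<times> {0<..}.
        epow (avg (cube x \<rho>) (\<lambda>y. ennreal (v_weight \<omega> y powr (q / p0')))) (1 / (q / p0')) *
        (\<Prod>j\<in>UNIV. dual_factor (cube x \<rho>) (P j / p0') (\<omega> j)))"
  have "X < top" using in_class by (simp add: weight_class_def X_def)
  then obtain K where K: "X = ennreal K" "0 \<le> K" by (cases X) auto
  have le: "epow (avg (cube x r) V) (p0' / q) * (\<Prod>j\<in>UNIV. dual_factor (cube x r) (P j / p0') (\<omega> j)) \<le> ennreal (K + 1)"
    if "0 < r" for x r
  proof -
    have "(\<lambda>(x, \<rho>). epow (avg (cube x \<rho>) (\<lambda>y. ennreal (v_weight \<omega> y powr (q / p0')))) (1 / (q / p0')) *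
        (\<Prod>j\<in>UNIV. dual_factor (cube x \<rho>) (P j / p0') (\<omega> j))) (x, r) \<le> X"
      unfolding X_def by (rule SUP_upper) (use that in auto)
    then have "epow (avg (cube x r) V) (p0' / q) * (\<Prod>j\<in>UNIV. dual_factor (cube x r) (P j / p0') (\<omega> j)) \<le> X"
      by (simp add: V_def[abs_def])
    also have "X \<le> ennreal (K + 1)" unfolding K(1) by (rule ennreal_leI) simp
    finally show ?thesis .
  qed
  show thesis by (rule that[of "K + 1"]) (use K le in auto)
qed

lemma avg_\<sigma>_le_dual: "0 < r \<Longrightarrow> epow (avg (cube x r) (\<sigma> j)) (1 / b j) \<le> dual_factor (cube x r) (P j / p0') (\<omega> j)"
  unfolding \<sigma>_def[abs_def]
proof (rule dual_average_le_dual_factor)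
  show "1 \<le> P j / p0'" using P p0' by simp
  assume "P j / p0' \<noteq> 1"
  then show "b j = P j / p0' / (P j / p0' - 1)" using p0' by (auto simp: b_def field_simps)
qed (use b_pos \<omega>_nonneg in auto)

lemma \<sigma>_nonzero: "\<sigma> j x \<noteq> 0"
  by (simp add: \<sigma>_def)

lemma avg_\<sigma>_nonzero: assumes "0 < r" shows "avg (cube x r) (\<sigma> j) \<noteq> 0"
proof
  assume "avg (cube x r) (\<sigma> j) = 0"
  then have "(\<integral>\<^sup>+y\<in>cube x r. \<sigma> j y \<partial>lebesgue) = 0" by (simp add: integral_cube_eq_avg[OF assms])
  then have "AE y in lebesgue. \<sigma> j y * indicator (cube x r) y = 0" by (subst (asm) nn_integral_0_iff_AE) auto
  then have "AE y in lebesgue. y \<notin> cube x r" by eventually_elim (auto simp: \<sigma>_nonzero)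
  then have "emeasure lebesgue (cube x r) = 0" by (subst (asm) AE_iff_measurable[of "cube x r"]) auto
  then show False using cube_measure_pos[OF assms] by blast
qed

text \<open>The power \<open>1 / p0'\<close> of the condition that defines the class.\<close>

lemma weight_condition:
  obtains K where "0 < K" "\<And>x r. 0 < r \<Longrightarrow>
    epow (avg (cube x r) V) (1 / q) * (\<Prod>j\<in>UNIV. epow (avg (cube x r) (\<sigma> j)) (1 / \<rho> j)) \<le> ennreal K"
proof -
  obtain K where K: "0 < K" "\<And>x r. 0 < r \<Longrightarrow>
    epow (avg (cube x r) V) (p0' / q) * (\<Prod>j\<in>UNIV. dual_factor (cube x r) (P j / p0') (\<omega> j)) \<le> ennreal K"
    by (rule weight_condition_dual) blast
  show thesis
  proof (rule that)
    show "0 < K powr (1 / p0')" using K by simp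
    fix x :: "real^'n" and r :: real assume r: "0 < r"
    have "epow (avg (cube x r) V) (p0' / q) * (\<Prod>j\<in>UNIV. epow (avg (cube x r) (\<sigma> j)) (1 / b j)) \<le> ennreal K"
      using mult_left_mono[OF prod_mono_ennreal[of UNIV "\<lambda>j. epow (avg (cube x r) (\<sigma> j)) (1 / b j)" "\<lambda>j. dual_factor (cube x r) (P j / p0') (\<omega> j)", OF avg_\<sigma>_le_dual[OF r]]]
        K(2)[OF r] by (meson order_trans zero_le)
    then have "epow (epow (avg (cube x r) V) (p0' / q) * (\<Prod>j\<in>UNIV. epow (avg (cube x r) (\<sigma> j)) (1 / b j))) (1 / p0') \<le> epow (ennreal K) (1 / p0')"
      using p0' by (intro epow_mono) auto
    then show "epow (avg (cube x r) V) (1 / q) * (\<Prod>j\<in>UNIV. epow (avg (cube x r) (\<sigma> j)) (1 / \<rho> j)) \<le> ennreal (K powr (1 / p0'))"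
      using p0' K(1) by (simp add: epow_mult epow_prod epow_epow epow_ennreal \<rho>_def)
  qed
qed

text \<open>Dual averages never vanish, as the weights are finite. If \<open>V\<close> has mass on some
  cube, then on every larger cube all factors in the weight condition are nonzero. So all of them are finite
  there, and a finite integral of \<open>\<sigma> j\<close> forces \<open>\<omega> j > 0\<close> almost
  everywhere. The convention \<open>0 * \<infinity> = 0\<close> admits the first alternative.\<close>

lemma degenerate_or_positive:
  obtains "AE x in lebesgue. v_weight \<omega> x = 0"
  | "\<And>j. AE x in lebesgue. 0 < \<omega> j x"
    "\<And>x r. 0 < r \<Longrightarrow> 0 < (\<integral>\<^sup>+y\<in>cube x r. V y \<partial>lebesgue)"
    "\<And>x r. 0 < r \<Longrightarrow> (\<integral>\<^sup>+y\<in>cube x r. V y \<partial>lebesgue) < top"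
proof (cases "\<forall>x r. 0 < r \<longrightarrow> (\<integral>\<^sup>+y\<in>cube x r. V y \<partial>lebesgue) = 0")
  case True
  have "AE y in lebesgue. y \<in> cube x r \<longrightarrow> v_weight \<omega> y = 0" if "0 < r" for x r
  proof -
    have "(\<integral>\<^sup>+y. V y * indicator (cube x r) y \<partial>lebesgue) = 0" using True that by blast
    then have "AE y in lebesgue. V y * indicator (cube x r) y = 0" by (subst (asm) nn_integral_0_iff_AE) auto
    then show ?thesis
      by eventually_elim (use v_nonneg in \<open>auto simp: V_def split: if_splits simp: indicator_def\<close>)
  qed
  then have "AE x in lebesgue. v_weight \<omega> x = 0" by (rule AE_lebesgue_if_AE_cubes)
  then show thesis by (rule that(1))
next
  case False
  then obtain x0 r0 where r0: "0 < r0" and V0: "(\<integral>\<^sup>+y\<in>cube x0 r0. V y \<partial>lebesgue) \<noteq> 0" by blast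
  obtain K where K: "0 < K" "\<And>x r. 0 < r \<Longrightarrow>
    epow (avg (cube x r) V) (1 / q) * (\<Prod>j\<in>UNIV. epow (avg (cube x r) (\<sigma> j)) (1 / \<rho> j)) \<le> ennreal K"
    by (rule weight_condition) blast
  have big: "(\<integral>\<^sup>+y\<in>cube z R. V y \<partial>lebesgue) < top \<and> (\<forall>j. (\<integral>\<^sup>+y\<in>cube z R. \<sigma> j y \<partial>lebesgue) < top)"
    if R: "0 < R" and sub: "cube x0 r0 \<subseteq> cube z R" for z R
  proof -
    have "(\<integral>\<^sup>+y\<in>cube x0 r0. V y \<partial>lebesgue) \<le> (\<integral>\<^sup>+y\<in>cube z R. V y \<partial>lebesgue)"
      using sub by (intro nn_integral_mono) (auto simp: indicator_def)
    then have "(\<integral>\<^sup>+y\<in>cube z R. V y \<partial>lebesgue) \<noteq> 0" using V0 by auto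
    then have V1: "avg (cube z R) V \<noteq> 0" by (simp add: integral_cube_eq_avg[OF R])
    have fin: "epow (avg (cube z R) V) (1 / q) * (\<Prod>j\<in>UNIV. epow (avg (cube z R) (\<sigma> j)) (1 / \<rho> j)) \<noteq> top"
      using K(2)[OF R, of z] by (auto simp: top_unique)
    have s0: "(\<Prod>j\<in>UNIV. epow (avg (cube z R) (\<sigma> j)) (1 / \<rho> j)) \<noteq> 0"
      using avg_\<sigma>_nonzero[OF R] by simp
    have "avg (cube z R) V \<noteq> top" "(\<Prod>j\<in>UNIV. epow (avg (cube z R) (\<sigma> j)) (1 / \<rho> j)) \<noteq> top"
      using fin V1 s0 by (auto simp: ennreal_mult_eq_top_iff)
    moreover from this have "avg (cube z R) (\<sigma> j) \<noteq> top" for j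
      using avg_\<sigma>_nonzero[OF R] by (auto simp: ennreal_prod_eq_top)
    ultimately show ?thesis
      using cube_measure_pos[OF R, of z] by (simp add: integral_cube_eq_avg[OF R] ennreal_mult_eq_top_iff less_top[symmetric])
  qed
  have pos_on: "AE y in lebesgue. y \<in> cube x r \<longrightarrow> 0 < \<omega> j y" for x r j
  proof -
    obtain z R where R: "0 < R" "cube x r \<union> cube x0 r0 \<subseteq> cube z R" using cube_in_cube by blast
    then have "(\<integral>\<^sup>+y\<in>cube z R. \<sigma> j y \<partial>lebesgue) < top" using big[of R z] by auto
    then have "AE y in lebesgue. \<sigma> j y * indicator (cube z R) y \<noteq> \<infinity>"
      by (intro nn_integral_noteq_infinite) (auto simp: less_top)
    then show ?thesis
    proof eventually_elim
      fix y assume *: "\<sigma> j y * indicator (cube z R) y \<noteq> \<infinity>"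
      show "y \<in> cube x r \<longrightarrow> 0 < \<omega> j y"
      proof
        assume "y \<in> cube x r"
        then have "\<sigma> j y \<noteq> top" using * R(2) by (auto simp: indicator_def split: if_splits)
        then have "\<omega> j y \<noteq> 0" by (auto simp: \<sigma>_def)
        then show "0 < \<omega> j y" using \<omega>_nonneg[of j y] by simp
      qed
    qed
  qed
  have pos: "AE y in lebesgue. 0 < \<omega> j y" for j
    by (rule AE_lebesgue_if_AE_cubes) (rule pos_on)
  show thesis
  proof (rule that(2)[OF pos])
    fix x :: "real^'n" and r :: real assume r: "0 < r"
    obtain z R where R: "0 < R" "cube x r \<union> cube x0 r0 \<subseteq> cube z R" using cube_in_cube by blast
    have "(\<integral>\<^sup>+y\<in>cube x r. V y \<partial>lebesgue) \<le> (\<integral>\<^sup>+y\<in>cube z R. V y \<partial>lebesgue)"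
      using R by (intro nn_integral_mono) (auto simp: indicator_def)
    also have "\<dots> < top" using big[of R z] R by auto
    finally show "(\<integral>\<^sup>+y\<in>cube x r. V y \<partial>lebesgue) < top" .
    show "0 < (\<integral>\<^sup>+y\<in>cube x r. V y \<partial>lebesgue)"
    proof (rule ccontr)
      assume "\<not> 0 < (\<integral>\<^sup>+y\<in>cube x r. V y \<partial>lebesgue)"
      then have "(\<integral>\<^sup>+y. V y * indicator (cube x r) y \<partial>lebesgue) = 0" by (simp add: zero_less_iff_neq_zero)
      then have "AE y in lebesgue. V y * indicator (cube x r) y = 0" by (subst (asm) nn_integral_0_iff_AE) auto
      moreover have "AE y in lebesgue. \<forall>j. 0 < \<omega> j y" unfolding AE_all_countable using pos by blast
      ultimately have "AE y in lebesgue. y \<notin> cube x r"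
      proof eventually_elim
        fix y assume 1: "V y * indicator (cube x r) y = 0" and 2: "\<forall>j. 0 < \<omega> j y"
        have "0 < v_weight \<omega> y" unfolding v_weight_def using 2 by (intro prod_pos) auto
        then have "V y \<noteq> 0" by (simp add: V_def)
        then show "y \<notin> cube x r" using 1 by (auto simp: indicator_def split: if_splits)
      qed
      then have "emeasure lebesgue (cube x r) = 0" by (subst (asm) AE_iff_measurable[of "cube x r"]) auto
      then show False using cube_measure_pos[OF r] by blast
    qed
  qed
qed

text \<open>The choice \<open>h j = (|f j| \<omega>\<^sub>j\<^bsup>1/p0'\<^esup>)\<^bsup>a j\<^esup>\<close>
  turns the powers of the \<open>h j\<close> into the weighted norms of the \<open>f j\<close>.\<close>

lemma weighted_potential_bound:
  assumes pos: "\<And>j. AE x in lebesgue. 0 < \<omega> j x"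
    and Vc: "\<And>x r. 0 < r \<Longrightarrow> 0 < (\<integral>\<^sup>+y\<in>cube x r. V y \<partial>lebesgue)"
    "\<And>x r. 0 < r \<Longrightarrow> (\<integral>\<^sup>+y\<in>cube x r. V y \<partial>lebesgue) < top"
  shows "\<exists>C>0. \<forall>f. (\<forall>j. f j \<in> Lp_space (P j) (\<lambda>x. \<omega> j x powr (P j / p0'))) \<longrightarrow>
      (\<integral>\<^sup>+x. epow (dyadic_potential \<alpha> (\<lambda>i y. ennreal (norm (f i y))) x) q * ennreal (v_weight \<omega> x powr (q / p0')) \<partial>lebesgue)
        \<le> ennreal C * epow (\<Prod>j\<in>UNIV. Lp_norm (P j) (\<lambda>x. \<omega> j x powr (P j / p0')) (f j)) q"
proof -
  obtain K where K: "0 < K" "\<And>x r. 0 < r \<Longrightarrow>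
    epow (avg (cube x r) V) (1 / q) * (\<Prod>j\<in>UNIV. epow (avg (cube x r) (\<sigma> j)) (1 / \<rho> j)) \<le> ennreal K"
    by (rule weight_condition) blast
  have all_pos: "AE y in lebesgue. \<forall>j. 0 < \<omega> j y" unfolding AE_all_countable using pos by blast
  have root: "epow (\<sigma> j y) (1 / \<rho> j) = ennreal (1 / \<omega> j y powr (1 / p0'))" if "0 < \<omega> j y" for j y
  proof -
    have "epow (\<sigma> j y) (1 / \<rho> j) = epow (inverse (ennreal (\<omega> j y))) (1 / p0')"
      using b_pos[of j] by (simp add: \<sigma>_def \<rho>_def epow_epow)
    also have "\<dots> = inverse (ennreal (\<omega> j y powr (1 / p0')))"
      by (rule inverse_power_weight[symmetric, OF \<omega>_nonneg])
    finally show ?thesis using that by (simp add: inverse_ennreal inverse_eq_divide)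
  qed
  have p_pos: "0 < p"
  proof -
    have "0 < (\<Sum>j\<in>(UNIV :: 'm set). 1 / P j)" using P0 by (intro sum_pos) auto
    then show ?thesis using p_sum by (metis zero_less_divide_1_iff)
  qed
  interpret fw: frac_weights V \<sigma> P a \<rho> \<alpha> p q K
  proof unfold_locales
    show "0 < \<rho> i" for i using \<rho>_gt1[of i] by simp
    show "AE x in lebesgue. 1 \<le> epow (V x) (1 / q) * (\<Prod>i\<in>UNIV. epow (\<sigma> i x) (1 / \<rho> i))"
      using all_pos
    proof eventually_elim
      fix x assume x: "\<forall>j. 0 < \<omega> j x"
      have "epow (V x) (1 / q) = ennreal (v_weight \<omega> x powr (1 / p0'))"
        using q0 by (simp add: V_def epow_ennreal powr_powr)
      also have "v_weight \<omega> x powr (1 / p0') = (\<Prod>j\<in>UNIV. \<omega> j x powr (1 / p0'))"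
        unfolding v_weight_def by (simp add: prod_powr_distrib \<omega>_nonneg)
      also have "ennreal \<dots> = (\<Prod>j\<in>UNIV. ennreal (\<omega> j x powr (1 / p0')))"
        by (rule prod_ennreal[symmetric]) simp
      finally have "epow (V x) (1 / q) * (\<Prod>i\<in>UNIV. epow (\<sigma> i x) (1 / \<rho> i))
         = (\<Prod>j\<in>UNIV. ennreal (\<omega> j x powr (1 / p0')) * ennreal (1 / \<omega> j x powr (1 / p0')))"
        using x by (simp add: root prod.distrib)
      also have "\<dots> = (\<Prod>j\<in>(UNIV :: 'm set). 1)"
        by (intro prod.cong refl) (use x in \<open>simp flip: ennreal_mult add: order_less_imp_not_eq2\<close>)
      finally show "1 \<le> epow (V x) (1 / q) * (\<Prod>i\<in>UNIV. epow (\<sigma> i x) (1 / \<rho> i))" by simp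
    qed
  qed (use a_facts \<alpha> p_pos q0 K p_sum q_def Vc in auto)
  obtain C where C: "0 < C" and bound: "\<And>\<phi> h. (\<forall>i. \<phi> i \<in> borel_measurable lebesgue) \<Longrightarrow> (\<forall>i. h i \<in> borel_measurable lebesgue) \<Longrightarrow>
     (\<forall>i. AE x in lebesgue. \<phi> i x \<le> epow (h i x) (1 / a i) * epow (\<sigma> i x) (1 / \<rho> i)) \<Longrightarrow>
     (\<forall>i. (\<integral>\<^sup>+x. epow (h i x) (P i / a i) \<partial>lebesgue) < top) \<Longrightarrow>
     (\<integral>\<^sup>+x. epow (dyadic_potential \<alpha> \<phi> x) q * V x \<partial>lebesgue)
       \<le> ennreal C * epow (\<Prod>i\<in>UNIV. epow (\<integral>\<^sup>+x. epow (h i x) (P i / a i) \<partial>lebesgue) (1 / P i)) q"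
    using fw.dyadic_potential_bound by blast
  show ?thesis
  proof (intro exI[of _ C] conjI allI impI C)
    fix f assume f: "\<forall>j. f j \<in> Lp_space (P j) (\<lambda>x. \<omega> j x powr (P j / p0'))"
    have [measurable]: "f j \<in> borel_measurable lebesgue" for j using f by (simp add: Lp_space_def)
    define h where "h j x = ennreal ((norm (f j x) * \<omega> j x powr (1 / p0')) powr a j)" for j x
    have [measurable]: "h j \<in> borel_measurable lebesgue" for j unfolding h_def[abs_def] by measurable
    have hP: "epow (h j x) (P j / a j) = ennreal (norm (f j x) powr P j * \<omega> j x powr (P j / p0'))" for j x
      using a_facts(1)[of j] by (simp add: h_def epow_ennreal powr_powr powr_mult)
    have norm_eq: "epow (\<integral>\<^sup>+x. epow (h j x) (P j / a j) \<partial>lebesgue) (1 / P j) = Lp_norm (P j) (\<lambda>x. \<omega> j x powr (P j / p0')) (f j)" for j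
      by (simp only: hP Lp_norm_def)
    have fin: "(\<integral>\<^sup>+x. epow (h j x) (P j / a j) \<partial>lebesgue) < top" for j
    proof -
      have "epow (\<integral>\<^sup>+x. epow (h j x) (P j / a j) \<partial>lebesgue) (1 / P j) < top"
        unfolding norm_eq using f by (simp add: Lp_space_def)
      then show ?thesis by (simp only: epow_less_top_iff)
    qed
    have dom: "AE x in lebesgue. ennreal (norm (f j x)) \<le> epow (h j x) (1 / a j) * epow (\<sigma> j x) (1 / \<rho> j)" for j
      using pos[of j]
    proof eventually_elim
      fix x assume x: "0 < \<omega> j x"
      have "epow (h j x) (1 / a j) = ennreal (norm (f j x) * \<omega> j x powr (1 / p0'))"
        using a_facts(1)[of j] by (simp add: h_def epow_ennreal powr_powr)
      then show "ennreal (norm (f j x)) \<le> epow (h j x) (1 / a j) * epow (\<sigma> j x) (1 / \<rho> j)"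
        using x by (simp add: root flip: ennreal_mult)
    qed
    have "(\<integral>\<^sup>+x. epow (dyadic_potential \<alpha> (\<lambda>i y. ennreal (norm (f i y))) x) q * V x \<partial>lebesgue)
      \<le> ennreal C * epow (\<Prod>i\<in>UNIV. epow (\<integral>\<^sup>+x. epow (h i x) (P i / a i) \<partial>lebesgue) (1 / P i)) q"
      by (rule bound) (use dom fin in auto)
    then show "(\<integral>\<^sup>+x. epow (dyadic_potential \<alpha> (\<lambda>i y. ennreal (norm (f i y))) x) q * ennreal (v_weight \<omega> x powr (q / p0')) \<partial>lebesgue)
        \<le> ennreal C * epow (\<Prod>j\<in>UNIV. Lp_norm (P j) (\<lambda>x. \<omega> j x powr (P j / p0')) (f j)) q"
      by (simp only: norm_eq V_def)
  qed
qed

end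

theorem theorem2p3:
  fixes p0 p0' \<alpha> p q :: real
    and P :: "'m::finite \<Rightarrow> real"
    and Ck :: "nat \<Rightarrow> real"
    and K :: "real^'n \<Rightarrow> real^'n^'m \<Rightarrow> complex"
    and T0 :: "('m \<Rightarrow> real^'n \<Rightarrow> complex) \<Rightarrow> (real^'n \<Rightarrow> complex) \<Rightarrow> complex"
    and T :: "('m \<Rightarrow> real^'n \<Rightarrow> complex) \<Rightarrow> real^'n \<Rightarrow> complex"
    and \<omega> :: "'m \<Rightarrow> real^'n \<Rightarrow> real"
  assumes "CARD('m) \<ge> 2"
    and "1 < p0" and "1 / p0 + 1 / p0' = 1"
    and "0 < \<alpha> * p0'" and "\<alpha> * p0' < real CARD('m) * real CARD('n)"
    and "frac_integral_operator p0 p0' \<alpha> Ck K T0 T"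
    and "summable (\<lambda>k. Ck (Suc k))"
    and "1 / p = (\<Sum>j\<in>UNIV. 1 / P j)"
    and "\<forall>j. p0' \<le> P j"
    and "1 / q = 1 / p - \<alpha> / real CARD('n)" and "1 / p - \<alpha> / real CARD('n) > 0"
    and "\<omega> \<in> weight_class (\<lambda>j. P j / p0') (q / p0')"
  shows "((\<forall>j. p0' < P j) \<longrightarrow>
           (\<exists>C>0. \<exists>S.
              continuous_extension P (\<lambda>j x. \<omega> j x powr (P j / p0'))
                (Lp_norm q (\<lambda>x. v_weight \<omega> x powr (q / p0'))) T S \<and>
              (\<forall>f. (\<forall>j. f j \<in> Lp_space (P j) (\<lambda>x. \<omega> j x powr (P j / p0'))) \<longrightarrow>
                 Lp_norm q (\<lambda>x. v_weight \<omega> x powr (q / p0')) (S f)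
                 \<le> ennreal C * (\<Prod>j\<in>UNIV. Lp_norm (P j) (\<lambda>x. \<omega> j x powr (P j / p0')) (f j)))))
       \<and> ((\<exists>j. P j = p0') \<longrightarrow>
           (\<exists>C>0. \<exists>S.
              continuous_extension P (\<lambda>j x. \<omega> j x powr (P j / p0'))
                (weak_Lp_norm q (\<lambda>x. v_weight \<omega> x powr (q / p0'))) T S \<and>
              (\<forall>f. (\<forall>j. f j \<in> Lp_space (P j) (\<lambda>x. \<omega> j x powr (P j / p0'))) \<longrightarrow>
                 weak_Lp_norm q (\<lambda>x. v_weight \<omega> x powr (q / p0')) (S f)
                 \<le> ennreal C * (\<Prod>j\<in>UNIV. Lp_norm (P j) (\<lambda>x. \<omega> j x powr (P j / p0')) (f j)))))"
proof -
  define v where "v = (\<lambda>x. v_weight \<omega> x powr (q / p0'))"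
  define w where "w = (\<lambda>j x. \<omega> j x powr (P j / p0'))"
  have p0': "1 < p0'"
  proof -
    have "1 / p0 < 1" using assms(2) by simp
    moreover have "0 < 1 / p0" using assms(2) by simp
    ultimately have "0 < 1 / p0'" "1 / p0' < 1" using assms(3) by linarith+
    then show ?thesis by simp
  qed
  have \<alpha>: "0 < \<alpha>" using assms(4) p0' by (simp add: zero_less_mult_iff)
  have \<alpha>mn: "\<alpha> < real CARD('m) * real CARD('n)"
  proof -
    have "\<alpha> * 1 < \<alpha> * p0'" using \<alpha> p0' by (intro mult_strict_left_mono) auto
    then show ?thesis using assms(5) by simp
  qed
  have q: "0 < q"
  proof -
    have "0 < 1 / q" using assms(10,11) by linarith
    then show ?thesis by simp
  qed
  interpret aw: admissible_weights \<omega> P p0' p q \<alpha>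
    by unfold_locales (use assms p0' \<alpha> q in auto)
  have K_meas: "K x \<in> borel_measurable lebesgue" for x
    using assms(6) by (simp add: frac_integral_operator_def kernel_locally_integrable_def)
  have "kernel_size \<alpha> K" using assms(6) by (simp add: frac_integral_operator_def)
  from kernel_potential_bound[OF this \<alpha>mn] obtain CK where CK: "0 < CK"
    and K_bound: "\<And>\<phi> x. (\<And>i. \<phi> i \<in> borel_measurable lebesgue) \<Longrightarrow>
      (\<integral>\<^sup>+y. ennreal (norm (K x y)) * (\<Prod>i\<in>UNIV. \<phi> i (y $ i)) \<partial>lebesgue) \<le> ennreal CK * dyadic_potential \<alpha> \<phi> x"
    by blast
  obtain s \<sigma> where s: "\<forall>j. 1 \<le> s j \<and> s j \<le> p0'" and \<sigma>: "1 / \<sigma> = (\<Sum>j\<in>UNIV. 1 / s j)"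
    and ext: "bounded_weak_extension s (\<sigma> * real CARD('n) / (real CARD('n) - \<sigma> * \<alpha>)) K T0 T"
    using assms(6) unfolding frac_integral_operator_def by blast
  define t where "t = \<sigma> * real CARD('n) / (real CARD('n) - \<sigma> * \<alpha>)"
  have s_pos: "0 < s j" for j using s by (meson less_le_trans zero_less_one)
  have \<sigma>_pos: "0 < \<sigma>"
  proof -
    have "0 < (\<Sum>j\<in>(UNIV :: 'm set). 1 / s j)" using s_pos by (intro sum_pos) auto
    then show ?thesis using \<sigma> by (metis zero_less_divide_1_iff)
  qed
  \<comment> \<open>From \<open>s j \<le> p0'\<close> one gets \<open>1 / \<sigma> \<ge> m / p0' > \<alpha>
    / n\<close>, so \<open>1 / t = 1 / \<sigma> - \<alpha> / n\<close> is positive and less than \<open>1 /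
    \<sigma>\<close>.\<close>
  have \<sigma>t: "\<sigma> < t"
  proof -
    have "real CARD('m) / p0' = (\<Sum>j\<in>(UNIV :: 'm set). 1 / p0')" by simp
    also have "\<dots> \<le> 1 / \<sigma>" unfolding \<sigma> using s s_pos p0' by (intro sum_mono divide_left_mono) auto
    finally have "real CARD('m) / p0' \<le> 1 / \<sigma>" .
    moreover have "\<alpha> < real CARD('m) / p0' * real CARD('n)" using assms(5) p0' by (simp add: field_simps)
    ultimately have "\<alpha> < 1 / \<sigma> * real CARD('n)"
      by (smt (verit) mult_right_mono of_nat_0_le_iff)
    then have pos: "0 < real CARD('n) - \<sigma> * \<alpha>" using \<sigma>_pos by (simp add: field_simps)
    have "\<sigma> * (real CARD('n) - \<sigma> * \<alpha>) < \<sigma> * real CARD('n)"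
      using \<sigma>_pos \<alpha> by (intro mult_strict_left_mono) auto
    then show ?thesis unfolding t_def using pos by (simp add: field_simps)
  qed
  obtain B where B: "0 < B" "\<And>f. (\<forall>j. f j \<in> Lp_space (s j) (\<lambda>_. 1)) \<Longrightarrow>
        weak_Lp_norm t (\<lambda>_. 1) (T f) \<le> ennreal B * (\<Prod>j\<in>UNIV. Lp_norm (s j) (\<lambda>_. 1) (f j))"
    using ext unfolding bounded_weak_extension_def t_def by blast
  interpret ko: kernel_operator K T s \<sigma> \<alpha> t B CK
  proof unfold_locales
    show "T f \<in> borel_measurable lebesgue" if "\<And>j. f j \<in> Lp_space (s j) (\<lambda>_. 1)" for f
      using ext that unfolding bounded_weak_extension_def by blast
    show "AE x in lebesgue. T (f(i := \<lambda>x. a * f i x + b * g x)) x = a * T f x + b * T (f(i := g)) x"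
      if "\<And>j. f j \<in> Lp_space (s j) (\<lambda>_. 1)" "g \<in> Lp_space (s i) (\<lambda>_. 1)" for f i g a b
      using ext that unfolding bounded_weak_extension_def by blast
    show "AE x in lebesgue. x \<notin> (\<Inter>j. supp (f j)) \<longrightarrow> T f x = kernel_integral K f x"
      if "\<And>j. f j \<in> bounded_compact_supp" for f
      using ext that unfolding bounded_weak_extension_def by blast
  qed (use K_meas \<alpha> \<alpha>mn CK K_bound s_pos \<sigma> \<sigma>_pos \<sigma>t B in auto)
  have v_meas [measurable]: "v \<in> borel_measurable lebesgue" unfolding v_def by measurable
  have v_nonneg: "0 \<le> v x" for x by (simp add: v_def)
  have T_meas: "T f \<in> borel_measurable lebesgue" if "\<And>j. f j \<in> bounded_compact_supp" for f
    using ko.T_meas ko.bcs_Lp that by blast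
  have "\<exists>C>0. \<exists>S. continuous_extension P w (Lp_norm q v) T S \<and>
      (\<forall>f. (\<forall>j. f j \<in> Lp_space (P j) (w j)) \<longrightarrow> Lp_norm q v (S f) \<le> ennreal C * (\<Prod>j\<in>UNIV. Lp_norm (P j) (w j) (f j)))"
  proof (cases rule: aw.degenerate_or_positive)
    case 1
    have zero: "Lp_norm q v g = 0" for g
    proof -
      have "AE x in lebesgue. ennreal (norm (g x) powr q * v x) = 0"
        using 1 by eventually_elim (simp add: v_def)
      then have "(\<integral>\<^sup>+x. ennreal (norm (g x) powr q * v x) \<partial>lebesgue) = (\<integral>\<^sup>+x. 0 \<partial>(lebesgue :: (real^'n) measure))"
        by (rule nn_integral_cong_AE)
      then show ?thesis by (simp add: Lp_norm_def)
    qed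
    show ?thesis
      by (rule exI[of _ 1], intro conjI exI[of _ "\<lambda>f x. 0"]) (auto simp: continuous_extension_def zero)
  next
    case 2
    obtain C where C: "0 < C" and bound: "\<And>f. (\<And>j. f j \<in> Lp_space (P j) (\<lambda>x. \<omega> j x powr (P j / p0'))) \<Longrightarrow>
      (\<integral>\<^sup>+x. epow (dyadic_potential \<alpha> (\<lambda>i y. ennreal (norm (f i y))) x) q * ennreal (v_weight \<omega> x powr (q / p0')) \<partial>lebesgue)
        \<le> ennreal C * epow (\<Prod>j\<in>UNIV. Lp_norm (P j) (\<lambda>x. \<omega> j x powr (P j / p0')) (f j)) q"
      using aw.weighted_potential_bound[OF 2] by blast
    have potential: "(\<integral>\<^sup>+x. epow (dyadic_potential \<alpha> (\<lambda>i y. ennreal (norm (f i y))) x) q * ennreal (v x) \<partial>lebesgue)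
        \<le> ennreal C * epow (\<Prod>j\<in>UNIV. Lp_norm (P j) (w j) (f j)) q"
      if "\<And>j. f j \<in> Lp_space (P j) (w j)" for f
      unfolding v_def w_def by (rule bound) (use that in \<open>simp add: w_def\<close>)
    interpret wk: weighted_kernel K T w v P q \<alpha> CK C
    proof unfold_locales
      have "AE y in lebesgue. \<forall>j. 0 < \<omega> j y" unfolding AE_all_countable using 2(1) by blast
      then show "AE x in lebesgue. 0 < v x"
      proof eventually_elim
        fix x assume "\<forall>j. 0 < \<omega> j x"
        then have "0 < v_weight \<omega> x" unfolding v_weight_def by (intro prod_pos) auto
        then show "0 < v x" by (simp add: v_def)
      qed
    qed (use K_meas CK K_bound T_meas ko.operator_eq_kernel_integral v_meas v_nonneg q C potential in auto)
    show ?thesis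
      by (rule exI[of _ "CK * C powr (1 / q)"], intro conjI exI[of _ "kernel_integral K"])
         (use CK C wk.kernel_integral_extends wk.kernel_integral_Lp_bound in auto)
  qed
  then obtain C S where C: "0 < C" and S: "continuous_extension P w (Lp_norm q v) T S"
    and bound: "\<And>f. (\<forall>j. f j \<in> Lp_space (P j) (w j)) \<Longrightarrow> Lp_norm q v (S f) \<le> ennreal C * (\<Prod>j\<in>UNIV. Lp_norm (P j) (w j) (f j))"
    by blast
  have S_weak: "continuous_extension P w (weak_Lp_norm q v) T S"
    by (rule continuous_extension_weak[OF S q v_nonneg v_meas T_meas])
  have bound_weak: "weak_Lp_norm q v (S f) \<le> ennreal C * (\<Prod>j\<in>UNIV. Lp_norm (P j) (w j) (f j))"
    if f: "\<forall>j. f j \<in> Lp_space (P j) (w j)" for f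
  proof -
    have "S f \<in> borel_measurable lebesgue" using S f by (simp add: continuous_extension_def)
    then have "weak_Lp_norm q v (S f) \<le> Lp_norm q v (S f)"
      by (intro weak_Lp_norm_le_Lp_norm q v_nonneg v_meas)
    also have "\<dots> \<le> ennreal C * (\<Prod>j\<in>UNIV. Lp_norm (P j) (w j) (f j))" by (rule bound[OF f])
    finally show ?thesis .
  qed
  show ?thesis
    unfolding v_def[symmetric] w_def[symmetric]
    using C S S_weak bound bound_weak by (intro conjI impI exI[of _ C] exI[of _ S] allI) (auto simp: w_def)
qed

end
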